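(* Let $q:\mathbb{R}\to\mathbb{C}$ be $1$-periodic, $q\in L_1[0,1]$, Fourier coefficients $q_n$ (with $q_0=0$). Let $p\ge0$ be an integer, $q\in W_1^p[0,1]$, $s$ an integer with $0\le s\le p$ and $q^{(k)}(0)=q^{(k)}(1)$ for $k=0,\dots,s-1$. Suppose that for some $c>0$, $\varepsilon>0$ and all large $n$: $q_{2n}\sim q_{-2n}$, $|q_{2n}|>cn^{-s-1}$, and at least one of $\operatorname{Re}(q_{2n}q_{-2n})\ge0$ or $|\operatorname{Im}(q_{2n}q_{-2n})|\ge\varepsilon|q_{2n}q_{-2n}|$ holds. Then for all sufficiently large $n$ and all $t\in[0,\rho]$ the eigenvalues $\lambda_{n,1}(t),\lambda_{n,2}(t)$ of $L_t(q)$ are simple, and with a suitable numbering, for $j=1,2$, $\lambda_{n,j}(t)=(2\pi n+t)^2+\tfrac12\big(A(\lambda_{n,j}(t),t)+A'(\lambda_{n,j}(t),t)\big)-4\pi nt+(-1)^j\sqrt{D(\lambda_{n,j}(t),t)},$ where the square root has positive real part.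
   Context: $q_n=\int_0^1q(x)e^{-i2\pi nx}dx$. $L_t(q)$ is the operator in $L_2[0,1]$ generated by $-y''+q(x)y$ with $y(1)=e^{it}y(0)$, $y'(1)=e^{it}y'(0)$. $W_1^p[0,1]$: derivatives up to order $p$ in $L_1$. $a_n\sim b_n$: $a_n=O(b_n)$ and $b_n=O(a_n)$. $\rho\in(0,\pi/2)$ fixed and sufficiently small; $D(n,t,\rho)=\{\lambda:|\lambda-(2\pi n+t)^2|<15\pi n\rho\}$; for large $n$, $t\in[0,\rho]$, $\lambda_{n,1}(t),\lambda_{n,2}(t)$ are the two eigenvalues (with multiplicity) of $L_t(q)$ in $D(n,t,\rho)$. For $\lambda\in D(n,t,\rho)$, $k\ge1$: $a_k(\lambda,t)=\sum\frac{q_{n_1}\cdots q_{n_k}q_{-n_1-\dots-n_k}}{\prod_{r=1}^k[\lambda-(2\pi(n-n_1-\dots-n_r)+t)^2]}$, $b_k$ the same with $q_{-n_1-\dots-n_k}$ replaced by $q_{2n-n_1-\dots-n_k}$, summed over $n_r\ne0$, $n_1+\dots+n_r\notin\{0,2n\}$ ($r=1,\dots,k$); $a'_k(\lambda,t)=\sum\frac{q_{n_1}\cdots q_{n_k}q_{-n_1-\dots-n_k}}{\prod_{r=1}^k[\lambda-(2\pi(n+n_1+\dots+n_r)-t)^2]}$, $b'_k$ the same with $q_{-2n-n_1-\dots-n_k}$, summed over $n_r\ne0$, $n_1+\dots+n_r\notin\{0,-2n\}$. $A=\sum a_k$, $B=\sum b_k$, $A'=\sum a'_k$, $B'=\sum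 b'_k$, $C=\frac12(A-A')$, and $D(\lambda,t)=(4\pi nt)^2+q_{2n}q_{-2n}+8\pi ntC(\lambda,t)+C^2(\lambda,t)+q_{2n}B'(\lambda,t)+q_{-2n}B(\lambda,t)+B(\lambda,t)B'(\lambda,t).$ *)

theory Defs
  imports "HOL-Analysis.Analysis" "HOL-Complex_Analysis.Complex_Analysis"
          "HOL-Library.Landau_Symbols"
begin

definition fc :: "(real \<Rightarrow> complex) \<Rightarrow> int \<Rightarrow> complex" where
  "fc q m = integral {0..1} (\<lambda>x. q x * cis (- 2 * pi * real_of_int m * x))"

(* W_1^p[0,1]: d 0 = q a.e. on [0,1], d k is the k-th derivative (d k, k<p, absolutely
   continuous with derivative d (k+1)), all d k (k \<le> p) in L_1[0,1] *)
definition sobolev_W1 :: "nat \<Rightarrow> (real \<Rightarrow> complex) \<Rightarrow> (nat \<Rightarrow> real \<Rightarrow> complex) \<Rightarrow> bool" where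
  "sobolev_W1 p q d \<longleftrightarrow>
     (AE x in lborel. x \<in> {0..1} \<longrightarrow> d 0 x = q x) \<and>
     (\<forall>k\<le>p. d k absolutely_integrable_on {0..1}) \<and>
     (\<forall>k<p. \<forall>x\<in>{0..1}. (d (Suc k) has_integral (d k x - d k 0)) {0..x})"

(* y solves -y'' + q y = lam y on [0,1] (Caratheodory sense), y1 = y' *)
definition ode_sol :: "(real \<Rightarrow> complex) \<Rightarrow> complex \<Rightarrow> (real \<Rightarrow> complex) \<Rightarrow> (real \<Rightarrow> complex) \<Rightarrow> bool" where
  "ode_sol q lam y y1 \<longleftrightarrow>
     (\<forall>x\<in>{0..1}. (y1 has_integral (y x - y 0)) {0..x} \<and>
                 ((\<lambda>s. (q s - lam) * y s) has_integral (y1 x - y1 0)) {0..x})"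

definition is_eigenvalue :: "(real \<Rightarrow> complex) \<Rightarrow> real \<Rightarrow> complex \<Rightarrow> bool" where
  "is_eigenvalue q t lam \<longleftrightarrow>
     (\<exists>y y1. ode_sol q lam y y1 \<and> (\<exists>x\<in>{0..1}. y x \<noteq> 0) \<and>
             y 1 = cis t * y 0 \<and> y1 1 = cis t * y1 0)"

definition hill_F :: "(real \<Rightarrow> complex) \<Rightarrow> complex \<Rightarrow> complex" where
  "hill_F q lam = (THE v. \<exists>y y1 z z1. ode_sol q lam y y1 \<and> y 0 = 1 \<and> y1 0 = 0 \<and>
                                     ode_sol q lam z z1 \<and> z 0 = 0 \<and> z1 0 = 1 \<and>
                                     v = y 1 + z1 1)"

(* characteristic determinant of L_t(q); its zeros are the eigenvalues and the
   order of a zero is the (algebraic) multiplicity of the eigenvalue *)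
definition char_det :: "(real \<Rightarrow> complex) \<Rightarrow> real \<Rightarrow> complex \<Rightarrow> complex" where
  "char_det q t lam = hill_F q lam - 2 * of_real (cos t)"

definition simple_eigenvalue :: "(real \<Rightarrow> complex) \<Rightarrow> real \<Rightarrow> complex \<Rightarrow> bool" where
  "simple_eigenvalue q t lam \<longleftrightarrow>
     is_eigenvalue q t lam \<and> zorder (char_det q t) lam = 1"

definition Dset :: "int \<Rightarrow> real \<Rightarrow> real \<Rightarrow> complex set" where
  "Dset n t \<rho> = {lam. cmod (lam - of_real ((2 * pi * n + t)\<^sup>2)) < 15 * pi * n * \<rho>}"

definition idx :: "nat \<Rightarrow> int set \<Rightarrow> int list set" where
  "idx k E = {ns. length ns = k \<and>
                 (\<forall>r<k. ns ! r \<noteq> 0 \<and> sum_list (take (Suc r) ns) \<notin> E)}"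

definition a_k :: "(real \<Rightarrow> complex) \<Rightarrow> int \<Rightarrow> nat \<Rightarrow> complex \<Rightarrow> real \<Rightarrow> complex" where
  "a_k q n k lam t = (\<Sum>\<^sub>\<infinity>ns\<in>idx k {0, 2*n}.
      (\<Prod>r<k. fc q (ns ! r)) * fc q (- sum_list ns) /
      (\<Prod>r<k. lam - of_real ((2 * pi * of_int (n - sum_list (take (Suc r) ns)) + t)\<^sup>2)))"

definition b_k :: "(real \<Rightarrow> complex) \<Rightarrow> int \<Rightarrow> nat \<Rightarrow> complex \<Rightarrow> real \<Rightarrow> complex" where
  "b_k q n k lam t = (\<Sum>\<^sub>\<infinity>ns\<in>idx k {0, 2*n}.
      (\<Prod>r<k. fc q (ns ! r)) * fc q (2*n - sum_list ns) /
      (\<Prod>r<k. lam - of_real ((2 * pi * of_int (n - sum_list (take (Suc r) ns)) + t)\<^sup>2)))"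

definition a'_k :: "(real \<Rightarrow> complex) \<Rightarrow> int \<Rightarrow> nat \<Rightarrow> complex \<Rightarrow> real \<Rightarrow> complex" where
  "a'_k q n k lam t = (\<Sum>\<^sub>\<infinity>ns\<in>idx k {0, -2*n}.
      (\<Prod>r<k. fc q (ns ! r)) * fc q (- sum_list ns) /
      (\<Prod>r<k. lam - of_real ((2 * pi * of_int (n + sum_list (take (Suc r) ns)) - t)\<^sup>2)))"

definition b'_k :: "(real \<Rightarrow> complex) \<Rightarrow> int \<Rightarrow> nat \<Rightarrow> complex \<Rightarrow> real \<Rightarrow> complex" where
  "b'_k q n k lam t = (\<Sum>\<^sub>\<infinity>ns\<in>idx k {0, -2*n}.
      (\<Prod>r<k. fc q (ns ! r)) * fc q (-2*n - sum_list ns) /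
      (\<Prod>r<k. lam - of_real ((2 * pi * of_int (n + sum_list (take (Suc r) ns)) - t)\<^sup>2)))"

definition A_fun :: "(real \<Rightarrow> complex) \<Rightarrow> int \<Rightarrow> complex \<Rightarrow> real \<Rightarrow> complex" where
  "A_fun q n lam t = (\<Sum>k. a_k q n (Suc k) lam t)"
definition B_fun :: "(real \<Rightarrow> complex) \<Rightarrow> int \<Rightarrow> complex \<Rightarrow> real \<Rightarrow> complex" where
  "B_fun q n lam t = (\<Sum>k. b_k q n (Suc k) lam t)"
definition A'_fun :: "(real \<Rightarrow> complex) \<Rightarrow> int \<Rightarrow> complex \<Rightarrow> real \<Rightarrow> complex" where
  "A'_fun q n lam t = (\<Sum>k. a'_k q n (Suc k) lam t)"
definition B'_fun :: "(real \<Rightarrow> complex) \<Rightarrow> int \<Rightarrow> complex \<Rightarrow> real \<Rightarrow> complex" where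
  "B'_fun q n lam t = (\<Sum>k. b'_k q n (Suc k) lam t)"

definition C_fun :: "(real \<Rightarrow> complex) \<Rightarrow> int \<Rightarrow> complex \<Rightarrow> real \<Rightarrow> complex" where
  "C_fun q n lam t = (A_fun q n lam t - A'_fun q n lam t) / 2"

definition D_fun :: "(real \<Rightarrow> complex) \<Rightarrow> int \<Rightarrow> complex \<Rightarrow> real \<Rightarrow> complex" where
  "D_fun q n lam t =
     of_real ((4 * pi * n * t)\<^sup>2) + fc q (2*n) * fc q (-2*n)
     + of_real (8 * pi * n * t) * C_fun q n lam t + (C_fun q n lam t)\<^sup>2
     + fc q (2*n) * B'_fun q n lam t + fc q (-2*n) * B_fun q n lam t
     + B_fun q n lam t * B'_fun q n lam t"

definition eig_formula :: "(real \<Rightarrow> complex) \<Rightarrow> int \<Rightarrow> real \<Rightarrow> nat \<Rightarrow> complex \<Rightarrow> bool" where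
  "eig_formula q n t j lam \<longleftrightarrow>
     (\<exists>r. r\<^sup>2 = D_fun q n lam t \<and> Re r > 0 \<and>
          lam = of_real ((2 * pi * n + t)\<^sup>2)
                + (A_fun q n lam t + A'_fun q n lam t) / 2
                - of_real (4 * pi * n * t) + (-1) ^ j * r)"

end

theory Submission
  imports Defs
begin

text \<open>Expand a quasi-periodic solution in the exponentials \<open>exp (i (2 \<pi> m + t) x)\<close> and eliminate the modes
  \<open>m \<noteq> \<plusminus>n\<close> by a Neumann series. The sums \<open>A, B, A', B'\<close> are the entries of the resulting \<open>2 \<times> 2\<close>
  system for the modes \<open>\<plusminus>n\<close>, whose determinant vanishes exactly when the eigenvalue formula holds for one
  choice of the sign of the root. Smoothness of \<open>q\<close> makes \<open>B, B'\<close> negligible against \<open>q\<^sub>2\<^sub>n, q\<^sub>-\<^sub>2\<^sub>n\<close>, and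
  \<open>A(\<lambda>, t) - A'(\<lambda>, t) = A(\<lambda>, t) - A(\<lambda>, -t)\<close> is \<open>O(t)\<close>; so \<open>D\<close> avoids the negative half axis and its principal root
  is continuous. For each sign, the formula is then a fixed point equation for a continuous self-map of a disc,
  solved by Brouwer's theorem, and the two solutions differ. Conversely, the characteristic determinant at
  \<open>\<lambda> = (2 \<pi> n + \<zeta>)\<^sup>2\<close> is \<open>2 cos \<zeta> - 2 cos t + O(1/n)\<close>, whose second derivative is close to \<open>-2\<close>, so it has at most two
  zeros counted with multiplicity: the two eigenvalues found are simple and there are no others.\<close>

section \<open>Absolutely continuous functions and integration by parts\<close>

text \<open>As \<open>q\<close> is only in L_1, second derivatives exist almost everywhere only.
  Calculus therefore runs through primitives, and the equation is solved only for large roots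
  \<open>z\<close> of lam in the strip |Im z| < 1, where the Volterra operator halves the sup norm.
  The obstacle is that B and B' must be o(n^(-s-1)), since q_2n is bounded below by just this order.
  Paths through two or more intermediate modes are harmless: each sum over modes gains at least
  n^(-3/4), and the square beats 1/n. The single intermediate mode is critical. For s >= 1 the decay
  of both coefficients and the Riemann-Lebesgue lemma suffice. For s = 0 absolute values lose a
  logarithm, and cancellation has to help: with denominators 4 pi^2 (n^2 - m^2) the sum is a Fourier
  coefficient of an absolutely continuous function. The bound 1/40 on \<rho> keeps each disc within
  2n of (2 pi n)^2, where the nonresonant denominators are at least |n^2 - m^2|. Brouwer's theorem
  gives existence without uniqueness; the count supplies the latter, and the only link it needs is
  that an eigenvalue is a zero of the determinant.\<close>

lemma absolutely_integrable_mult_continuous: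
  fixes f G :: "real \<Rightarrow> complex"
  assumes f: "f absolutely_integrable_on {a..b}" and G: "continuous_on {a..b} G"
  shows "(\<lambda>x. f x * G x) absolutely_integrable_on {a..b}"
proof -
  have bl: "bilinear (\<lambda>(x::complex) (y::complex). y * x)"
    by (auto simp: bilinear_def linear_iff algebra_simps)
  have m: "G \<in> borel_measurable (lebesgue_on {a..b})"
    by (rule continuous_imp_measurable_on_sets_lebesgue[OF G])
      (metis box_real(2) fmeasurableD lmeasurable_cbox)
  have b: "bounded (G ` {a..b})"
    using G compact_continuous_image compact_imp_bounded by blast
  show ?thesis
    using absolutely_integrable_bounded_measurable_product[OF bl m _ b f] by simp
qed

lemma absolutely_integrable_cmult:
  fixes f :: "real \<Rightarrow> complex"
  assumes "f absolutely_integrable_on S"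
  shows "(\<lambda>x. c * f x) absolutely_integrable_on S"
  using set_integrable_mult_right[of c lebesgue S f] assms by auto

lemma norm_integral_mult_le:
  fixes f G :: "real \<Rightarrow> complex"
  assumes f: "f absolutely_integrable_on {a..b}" and G: "continuous_on {a..b} G"
    and M: "\<And>x. x \<in> {a..b} \<Longrightarrow> norm (G x) \<le> M"
  shows "norm (integral {a..b} (\<lambda>x. f x * G x)) \<le> M * integral {a..b} (\<lambda>x. norm (f x))"
proof -
  have fn: "(\<lambda>x. norm (f x)) integrable_on {a..b}"
    using f absolutely_integrable_on_def by blast
  have "norm (integral {a..b} (\<lambda>x. f x * G x)) \<le> integral {a..b} (\<lambda>x. M * norm (f x))"
  proof (rule integral_norm_bound_integral)
    show "(\<lambda>x. f x * G x) integrable_on {a..b}"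
      using absolutely_integrable_mult_continuous[OF f G] absolutely_integrable_on_def by blast
    show "(\<lambda>x. M * norm (f x)) integrable_on {a..b}"
      using integrable_on_mult_right[OF fn] by simp
    show "norm (f x * G x) \<le> M * norm (f x)" if "x \<in> {a..b}" for x
      using M[OF that] by (simp add: norm_mult mult.commute mult_right_mono)
  qed
  then show ?thesis by simp
qed

text \<open>This is absolute continuity of \<open>F\<close> on [0,1] with F' = f almost everywhere,
  stated by integrals so that no differentiation theorem is called for. The constant
  \<open>F 0\<close> stays free.\<close>

definition primitive_on01 :: "(real \<Rightarrow> complex) \<Rightarrow> (real \<Rightarrow> complex) \<Rightarrow> bool" where
  "primitive_on01 f F \<longleftrightarrow> f absolutely_integrable_on {0..1} \<and>
     (\<forall>x\<in>{0..1}. (f has_integral (F x - F 0)) {0..x})"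

lemma primitive_on01_abs: "primitive_on01 f F \<Longrightarrow> f absolutely_integrable_on {0..1}"
  by (simp add: primitive_on01_def)

lemma primitive_on01_at1:
  "primitive_on01 f F \<Longrightarrow> (f has_integral (F 1 - F 0)) {0..1}"
  by (simp add: primitive_on01_def)

lemma primitive_on01_integrable:
  assumes "primitive_on01 f F" "0 \<le> a" "b \<le> 1" shows "f integrable_on {a..b}"
  using assms unfolding primitive_on01_def
  by (meson absolutely_integrable_on_def atLeastatMost_subset_iff integrable_on_subinterval)

lemma primitive_on01_diff:
  assumes P: "primitive_on01 f F" and ab: "0 \<le> a" "a \<le> b" "b \<le> 1"
  shows "(f has_integral (F b - F a)) {a..b}"
proof -
  have 1: "integral {0..b} f = F b - F 0" "integral {0..a} f = F a - F 0"
    using P ab unfolding primitive_on01_def by (auto intro!: integral_unique)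
  have "integral {0..a} f + integral {a..b} f = integral {0..b} f"
    by (rule Henstock_Kurzweil_Integration.integral_combine) (use ab primitive_on01_integrable[OF P, of 0 b] in auto)
  then have "integral {a..b} f = F b - F a" using 1 by (simp add: algebra_simps)
  then show ?thesis
    using primitive_on01_integrable[OF P, of a b] ab by (metis integrable_integral)
qed

lemma primitive_on01_norm_diff:
  assumes P: "primitive_on01 f F" and ab: "0 \<le> a" "a \<le> b" "b \<le> 1"
  shows "norm (F b - F a) \<le> integral {a..b} (\<lambda>x. norm (f x))"
proof -
  have "(\<lambda>x. norm (f x)) integrable_on {a..b}"
    using P ab unfolding primitive_on01_def absolutely_integrable_on_def
    by (meson atLeastatMost_subset_iff integrable_on_subinterval)
  then have "norm (integral {a..b} f) \<le> integral {a..b} (\<lambda>x. norm (f x))"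
    using integral_norm_bound_integral primitive_on01_integrable[OF P] ab by blast
  then show ?thesis using primitive_on01_diff[OF P ab] by (simp add: integral_unique)
qed

lemma primitive_on01_continuous:
  assumes P: "primitive_on01 f F" shows "continuous_on {0..1} F"
proof -
  have "continuous_on {0..1} (\<lambda>x. integral {0..x} f)"
    by (rule indefinite_integral_continuous_1) (rule primitive_on01_integrable[OF P], auto)
  then have "continuous_on {0..1} (\<lambda>x. F 0 + integral {0..x} f)"
    by (intro continuous_intros)
  moreover have "F 0 + integral {0..x} f = F x" if "x \<in> {0..1}" for x
    using P that unfolding primitive_on01_def by (force dest!: bspec integral_unique)
  ultimately show ?thesis by (metis (no_types, lifting) continuous_on_cong)
qed

lemma primitive_on01I:
  assumes f: "f absolutely_integrable_on {0..1}"
  shows "primitive_on01 f (\<lambda>x. c + integral {0..x} f)"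
  unfolding primitive_on01_def
proof (intro conjI ballI f)
  fix x :: real assume "x \<in> {0..1}"
  then have "f integrable_on {0..x}"
    by (meson f absolutely_integrable_on_def atLeastAtMost_iff atLeastatMost_subset_iff
        integrable_on_subinterval order_refl)
  then show "(f has_integral c + integral {0..x} f - (c + integral {0..0} f)) {0..x}"
    by (simp add: has_integral_integral)
qed

lemma primitive_on01_smooth:
  assumes "\<And>x. x \<in> {0..1} \<Longrightarrow> (F has_vector_derivative f x) (at x within {0..1})"
    and "continuous_on {0..1} f"
  shows "primitive_on01 f F"
  unfolding primitive_on01_def
proof (intro conjI ballI)
  show "f absolutely_integrable_on {0..1}"
    using assms(2) absolutely_integrable_continuous_real by blast
  fix x :: real assume x: "x \<in> {0..1}"
  show "(f has_integral F x - F 0) {0..x}"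
    by (rule fundamental_theorem_of_calculus)
      (use x in \<open>auto intro!: has_vector_derivative_within_subset[OF assms(1)]\<close>)
qed

text \<open>Cut [0,X] into equal pieces. Uniform continuity makes every increment of
  \<open>\<phi>\<close> at most e/L, while the increments of \<open>\<gamma>\<close> telescope, so
  the whole increment of \<open>H\<close> is at most e. This replaces an argument by almost
  everywhere differentiation.\<close>

lemma constant_if_increments_quadratic:
  fixes H :: "real \<Rightarrow> complex" and \<phi> \<gamma> :: "real \<Rightarrow> real"
  assumes inc: "\<And>a b. 0 \<le> a \<Longrightarrow> a \<le> b \<Longrightarrow> b \<le> X \<Longrightarrow>
      norm (H b - H a) \<le> C * (\<phi> b - \<phi> a) * (\<gamma> b - \<gamma> a)"
    and cont: "continuous_on {0..X} \<phi>"
    and mono: "\<And>a b. 0 \<le> a \<Longrightarrow> a \<le> b \<Longrightarrow> b \<le> X \<Longrightarrow> \<gamma> a \<le> \<gamma> b"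
    and C: "C \<ge> 0" and X: "0 \<le> X"
  shows "H X = H 0"
proof -
  have "norm (H X - H 0) \<le> e" if e: "e > 0" for e
  proof -
    define L where "L = C * (\<gamma> X - \<gamma> 0) + 1"
    have g0: "\<gamma> X - \<gamma> 0 \<ge> 0" using mono[of 0 X] X by simp
    have Lp: "L > 0" unfolding L_def using C g0 by (simp add: add_nonneg_pos)
    obtain \<delta> where d: "\<delta> > 0" "\<And>x y. x \<in> {0..X} \<Longrightarrow> y \<in> {0..X} \<Longrightarrow> dist y x < \<delta> \<Longrightarrow> dist (\<phi> y) (\<phi> x) < e / L"
      using compact_uniformly_continuous[OF cont] e Lp
      unfolding uniformly_continuous_on_def by (metis compact_Icc divide_pos_pos)
    obtain N :: nat where N: "N > 0" "X / real N < \<delta>"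
    proof -
      obtain n :: nat where n: "X / \<delta> < real n" using reals_Archimedean2 by blast
      have "0 \<le> X / \<delta>" using X d by simp
      with n have "n > 0" by (cases n) auto
      with n have "X / real n < \<delta>" using d by (simp add: field_simps)
      then show ?thesis using that \<open>n > 0\<close> by blast
    qed
    define p where "p i = real i * X / real N" for i :: nat
    have p01: "0 \<le> p i" "p i \<le> p (Suc i)" for i using X N by (auto simp: p_def field_simps)
    have pX: "p i \<le> X" if "i \<le> N" for i using that N X by (simp add: p_def divide_le_eq mult.commute mult_left_mono)
    have step: "norm (H (p (Suc i)) - H (p i)) \<le> C * (e / L) * (\<gamma> (p (Suc i)) - \<gamma> (p i))" if "i < N" for i
    proof -
      have "dist (p (Suc i)) (p i) < \<delta>" using N X by (simp add: p_def dist_real_def diff_divide_distrib[symmetric] algebra_simps)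
      then have "dist (\<phi> (p (Suc i))) (\<phi> (p i)) < e / L"
        using that pX p01 by (intro d) (auto simp: Suc_leI)
      then have "\<phi> (p (Suc i)) - \<phi> (p i) \<le> e / L" by (simp add: dist_real_def)
      moreover have "0 \<le> \<gamma> (p (Suc i)) - \<gamma> (p i)" using mono p01 pX that by (simp add: Suc_leI)
      ultimately have "C * (\<phi> (p (Suc i)) - \<phi> (p i)) * (\<gamma> (p (Suc i)) - \<gamma> (p i)) \<le> C * (e / L) * (\<gamma> (p (Suc i)) - \<gamma> (p i))"
        using C by (intro mult_right_mono mult_left_mono) auto
      then show ?thesis using inc[of "p i" "p (Suc i)"] p01 pX[of "Suc i"] that by (simp add: Suc_leI)
    qed
    have "H (p N) - H (p 0) = (\<Sum>i<N. H (p (Suc i)) - H (p i))"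
      using sum_lessThan_telescope[of "\<lambda>i. H (p i)" N] by simp
    also have "norm \<dots> \<le> (\<Sum>i<N. C * (e / L) * (\<gamma> (p (Suc i)) - \<gamma> (p i)))"
      by (rule sum_norm_le) (use step in auto)
    also have "\<dots> = C * (e / L) * (\<gamma> (p N) - \<gamma> (p 0))"
      by (simp only: sum_distrib_left[symmetric] sum_lessThan_telescope[of "\<lambda>i. \<gamma> (p i)" N])
    also have "\<dots> = (e / L) * (C * (\<gamma> X - \<gamma> 0))" using N by (simp add: p_def)
    also have "\<dots> \<le> (e / L) * L" using e Lp by (intro mult_left_mono) (auto simp: L_def)
    also have "\<dots> = e" using Lp by simp
    finally show ?thesis using N by (simp add: p_def)
  qed
  then have "norm (H X - H 0) \<le> 0" by (meson field_le_epsilon less_eq_real_def add_0 dense_ge)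
  then show ?thesis by simp
qed

text \<open>With \<open>H = F G - \<integral>(f G + F g)\<close>, an increment of \<open>H\<close> over a short interval is
  bounded by a multiple of \<open>\<integral>|f| \<integral>|g|\<close> over that interval, so \<open>H\<close> is constant.\<close>

lemma primitive_on01_mult:
  assumes F: "primitive_on01 f F" and G: "primitive_on01 g G"
  shows "primitive_on01 (\<lambda>s. f s * G s + F s * g s) (\<lambda>x. F x * G x)"
proof -
  let ?h = "\<lambda>s. f s * G s + F s * g s"
  have cF: "continuous_on {0..1} F" and cG: "continuous_on {0..1} G"
    using F G primitive_on01_continuous by blast+
  have aF: "f absolutely_integrable_on {0..1}" and aG: "g absolutely_integrable_on {0..1}"
    using F G primitive_on01_abs by blast+
  have afG: "(\<lambda>s. f s * G s) absolutely_integrable_on {0..1}"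
    using absolutely_integrable_mult_continuous[OF aF cG] .
  have aFg: "(\<lambda>s. F s * g s) absolutely_integrable_on {0..1}"
    using absolutely_integrable_mult_continuous[OF aG cF] by (simp add: mult.commute)
  have ah: "?h absolutely_integrable_on {0..1}"
    using afG aFg by (rule set_integral_add)
  define P where "P x = integral {0..x} ?h" for x
  have P: "primitive_on01 ?h P"
    using primitive_on01I[OF ah, of 0] by (simp add: P_def[abs_def])
  define \<phi> where "\<phi> x = integral {0..x} (\<lambda>s. norm (f s))" for x
  define \<gamma> where "\<gamma> x = integral {0..x} (\<lambda>s. norm (g s))" for x
  have nf: "(\<lambda>s. norm (f s)) integrable_on {a..b}" if "0 \<le> a" "b \<le> 1" for a b
    using aF that unfolding absolutely_integrable_on_def
    by (meson atLeastatMost_subset_iff integrable_on_subinterval)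
  have ng: "(\<lambda>s. norm (g s)) integrable_on {a..b}" if "0 \<le> a" "b \<le> 1" for a b
    using aG that unfolding absolutely_integrable_on_def
    by (meson atLeastatMost_subset_iff integrable_on_subinterval)
  have phi: "integral {a..b} (\<lambda>s. norm (f s)) = \<phi> b - \<phi> a" if "0 \<le> a" "a \<le> b" "b \<le> 1" for a b
    using Henstock_Kurzweil_Integration.integral_combine[of 0 a b "\<lambda>s. norm (f s)"] that nf[of 0 b]
    by (simp add: \<phi>_def)
  have gam: "integral {a..b} (\<lambda>s. norm (g s)) = \<gamma> b - \<gamma> a" if "0 \<le> a" "a \<le> b" "b \<le> 1" for a b
    using Henstock_Kurzweil_Integration.integral_combine[of 0 a b "\<lambda>s. norm (g s)"] that ng[of 0 b]
    by (simp add: \<gamma>_def)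
  have main: "F X * G X - P X = F 0 * G 0 - P 0" if X: "0 \<le> X" "X \<le> 1" for X
  proof (rule constant_if_increments_quadratic[where \<phi> = \<phi> and \<gamma> = \<gamma> and C = 3])
    show "continuous_on {0..X} \<phi>"
      unfolding \<phi>_def by (rule indefinite_integral_continuous_1) (use nf X in auto)
    show "\<gamma> a \<le> \<gamma> b" if "0 \<le> a" "a \<le> b" "b \<le> X" for a b
      using gam[of a b] that X integral_nonneg[OF ng[of a b]] by auto
    fix a b assume ab: "0 \<le> a" "a \<le> b" "b \<le> X"
    then have b1: "b \<le> 1" using X by simp
    define \<Phi> where "\<Phi> = integral {a..b} (\<lambda>s. norm (f s))"
    define \<Gamma> where "\<Gamma> = integral {a..b} (\<lambda>s. norm (g s))"
    have \<Phi>0: "\<Phi> \<ge> 0" "\<Gamma> \<ge> 0" unfolding \<Phi>_def \<Gamma>_def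
      by (rule integral_nonneg, use nf ng ab b1 in auto)+
    have dF: "norm (F s - F a) \<le> \<Phi>" if "s \<in> {a..b}" for s
    proof -
      have "norm (F s - F a) \<le> integral {a..s} (\<lambda>x. norm (f x))"
        by (rule primitive_on01_norm_diff[OF F]) (use that ab b1 in auto)
      also have "\<dots> \<le> \<Phi>" unfolding \<Phi>_def
        by (rule integral_subset_le) (use that ab b1 nf in auto)
      finally show ?thesis .
    qed
    have dG: "norm (G s - G a) \<le> \<Gamma>" if "s \<in> {a..b}" for s
    proof -
      have "norm (G s - G a) \<le> integral {a..s} (\<lambda>x. norm (g x))"
        by (rule primitive_on01_norm_diff[OF G]) (use that ab b1 in auto)
      also have "\<dots> \<le> \<Gamma>" unfolding \<Gamma>_def
        by (rule integral_subset_le) (use that ab b1 ng in auto)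
      finally show ?thesis .
    qed
    have sub: "{a..b} \<subseteq> {0..1}" using ab b1 by auto
    have af: "f absolutely_integrable_on {a..b}" "g absolutely_integrable_on {a..b}"
      using aF aG sub by (auto intro: absolutely_integrable_on_subinterval)
    have c: "continuous_on {a..b} (\<lambda>s. G s - G a)" "continuous_on {a..b} (\<lambda>s. F s - F a)"
      using cF cG sub by (auto intro!: continuous_intros elim: continuous_on_subset)
    have i1: "norm (integral {a..b} (\<lambda>s. f s * (G s - G a))) \<le> \<Gamma> * \<Phi>"
      unfolding \<Phi>_def by (rule norm_integral_mult_le[OF af(1) c(1)]) (use dG in auto)
    have i2: "norm (integral {a..b} (\<lambda>s. g s * (F s - F a))) \<le> \<Phi> * \<Gamma>"
      unfolding \<Gamma>_def by (rule norm_integral_mult_le[OF af(2) c(2)]) (use dF in auto)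
    have hi1: "((\<lambda>s. f s * (G s - G a)) has_integral integral {a..b} (\<lambda>s. f s * (G s - G a))) {a..b}"
      using absolutely_integrable_mult_continuous[OF af(1) c(1)]
      by (simp add: absolutely_integrable_on_def integrable_integral)
    have hi2: "((\<lambda>s. g s * (F s - F a)) has_integral integral {a..b} (\<lambda>s. g s * (F s - F a))) {a..b}"
      using absolutely_integrable_mult_continuous[OF af(2) c(2)]
      by (simp add: absolutely_integrable_on_def integrable_integral)
    \<comment> \<open>Freezing \<open>G\<close> and \<open>F\<close> at the left end
      \<open>a\<close> splits off terms whose integrals are exact increments. They cancel against
      the linear part of F b G b - F a G a, and three products of second order remain.\<close>
    have "((\<lambda>s. f s * (G s - G a) + g s * (F s - F a) + (f s * G a + g s * F a)) has_integral
        integral {a..b} (\<lambda>s. f s * (G s - G a)) + integral {a..b} (\<lambda>s. g s * (F s - F a)) +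
        ((F b - F a) * G a + (G b - G a) * F a)) {a..b}"
      by (intro has_integral_add hi1 hi2 has_integral_mult_left
          primitive_on01_diff[OF F] primitive_on01_diff[OF G]) (use ab b1 in auto)
    moreover have "(\<lambda>s. f s * (G s - G a) + g s * (F s - F a) + (f s * G a + g s * F a)) = ?h"
      by (auto simp: algebra_simps)
    ultimately have "(?h has_integral integral {a..b} (\<lambda>s. f s * (G s - G a)) +
        integral {a..b} (\<lambda>s. g s * (F s - F a)) + ((F b - F a) * G a + (G b - G a) * F a)) {a..b}"
      by simp
    from has_integral_unique[OF primitive_on01_diff[OF P ab(1,2) b1] this]
    have "(F b * G b - P b) - (F a * G a - P a)
      = (F b - F a) * (G b - G a) - integral {a..b} (\<lambda>s. f s * (G s - G a)) - integral {a..b} (\<lambda>s. g s * (F s - F a))"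
      by (simp add: algebra_simps)
    also have "norm \<dots> \<le> norm (F b - F a) * norm (G b - G a) + norm (integral {a..b} (\<lambda>s. f s * (G s - G a)))
       + norm (integral {a..b} (\<lambda>s. g s * (F s - F a)))"
      by (smt (verit) norm_mult norm_triangle_ineq4)
    also have "\<dots> \<le> \<Phi> * \<Gamma> + \<Gamma> * \<Phi> + \<Phi> * \<Gamma>"
      using dF[of b] dG[of b] ab \<Phi>0 i1 i2 by (intro add_mono mult_mono) auto
    also have "\<dots> = 3 * (\<phi> b - \<phi> a) * (\<gamma> b - \<gamma> a)"
      using phi[of a b] gam[of a b] ab b1 by (simp add: \<Phi>_def \<Gamma>_def)
    finally show "norm ((F b * G b - P b) - (F a * G a - P a)) \<le> 3 * (\<phi> b - \<phi> a) * (\<gamma> b - \<gamma> a)" .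
  qed (use X in auto)
  have "(?h has_integral F x * G x - F 0 * G 0) {0..x}" if "x \<in> {0..1}" for x
  proof -
    have "(?h has_integral P x - P 0) {0..x}" using P that unfolding primitive_on01_def by blast
    moreover have "P x - P 0 = F x * G x - F 0 * G 0" using main[of x] that by (simp add: algebra_simps)
    ultimately show ?thesis by simp
  qed
  then show ?thesis using ah by (simp add: primitive_on01_def)
qed

section \<open>Fourier coefficients\<close>

definition fexp :: "int \<Rightarrow> real \<Rightarrow> complex" where
  "fexp m x = cis (2 * pi * real_of_int m * x)"

lemma fexp_0 [simp]: "fexp 0 x = 1" by (simp add: fexp_def)
lemma fexp_at_0 [simp]: "fexp m 0 = 1" by (simp add: fexp_def)
lemma fexp_at_1 [simp]: "fexp m 1 = 1"
  using cis_multiple_2pi[of "real_of_int m"] by (simp add: fexp_def)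
lemma norm_fexp [simp]: "norm (fexp m x) = 1" by (simp add: fexp_def)
lemma fexp_mult: "fexp m x * fexp n x = fexp (m + n) x"
  by (simp add: fexp_def cis_mult algebra_simps)
lemma cnj_fexp: "cnj (fexp m x) = fexp (- m) x" by (simp add: fexp_def cis_cnj)

lemma has_vector_derivative_cis_mult:
  "((\<lambda>x. cis (a * x)) has_vector_derivative \<i> * of_real a * cis (a * x)) (at x within S)"
proof -
  have "((\<lambda>z. exp (\<i> * of_real a * z)) has_field_derivative
      \<i> * of_real a * exp (\<i> * of_real a * of_real x)) (at (of_real x))"
    by (auto intro!: derivative_eq_intros)
  from has_vector_derivative_real_field[OF this] show ?thesis
    by (simp add: cis_conv_exp mult_ac)
qed

lemma fexp_vd: "(fexp m has_vector_derivative (2 * pi * \<i> * of_int m) * fexp m x) (at x within S)"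
  using has_vector_derivative_cis_mult[of "2 * pi * real_of_int m" x S]
  by (simp add: fexp_def[abs_def] mult.assoc mult.left_commute mult.commute)

lemma continuous_on_fexp [continuous_intros]: "continuous_on S (fexp m)"
  by (auto simp: fexp_def[abs_def] intro!: continuous_intros)

lemma primitive_on01_fexp: "primitive_on01 (\<lambda>x. (2 * pi * \<i> * of_int m) * fexp m x) (fexp m)"
  by (rule primitive_on01_smooth, rule fexp_vd) (auto intro!: continuous_intros)

lemma has_integral_fexp: "(fexp m has_integral (if m = 0 then 1 else 0)) {0..1}"
proof (cases "m = 0")
  case True
  then have "fexp m = (\<lambda>x. 1)" by auto
  then show ?thesis using True has_integral_const_real[of "1::complex" 0 1] by simp
next
  case False
  define a where "a = 2 * pi * \<i> * of_int m"
  have a: "a \<noteq> 0" using False by (simp add: a_def)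
  have "((\<lambda>x. a * fexp m x) has_integral 0) {0..1}"
    using primitive_on01_at1[OF primitive_on01_fexp[of m]] by (simp add: a_def)
  then have "((\<lambda>x. inverse a * (a * fexp m x)) has_integral inverse a * 0) {0..1}"
    by (rule has_integral_mult_right)
  moreover have "inverse a * (a * z) = z" for z
    using a by (simp add: mult.assoc[symmetric])
  ultimately show ?thesis using False by simp
qed

lemma fc_fexp_def: "fc f m = integral {0..1} (\<lambda>x. f x * fexp (- m) x)"
  by (simp add: fc_def fexp_def)

lemma fc_ai: "f absolutely_integrable_on {0..1} \<Longrightarrow> (\<lambda>x. f x * fexp m x) absolutely_integrable_on {0..1}"
  by (rule absolutely_integrable_mult_continuous) (auto intro: continuous_intros)

lemma fc_has_integral:
  "f absolutely_integrable_on {0..1} \<Longrightarrow> ((\<lambda>x. f x * fexp (- m) x) has_integral fc f m) {0..1}"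
  unfolding fc_fexp_def using fc_ai[of f "-m"] by (simp add: absolutely_integrable_on_def integrable_integral)

lemma norm_fc_le:
  assumes "f absolutely_integrable_on {0..1}"
  shows "norm (fc f m) \<le> integral {0..1} (\<lambda>x. norm (f x))"
  using norm_integral_mult_le[OF assms, of "fexp (-m)" 1] by (simp add: fc_fexp_def continuous_on_fexp)

lemma fc_diff:
  assumes "f absolutely_integrable_on {0..1}" "g absolutely_integrable_on {0..1}"
  shows "fc (\<lambda>x. f x - g x) m = fc f m - fc g m"
proof -
  have "((\<lambda>x. f x * fexp (-m) x - g x * fexp (-m) x) has_integral fc f m - fc g m) {0..1}"
    using assms by (intro has_integral_diff fc_has_integral)
  then show ?thesis unfolding fc_fexp_def by (simp add: integral_unique left_diff_distrib)
qed

lemma fc_add: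
  assumes "f absolutely_integrable_on {0..1}" "g absolutely_integrable_on {0..1}"
  shows "fc (\<lambda>x. f x + g x) m = fc f m + fc g m"
proof -
  have "((\<lambda>x. f x * fexp (-m) x + g x * fexp (-m) x) has_integral fc f m + fc g m) {0..1}"
    using assms by (intro has_integral_add fc_has_integral)
  then show ?thesis unfolding fc_fexp_def by (simp add: integral_unique distrib_right)
qed

lemma fc_cmult: "fc (\<lambda>x. c * f x) m = c * fc f m"
  unfolding fc_fexp_def by (simp add: mult.assoc)

lemma fc_const: "fc (\<lambda>x. c) m = (if m = 0 then c else 0)"
proof -
  have "integral {0..1} (\<lambda>x. c * fexp (-m) x) = c * (if m = 0 then 1 else 0)"
    using integral_unique[OF has_integral_mult_right[OF has_integral_fexp[of "-m"]], of c] by simp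
  then show ?thesis by (auto simp: fc_fexp_def split: if_splits)
qed

lemma fc_fexp: "fc (\<lambda>x. c * fexp k x) m = (if m = k then c else 0)"
proof -
  have "integral {0..1} (\<lambda>x. c * fexp (k - m) x) = c * (if k - m = 0 then 1 else 0)"
    using integral_unique[OF has_integral_mult_right[OF has_integral_fexp[of "k-m"]], of c] by simp
  then show ?thesis by (auto simp: fc_fexp_def mult.assoc fexp_mult)
qed

lemma fc_mult_fexp: "fc (\<lambda>x. f x * fexp k x) m = fc f (m - k)"
  by (simp add: fc_fexp_def mult.assoc fexp_mult)

text \<open>Integration by parts against \<open>fexp (-m)\<close>; the boundary term vanishes
  because both factors take equal values at 0 and 1. For m = 0 it says that the mean of
  \<open>f\<close> is zero.\<close>

lemma fc_primitive:
  assumes F: "primitive_on01 f F" and per: "F 1 = F 0"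
  shows "fc f m = 2 * pi * \<i> * of_int m * fc F m"
proof -
  have cF: "continuous_on {0..1} F" by (rule primitive_on01_continuous[OF F])
  have aF: "F absolutely_integrable_on {0..1}" using cF by (rule absolutely_integrable_continuous_real)
  define a where "a = 2 * pi * \<i> * of_int (-m)"
  have "primitive_on01 (\<lambda>x. f x * fexp (-m) x + F x * (a * fexp (-m) x)) (\<lambda>x. F x * fexp (-m) x)"
    unfolding a_def by (rule primitive_on01_mult[OF F primitive_on01_fexp])
  from primitive_on01_at1[OF this]
  have 1: "((\<lambda>x. f x * fexp (-m) x + a * (F x * fexp (-m) x)) has_integral 0) {0..1}"
    using per by (simp add: mult.left_commute)
  have 2: "((\<lambda>x. f x * fexp (-m) x + a * (F x * fexp (-m) x)) has_integral fc f m + a * fc F m) {0..1}"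
    by (intro has_integral_add has_integral_mult_right fc_has_integral primitive_on01_abs[OF F] aF)
  have "fc f m + a * fc F m = 0" by (rule has_integral_unique[OF 2 1])
  moreover have "a = - (2 * pi * \<i> * of_int m)" by (simp add: a_def)
  ultimately show ?thesis by (simp add: eq_neg_iff_add_eq_0)
qed

lemma integral_mult_trig_sum:
  assumes f: "f absolutely_integrable_on {0..1}" and "finite S"
  shows "((\<lambda>x. f x * (\<Sum>m\<in>S. c m * fexp m x)) has_integral (\<Sum>m\<in>S. c m * fc f (- m))) {0..1}"
proof -
  have "((\<lambda>x. \<Sum>m\<in>S. c m * (f x * fexp m x)) has_integral (\<Sum>m\<in>S. c m * fc f (- m))) {0..1}"
    using fc_has_integral[OF f, of "-m" for m]
    by (intro has_integral_sum assms(2) has_integral_mult_right) auto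
  then show ?thesis by (simp add: sum_distrib_left mult_ac)
qed

section \<open>Bessel's inequality and the Riemann-Lebesgue lemma\<close>

lemma mult_cnj_eq_norm_sq: "z * cnj z = (complex_of_real (norm z))\<^sup>2"
  by (metis complex_norm_square of_real_power)

text \<open>Let T be the partial sum over \<open>S\<close>. Both the integral of f cnj T and that of
  |T|^2 equal the sum \<open>\<Sigma>\<close>, and Re (f cnj T) <= (|T|^2 + M^2) / 2 pointwise gives
  \<Sigma> <= (\<Sigma> + M^2) / 2. The sup bound \<open>M\<close> stands in for the L_2 norm, so
  |f|^2 is never integrated.\<close>

lemma bessel:
  assumes f: "f absolutely_integrable_on {0..1}" and M: "\<And>x. x \<in> {0..1} \<Longrightarrow> norm (f x) \<le> M"
    and S: "finite S"
  shows "(\<Sum>m\<in>S. (norm (fc f m))\<^sup>2) \<le> M\<^sup>2"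
proof -
  define \<Sigma> where "\<Sigma> = (\<Sum>m\<in>S. (norm (fc f m))\<^sup>2)"
  define T where "T x = (\<Sum>m\<in>S. fc f m * fexp m x)" for x
  have cT: "continuous_on {0..1} T" unfolding T_def by (intro continuous_intros)
  have cnjT: "cnj (T x) = (\<Sum>m\<in>uminus ` S. cnj (fc f (-m)) * fexp m x)" for x
    by (simp add: T_def cnj_fexp sum.reindex)
  have "((\<lambda>x. f x * cnj (T x)) has_integral (\<Sum>m\<in>uminus ` S. cnj (fc f (-m)) * fc f (- m))) {0..1}"
    unfolding cnjT by (rule integral_mult_trig_sum[OF f]) (use S in auto)
  also have "(\<Sum>m\<in>uminus ` S. cnj (fc f (-m)) * fc f (- m)) = of_real \<Sigma>"
    by (simp add: \<Sigma>_def sum.reindex mult_cnj_eq_norm_sq mult.commute)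
  finally have 1: "((\<lambda>x. f x * cnj (T x)) has_integral of_real \<Sigma>) {0..1}" .
  have aT: "T absolutely_integrable_on {0..1}" using cT by (rule absolutely_integrable_continuous_real)
  have fcT: "fc T m = fc f m" if "m \<in> S" for m
  proof -
    have "((\<lambda>x. fexp (-m) x * (\<Sum>k\<in>S. fc f k * fexp k x)) has_integral (\<Sum>k\<in>S. fc f k * fc (fexp (-m)) (- k))) {0..1}"
      by (rule integral_mult_trig_sum) (auto intro!: absolutely_integrable_continuous_real continuous_intros S)
    moreover have "fc (fexp (-m)) (-k) = (if k = m then 1 else 0)" for k
      using fc_fexp[of 1 "-m" "-k"] by simp
    then have "(\<Sum>k\<in>S. fc f k * fc (fexp (-m)) (- k)) = fc f m"
      using that S by (simp add: if_distrib[where f = "\<lambda>y. _ * y"] cong: if_cong)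
    ultimately show ?thesis by (simp add: fc_fexp_def T_def[abs_def] mult.commute integral_unique)
  qed
  have "((\<lambda>x. T x * cnj (T x)) has_integral (\<Sum>m\<in>uminus ` S. cnj (fc f (-m)) * fc T (- m))) {0..1}"
    unfolding cnjT by (rule integral_mult_trig_sum[OF aT]) (use S in auto)
  also have "(\<Sum>m\<in>uminus ` S. cnj (fc f (-m)) * fc T (- m)) = of_real \<Sigma>"
    by (simp add: \<Sigma>_def sum.reindex mult_cnj_eq_norm_sq fcT mult.commute cong: sum.cong)
  finally have 2: "((\<lambda>x. Re (T x * cnj (T x))) has_integral \<Sigma>) {0..1}"
    by (metis has_integral_Re Re_complex_of_real)
  have ReT: "Re (T x * cnj (T x)) = (norm (T x))\<^sup>2" for x
    by (metis Re_complex_of_real complex_norm_square)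
  have 3: "((\<lambda>x. ((norm (T x))\<^sup>2 + M\<^sup>2) / 2) has_integral (\<Sigma> + M\<^sup>2) / 2) {0..1}"
    by (intro has_integral_divide has_integral_add)
      (use 2 ReT has_integral_const_real[of "M\<^sup>2" 0 1] in auto)
  have "\<Sigma> \<le> (\<Sigma> + M\<^sup>2) / 2"
  proof (rule has_integral_le[OF has_integral_Re[OF 1, simplified] 3])
    fix x :: real assume x: "x \<in> {0..1}"
    have "Re (f x * cnj (T x)) \<le> norm (f x) * norm (T x)"
      using complex_Re_le_cmod[of "f x * cnj (T x)"] by (simp add: norm_mult)
    also have "\<dots> \<le> M * norm (T x)" using M[OF x] by (simp add: mult_right_mono)
    also have "\<dots> \<le> ((norm (T x))\<^sup>2 + M\<^sup>2) / 2"
      using sum_squares_bound[of M "norm (T x)"] by (simp add: algebra_simps)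
    finally show "Re (f x) * Re (T x) + Im (f x) * Im (T x) \<le> ((norm (T x))\<^sup>2 + M\<^sup>2) / 2" by simp
  qed
  then show ?thesis by (simp add: \<Sigma>_def)
qed

text \<open>Cut off \<open>f\<close> where it exceeds k; |f| dominates the difference, which
  vanishes pointwise for large k. Bessel's inequality is for bounded functions, and this brings L_1
  functions within its reach.\<close>

lemma truncation_L1:
  fixes f :: "real \<Rightarrow> complex"
  assumes f: "f absolutely_integrable_on {0..1}" and e: "e > 0"
  obtains g and M :: real where "g absolutely_integrable_on {0..1}" "\<And>x. norm (g x) \<le> M"
    "integral {0..1} (\<lambda>x. norm (f x - g x)) < e"
proof -
  define g where "g k x = (if norm (f x) \<le> real k then f x else 0)" for k :: nat and x
  have mf: "f \<in> borel_measurable (lebesgue_on {0..1})"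
    using absolutely_integrable_imp_borel_measurable[OF f]
    by (metis box_real(2) fmeasurableD lmeasurable_cbox)
  have nf: "(\<lambda>x. norm (f x)) integrable_on {0..1}"
    using f absolutely_integrable_on_def by blast
  have ag: "g k absolutely_integrable_on {0..1}" for k
  proof (rule measurable_bounded_by_integrable_imp_absolutely_integrable[OF _ _ nf])
    show "g k \<in> borel_measurable (lebesgue_on {0..1})"
      unfolding g_def by (rule measurable_If) (use mf in measurable)
  qed (auto simp: g_def)
  have "(\<lambda>k. integral {0..1} (\<lambda>x. norm (f x - g k x))) \<longlonglongrightarrow> integral {0..1} (\<lambda>x::real. 0)"
  proof (rule dominated_convergence(2)[OF _ nf])
    show "(\<lambda>x. norm (f x - g k x)) integrable_on {0..1}" for k
      using set_integral_diff(1)[OF f ag[of k]] unfolding absolutely_integrable_on_def by (rule conjunct2)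
    show "norm (norm (f x - g k x)) \<le> norm (f x)" for k x by (auto simp: g_def)
    show "(\<lambda>k. norm (f x - g k x)) \<longlonglongrightarrow> 0" for x
    proof (rule tendsto_eventually)
      obtain k0 :: nat where k0: "norm (f x) \<le> real k0" using real_arch_simple by blast
      have "norm (f x) \<le> real k" if "k0 \<le> k" for k
        using k0 that by linarith
      then have "\<forall>\<^sub>F k in sequentially. norm (f x) \<le> real k"
        by (rule eventually_sequentiallyI)
      then show "\<forall>\<^sub>F k in sequentially. norm (f x - g k x) = 0"
        by eventually_elim (simp add: g_def)
    qed
  qed
  then have "\<forall>\<^sub>F k in sequentially. integral {0..1} (\<lambda>x. norm (f x - g k x)) < e"
    using e by (simp add: order_tendstoD(2))
  from eventually_happens[OF this] obtain k where "integral {0..1} (\<lambda>x. norm (f x - g k x)) < e"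
    by auto
  then show ?thesis by (intro that[of "g k" "real k"] ag) (auto simp: g_def)
qed

text \<open>A bounded \<open>g\<close> within e/2 of \<open>f\<close> in L_1 has all its
  coefficients within e/2 of those of \<open>f\<close>, and by Bessel only finitely many
  coefficients of \<open>g\<close> can reach e/2.\<close>

lemma riemann_lebesgue_finite:
  assumes f: "f absolutely_integrable_on {0..1}" and e: "e > 0"
  shows "finite {m. norm (fc f m) \<ge> e}"
proof -
  obtain g and M :: real where g: "g absolutely_integrable_on {0..1}" "\<And>x. norm (g x) \<le> M"
    "integral {0..1} (\<lambda>x. norm (f x - g x)) < e / 2"
    using truncation_L1[OF f, of "e/2"] e by auto
  have near: "norm (fc f m - fc g m) < e / 2" for m
    using norm_fc_le[OF set_integral_diff(1)[OF f g(1)], of m] g(3) fc_diff[OF f g(1), of m] by simp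
  have "finite {m. norm (fc g m) \<ge> e / 2}"
  proof (rule ccontr)
    assume inf: "infinite {m. norm (fc g m) \<ge> e / 2}"
    obtain n :: nat where n: "M\<^sup>2 < real n * (e/2)\<^sup>2"
      using reals_Archimedean3[of "(e/2)\<^sup>2"] e by auto
    obtain S where S: "S \<subseteq> {m. norm (fc g m) \<ge> e / 2}" "finite S" "card S = n"
      using infinite_arbitrarily_large[OF inf] by metis
    have "real n * (e/2)\<^sup>2 = (\<Sum>m\<in>S. (e/2)\<^sup>2)" using S by simp
    also have "\<dots> \<le> (\<Sum>m\<in>S. (norm (fc g m))\<^sup>2)"
      using S e by (intro sum_mono power_mono) auto
    also have "\<dots> \<le> M\<^sup>2" by (rule bessel[OF g(1) _ S(2)]) (use g in auto)
    finally show False using n by simp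
  qed
  moreover have "{m. norm (fc f m) \<ge> e} \<subseteq> {m. norm (fc g m) \<ge> e / 2}"
  proof clarify
    fix m assume "e \<le> norm (fc f m)"
    then show "e / 2 \<le> norm (fc g m)"
      using near[of m] norm_triangle_ineq[of "fc f m - fc g m" "fc g m"] by simp
  qed
  ultimately show ?thesis by (rule rev_finite_subset)
qed

lemma riemann_lebesgue:
  assumes f: "f absolutely_integrable_on {0..1}" and e: "e > 0"
  obtains N :: nat where "\<And>m. \<bar>m\<bar> \<ge> int N \<Longrightarrow> norm (fc f m) < e"
proof -
  have "bdd_above (abs ` {m. norm (fc f m) \<ge> e})"
    using riemann_lebesgue_finite[OF f e] by (intro bdd_above_finite finite_imageI)
  then obtain b where "\<And>m. norm (fc f m) \<ge> e \<Longrightarrow> \<bar>m\<bar> \<le> b"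
    unfolding bdd_above_def by blast
  note b = this
  have "norm (fc f m) < e" if "\<bar>m\<bar> \<ge> int (nat (b + 1))" for m
    using b[of m] that by (cases "norm (fc f m) < e") auto
  then show ?thesis by (rule that)
qed

section \<open>Trigonometric polynomials, Parseval's identity and absolutely convergent Fourier
  series\<close>

inductive trigpoly :: "(real \<Rightarrow> complex) \<Rightarrow> bool" where
  fexp: "trigpoly (\<lambda>x. c * fexp m x)"
| add: "trigpoly f \<Longrightarrow> trigpoly g \<Longrightarrow> trigpoly (\<lambda>x. f x + g x)"

lemma trigpoly_const: "trigpoly (\<lambda>x. c)"
  using trigpoly.fexp[of c 0] by simp

lemma trigpoly_mult: "trigpoly f \<Longrightarrow> trigpoly g \<Longrightarrow> trigpoly (\<lambda>x. f x * g x)"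
proof (induction rule: trigpoly.induct)
  case (fexp c m)
  from fexp.prems show ?case
  proof (induction rule: trigpoly.induct)
    case (fexp c' m')
    have "(\<lambda>x. c * fexp m x * (c' * fexp m' x)) = (\<lambda>x. (c * c') * fexp (m + m') x)"
      by (simp add: fexp_mult[symmetric] mult_ac)
    then show ?case using trigpoly.fexp[of "c * c'" "m + m'"] by (simp only:)
  next
    case (add f g)
    then show ?case using trigpoly.add[OF add.IH] by (simp add: algebra_simps)
  qed
next
  case (add f g)
  then show ?case using trigpoly.add[OF add.IH[OF add.prems]] by (simp add: algebra_simps)
qed

lemma trigpoly_continuous: "trigpoly f \<Longrightarrow> continuous_on S f"
  by (induction rule: trigpoly.induct) (auto intro!: continuous_intros)

text \<open>The coefficients of \<open>T\<close> vanish off a finite set, so every finite sum past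
  that set has the same value. The form \<open>F \<subseteq> F'\<close> is that of the filter behind
  \<open>has_sum\<close>, as the proof of \<open>parseval\<close> requires.\<close>

lemma trigpoly_parseval:
  assumes "trigpoly T" and v: "v absolutely_integrable_on {0..1}"
  shows "\<exists>F. finite F \<and> (\<forall>F'. finite F' \<longrightarrow> F \<subseteq> F' \<longrightarrow>
     ((\<lambda>x. v x * T x) has_integral (\<Sum>k\<in>F'. fc T k * fc v (- k))) {0..1})"
  using assms(1)
proof (induction rule: trigpoly.induct)
  case (fexp c m)
  have "((\<lambda>x. v x * (c * fexp m x)) has_integral (\<Sum>k\<in>F'. fc (\<lambda>x. c * fexp m x) k * fc v (- k))) {0..1}"
    if "finite F'" "{m} \<subseteq> F'" for F'
  proof -
    have "(\<Sum>k\<in>F'. fc (\<lambda>x. c * fexp m x) k * fc v (- k)) = c * fc v (-m)"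
      using that by (simp add: fc_fexp if_distrib[where f = "\<lambda>y. y * _"] cong: if_cong)
    moreover have "((\<lambda>x. c * (v x * fexp m x)) has_integral c * fc v (-m)) {0..1}"
      using fc_has_integral[OF v, of "-m"] by (intro has_integral_mult_right) simp
    ultimately show ?thesis by (simp add: mult_ac)
  qed
  then show ?case by (intro exI[of _ "{m}"]) auto
next
  case (add f g)
  obtain F where F: "finite F" "\<forall>F'. finite F' \<longrightarrow> F \<subseteq> F' \<longrightarrow>
     ((\<lambda>x. v x * f x) has_integral (\<Sum>k\<in>F'. fc f k * fc v (- k))) {0..1}"
    using add.IH(1) by (elim exE conjE)
  obtain G where G: "finite G" "\<forall>F'. finite F' \<longrightarrow> G \<subseteq> F' \<longrightarrow>
     ((\<lambda>x. v x * g x) has_integral (\<Sum>k\<in>F'. fc g k * fc v (- k))) {0..1}"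
    using add.IH(2) by (elim exE conjE)
  have "fc (\<lambda>x. f x + g x) k = fc f k + fc g k" for k
    using add.hyps by (intro fc_add absolutely_integrable_continuous_real trigpoly_continuous)
  note fcadd = this
  show ?case
  proof (intro exI conjI allI impI)
    show "finite (F \<union> G)" using F(1) G(1) by simp
    fix F' :: "int set" assume F': "finite F'" "F \<union> G \<subseteq> F'"
    have "((\<lambda>x. v x * f x + v x * g x) has_integral
        (\<Sum>k\<in>F'. fc f k * fc v (- k)) + (\<Sum>k\<in>F'. fc g k * fc v (- k))) {0..1}"
      using F' by (intro has_integral_add F(2)[rule_format] G(2)[rule_format]) auto
    then show "((\<lambda>x. v x * (f x + g x)) has_integral (\<Sum>k\<in>F'. fc (\<lambda>x. f x + g x) k * fc v (- k))) {0..1}"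
      by (simp only: fcadd distrib_left distrib_right sum.distrib)
  qed
qed

lemma real_polynomial_trigpoly:
  "real_polynomial_function p \<Longrightarrow> trigpoly (\<lambda>x. of_real (p (fexp 1 x)))"
proof (induction rule: real_polynomial_function.induct)
  case (linear f)
  interpret f: bounded_linear f by fact
  \<comment> \<open>A real-linear functional on the complex plane is a combination of z and cnj z,
    and on the circle cnj z is \<open>fexp (-1) x\<close>.\<close>
  have "of_real (f (fexp 1 x)) = ((f 1 - \<i> * f \<i>) / 2) * fexp 1 x + ((f 1 + \<i> * f \<i>) / 2) * fexp (-1) x" for x
  proof -
    define z where "z = fexp 1 x"
    have z: "z = Re z *\<^sub>R 1 + Im z *\<^sub>R \<i>" by (simp add: complex_eq_iff)
    have "f z = Re z * f 1 + Im z * f \<i>"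
      by (subst z) (simp only: f.add f.scaleR real_scaleR_def)
    then have "of_real (f z) = ((f 1 - \<i> * f \<i>) / 2) * z + ((f 1 + \<i> * f \<i>) / 2) * cnj z"
      by (simp add: complex_eq_iff field_simps)
    then show ?thesis by (simp add: z_def cnj_fexp)
  qed
  then have eq: "(\<lambda>x. complex_of_real (f (fexp 1 x))) =
     (\<lambda>x. ((f 1 - \<i> * f \<i>) / 2) * fexp 1 x + ((f 1 + \<i> * f \<i>) / 2) * fexp (-1) x)" by (rule ext)
  show ?case
    by (rule ssubst[where P = trigpoly, OF eq]) (rule trigpoly.add[OF trigpoly.fexp trigpoly.fexp])
next
  case (const c)
  show ?case by (rule trigpoly_const)
next
  case (add f g)
  from trigpoly.add[OF add.IH] show ?case by simp
next
  case (mult f g)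
  from trigpoly_mult[OF mult.IH] show ?case by simp
qed

lemma polynomial_function_trigpoly:
  fixes g :: "complex \<Rightarrow> complex"
  assumes "polynomial_function g"
  shows "trigpoly (\<lambda>x. g (fexp 1 x))"
proof -
  have "real_polynomial_function (Re \<circ> g)" "real_polynomial_function (Im \<circ> g)"
    using assms bounded_linear_Re bounded_linear_Im unfolding polynomial_function_def by blast+
  then have "trigpoly (\<lambda>x. of_real (Re (g (fexp 1 x)))) \<and> trigpoly (\<lambda>x. of_real (Im (g (fexp 1 x))))"
    using real_polynomial_trigpoly by fastforce
  then have "trigpoly (\<lambda>x. of_real (Re (g (fexp 1 x))) + \<i> * of_real (Im (g (fexp 1 x))))"
    using trigpoly.add trigpoly_mult[OF trigpoly_const] by blast
  then show ?thesis by (simp add: complex_eq[symmetric])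
qed

text \<open>A loop is a continuous function on the unit circle, where Stone-Weierstrass supplies a
  polynomial in Re z and Im z; along z = \<open>fexp 1 x\<close> this is a trigonometric
  polynomial.\<close>

lemma trigpoly_dense:
  fixes u :: "real \<Rightarrow> complex"
  assumes u: "continuous_on {0..1} u" "u 1 = u 0" and e: "e > 0"
  obtains T where "trigpoly T" "\<And>x. x \<in> {0..1} \<Longrightarrow> norm (u x - T x) < e"
proof -
  let ?U = "u \<circ> (\<lambda>z. Arg2pi z / (2 * pi))"
  \<comment> \<open>The homotopy is trivial: it is only a way to obtain that \<open>u\<close>
    composed with the angle is continuous on the circle, also across the jump of
    \<open>Arg2pi\<close> at 1.\<close>
  have "homotopic_loops UNIV u u"
    using u by (simp add: path_def pathstart_def pathfinish_def homotopic_loops_refl)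
  then have "continuous_on (sphere 0 1) ?U"
    using homotopic_loops_imp_homotopic_circlemaps homotopic_with_imp_continuous by blast
  then obtain g where g: "polynomial_function g" "\<And>z. z \<in> sphere 0 1 \<Longrightarrow> norm (?U z - g z) < e"
    using Stone_Weierstrass_polynomial_function[of "sphere (0::complex) 1" ?U e] e by auto
  have U: "?U (fexp 1 x) = u x" if "x \<in> {0..1}" for x
  proof (cases "x = 1")
    case True
    then show ?thesis using u by (simp add: Arg2pi_of_real[of 1, simplified])
  next
    case False
    have "Arg2pi (fexp 1 x) = 2 * pi * x"
      by (rule Arg2pi_unique[of 1]) (use that False in \<open>auto simp: fexp_def cis_conv_exp mult_ac\<close>)
    then show ?thesis by simp
  qed
  have "norm (u x - g (fexp 1 x)) < e" if "x \<in> {0..1}" for x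
    using g(2)[of "fexp 1 x"] U[OF that] by simp
  then show ?thesis by (rule that[OF polynomial_function_trigpoly[OF g(1)]])
qed

text \<open>The pairing is bilinear, without conjugation, hence the index \<open>- k\<close>.
  Approximate \<open>u\<close> uniformly by a trigonometric polynomial \<open>T\<close>, for which
  the identity is finite. The error of the sum is bounded by Cauchy-Schwarz with Bessel for
  \<open>u - T\<close> and \<open>v\<close>, that of the integral by the sup norm.\<close>

lemma parseval:
  fixes u v :: "real \<Rightarrow> complex"
  assumes u: "continuous_on {0..1} u" "u 1 = u 0" and v: "continuous_on {0..1} v"
  shows "((\<lambda>k. fc u k * fc v (- k)) has_sum integral {0..1} (\<lambda>x. v x * u x)) UNIV"
  unfolding has_sum_def tendsto_iff eventually_finite_subsets_at_top
proof (intro allI impI)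
  fix e :: real assume e: "e > 0"
  have au: "u absolutely_integrable_on {0..1}" and av: "v absolutely_integrable_on {0..1}"
    using u v by (auto intro: absolutely_integrable_continuous_real)
  have "compact (v ` {0..1})" using v compact_continuous_image by blast
  then have "bounded (v ` {0..1})" by (rule compact_imp_bounded)
  then obtain V where V: "V > 0" "\<And>x. x \<in> {0..1} \<Longrightarrow> norm (v x) \<le> V"
    unfolding bounded_pos by auto
  \<comment> \<open>Two errors of size \<open>e' * V\<close> arise, which together make 2e/3 <
    e.\<close>
  define e' where "e' = e / (3 * V)"
  have e': "e' > 0" using e V by (simp add: e'_def)
  obtain T where T: "trigpoly T" "\<And>x. x \<in> {0..1} \<Longrightarrow> norm (u x - T x) < e'"
    using trigpoly_dense[OF u e'] by blast
  have cT: "continuous_on {0..1} T" by (rule trigpoly_continuous[OF T(1)])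
  have aT: "T absolutely_integrable_on {0..1}" using cT by (rule absolutely_integrable_continuous_real)
  obtain F where F: "finite F" "\<forall>F'. finite F' \<longrightarrow> F \<subseteq> F' \<longrightarrow>
     ((\<lambda>x. v x * T x) has_integral (\<Sum>k\<in>F'. fc T k * fc v (- k))) {0..1}"
    using trigpoly_parseval[OF T(1) av] by (elim exE conjE)
  have auT: "(\<lambda>x. u x - T x) absolutely_integrable_on {0..1}" using au aT by (rule set_integral_diff)
  have "dist (\<Sum>k\<in>F'. fc u k * fc v (- k)) (integral {0..1} (\<lambda>x. v x * u x)) < e"
    if F': "finite F'" "F \<subseteq> F'" for F'
  proof -
    define \<sigma> where "\<sigma> = (\<Sum>k\<in>F'. (fc u k - fc T k) * fc v (- k))"
    have i: "((\<lambda>x. v x * (u x - T x)) has_integral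
        (integral {0..1} (\<lambda>x. v x * u x) - (\<Sum>k\<in>F'. fc T k * fc v (- k)))) {0..1}"
    proof -
      have "((\<lambda>x. v x * u x) has_integral integral {0..1} (\<lambda>x. v x * u x)) {0..1}"
        using absolutely_integrable_mult_continuous[OF av u(1)]
        by (simp add: absolutely_integrable_on_def integrable_integral)
      from has_integral_diff[OF this F(2)[rule_format, OF F']] show ?thesis by (simp add: algebra_simps)
    qed
    have n1: "norm (integral {0..1} (\<lambda>x. v x * u x) - (\<Sum>k\<in>F'. fc T k * fc v (- k))) \<le> V * e'"
    proof -
      have "norm (integral {0..1} (\<lambda>x. v x * (u x - T x))) \<le> e' * integral {0..1} (\<lambda>x. norm (v x))"
        by (rule norm_integral_mult_le[OF av]) (use u cT T in \<open>auto intro!: continuous_intros less_imp_le\<close>)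
      also have "integral {0..1} (\<lambda>x. norm (v x)) \<le> integral {0..1} (\<lambda>x::real. V)"
        by (rule integral_le) (use V v in \<open>auto intro!: integrable_continuous_real continuous_intros\<close>)
      finally show ?thesis using i e' by (simp add: integral_unique mult_left_mono mult.commute)
    qed
    have n2: "norm \<sigma> \<le> e' * V"
    proof -
      have "norm \<sigma> \<le> (\<Sum>k\<in>F'. \<bar>norm (fc u k - fc T k)\<bar> * \<bar>norm (fc v (- k))\<bar>)"
        unfolding \<sigma>_def by (rule sum_norm_le) (simp add: norm_mult)
      also have "\<dots> \<le> L2_set (\<lambda>k. norm (fc u k - fc T k)) F' * L2_set (\<lambda>k. norm (fc v (- k))) F'"
        by (rule L2_set_mult_ineq)
      also have "\<dots> \<le> e' * V"
      proof (rule mult_mono)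
        have "(\<Sum>k\<in>F'. (norm (fc u k - fc T k))\<^sup>2) \<le> e'\<^sup>2"
          using bessel[OF auT _ F'(1), of e'] T(2) fc_diff[OF au aT] by (simp add: less_imp_le)
        then show "L2_set (\<lambda>k. norm (fc u k - fc T k)) F' \<le> e'"
          unfolding L2_set_def using e' by (simp add: real_le_lsqrt)
        have "(\<Sum>k\<in>F'. (norm (fc v (-k)))\<^sup>2) \<le> V\<^sup>2"
          using bessel[OF av _ finite_imageI[OF F'(1)], of V uminus] V(2)
          by (simp add: sum.reindex)
        then show "L2_set (\<lambda>k. norm (fc v (-k))) F' \<le> V"
          unfolding L2_set_def using V(1) by (simp add: real_le_lsqrt)
      qed (use e' in \<open>auto simp: L2_set_nonneg\<close>)
      finally show ?thesis .
    qed
    have "(\<Sum>k\<in>F'. fc u k * fc v (- k)) - integral {0..1} (\<lambda>x. v x * u x)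
       = \<sigma> - (integral {0..1} (\<lambda>x. v x * u x) - (\<Sum>k\<in>F'. fc T k * fc v (- k)))"
      by (simp add: \<sigma>_def left_diff_distrib sum_subtractf)
    then have "dist (\<Sum>k\<in>F'. fc u k * fc v (- k)) (integral {0..1} (\<lambda>x. v x * u x)) \<le> e' * V + V * e'"
      by (simp only: dist_norm) (rule order_trans[OF norm_triangle_ineq4 add_mono[OF n2 n1]])
    also have "\<dots> < e" using e V by (simp add: e'_def field_simps)
    finally show ?thesis .
  qed
  then show "\<exists>X. finite X \<and> X \<subseteq> UNIV \<and> (\<forall>Y. finite Y \<and> X \<subseteq> Y \<and> Y \<subseteq> UNIV \<longrightarrow>
      dist (\<Sum>k\<in>Y. fc u k * fc v (- k)) (integral {0..1} (\<lambda>x. v x * u x)) < e)"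
    using F(1) by auto
qed

text \<open>Parseval with v = cnj u makes the integral of |u|^2 zero, and a continuous nonnegative
  function with zero integral vanishes everywhere, also at the end points.\<close>

lemma fourier_unique:
  fixes u :: "real \<Rightarrow> complex"
  assumes u: "continuous_on {0..1} u" "u 1 = u 0" and z: "\<And>m. fc u m = 0" and x: "x \<in> {0..1}"
  shows "u x = 0"
proof -
  have cc: "continuous_on {0..1} (\<lambda>x. cnj (u x))" using u by (intro continuous_intros)
  have "((\<lambda>k::int. 0) has_sum integral {0..1} (\<lambda>x. cnj (u x) * u x)) UNIV"
    using parseval[OF u cc] by (simp only: z mult_zero_left)
  then have "integral {0..1} (\<lambda>x. cnj (u x) * u x) = 0"
    by (rule has_sum_unique) (rule has_sum_0, rule refl)
  moreover have "cnj (u x) * u x = complex_of_real ((norm (u x))\<^sup>2)" for x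
    using mult_cnj_eq_norm_sq[of "u x"] by (simp add: mult.commute)
  ultimately have 0: "integral {0..1} (\<lambda>x. complex_of_real ((norm (u x))\<^sup>2)) = 0" by simp
  have c: "continuous_on {0..1} (\<lambda>x. (norm (u x))\<^sup>2)" using u by (intro continuous_intros)
  have i: "(\<lambda>x. (norm (u x))\<^sup>2) integrable_on {0..1}"
    using c by (rule integrable_continuous_real)
  have "((\<lambda>x. complex_of_real ((norm (u x))\<^sup>2)) has_integral
      complex_of_real (integral {0..1} (\<lambda>x. (norm (u x))\<^sup>2))) {0..1}"
    by (rule has_integral_of_real[OF integrable_integral[OF i]])
  from integral_unique[OF this] 0 have "integral {0..1} (\<lambda>x. (norm (u x))\<^sup>2) = 0"
    by simp
  then have "(norm (u x))\<^sup>2 = 0"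
    using iffD1[OF integral_eq_0_iff[OF c zero_less_one]] x by fastforce
  then show ?thesis by simp
qed

text \<open>Absolute summability makes the series converge uniformly, so it may be integrated term
  by term against an L_1 function. This yields the convolution formula for the product f Y; the
  choice f = 1 then returns the coefficients of \<open>Y\<close>.\<close>

lemma fourier_series:
  fixes y :: "int \<Rightarrow> complex"
  assumes y: "(\<lambda>k. norm (y k)) summable_on UNIV"
  defines "Y \<equiv> (\<lambda>x. \<Sum>\<^sub>\<infinity>k. y k * fexp k x)"
  shows fourier_series_continuous: "continuous_on {0..1} Y"
    and fourier_series_periodic: "Y 1 = Y 0"
    and fourier_series_mult: "f absolutely_integrable_on {0..1} \<Longrightarrow>
        ((\<lambda>k. y k * fc f (m - k)) has_sum fc (\<lambda>x. f x * Y x) m) UNIV"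
    and fourier_series_fc: "fc Y m = y m"
proof -
  have U: "uniform_limit {0..1} (\<lambda>F x. \<Sum>k\<in>F. y k * fexp k x) Y (finite_subsets_at_top UNIV)"
    unfolding Y_def by (rule Weierstrass_m_test_general[OF _ y]) (simp add: norm_mult)
  show c: "continuous_on {0..1} Y"
    by (rule uniform_limit_theorem[OF _ U]) (auto intro!: always_eventually continuous_intros)
  show "Y 1 = Y 0" by (simp add: Y_def)
  show *: "((\<lambda>k. y k * fc f (m - k)) has_sum fc (\<lambda>x. f x * Y x) m) UNIV"
    if f: "f absolutely_integrable_on {0..1}" for f m
    unfolding has_sum_def tendsto_iff
  proof (intro allI impI)
    fix e :: real assume e: "e > 0"
    define I where "I = integral {0..1} (\<lambda>x. norm (f x))"
    have I: "I \<ge> 0" unfolding I_def by (rule integral_nonneg) (use f absolutely_integrable_on_def in auto)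
    define e' where "e' = e / (I + 1)"
    have e': "e' > 0" using e I by (simp add: e'_def)
    have "\<forall>\<^sub>F F in finite_subsets_at_top UNIV. \<forall>x\<in>{0..1}. dist (\<Sum>k\<in>F. y k * fexp k x) (Y x) < e'"
      using U e' unfolding uniform_limit_iff by blast
    moreover have "\<forall>\<^sub>F F in finite_subsets_at_top (UNIV :: int set). finite F"
      by (rule eventually_finite_subsets_at_top_weakI) auto
    ultimately show "\<forall>\<^sub>F F in finite_subsets_at_top UNIV.
        dist (\<Sum>k\<in>F. y k * fc f (m - k)) (fc (\<lambda>x. f x * Y x) m) < e"
    proof eventually_elim
      case (elim F)
      have af: "(\<lambda>x. f x * fexp (-m) x) absolutely_integrable_on {0..1}" using f by (rule fc_ai)
      have 1: "((\<lambda>x. (f x * fexp (-m) x) * (\<Sum>k\<in>F. y k * fexp k x)) has_integral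
          (\<Sum>k\<in>F. y k * fc f (m - k))) {0..1}"
        using integral_mult_trig_sum[OF af elim(2), of y] by (simp add: fc_mult_fexp)
      have 2: "((\<lambda>x. (f x * Y x) * fexp (-m) x) has_integral fc (\<lambda>x. f x * Y x) m) {0..1}"
        by (rule fc_has_integral[OF absolutely_integrable_mult_continuous[OF f c]])
      have "(\<lambda>x. (f x * fexp (-m) x) * (\<Sum>k\<in>F. y k * fexp k x) - (f x * Y x) * fexp (-m) x)
         = (\<lambda>x. f x * (((\<Sum>k\<in>F. y k * fexp k x) - Y x) * fexp (-m) x))"
        by (auto simp: algebra_simps)
      from integral_unique[OF has_integral_diff[OF 1 2], unfolded this]
      have "dist (\<Sum>k\<in>F. y k * fc f (m - k)) (fc (\<lambda>x. f x * Y x) m)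
         = norm (integral {0..1} (\<lambda>x. f x * (((\<Sum>k\<in>F. y k * fexp k x) - Y x) * fexp (-m) x)))"
        by (simp add: dist_norm)
      also have "\<dots> \<le> e' * I" unfolding I_def
        by (rule norm_integral_mult_le[OF f])
          (use c elim in \<open>auto intro!: continuous_intros less_imp_le simp: norm_mult dist_norm\<close>)
      also have "\<dots> < e" using e I by (simp add: e'_def field_simps)
      finally show ?case .
    qed
  qed
  have 1: "((\<lambda>k. y k * fc (\<lambda>x. 1) (m - k)) has_sum fc Y m) UNIV"
    using *[of "\<lambda>x. 1" m] by (simp add: absolutely_integrable_continuous_real)
  have "((\<lambda>k. y k * fc (\<lambda>x. 1) (m - k)) has_sum (\<Sum>k\<in>{m}. y k * fc (\<lambda>x. 1) (m - k))) {m}"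
    by (rule has_sum_finite) auto
  then have 2: "((\<lambda>k. y k * fc (\<lambda>x. 1) (m - k)) has_sum (\<Sum>k\<in>{m}. y k * fc (\<lambda>x. 1) (m - k))) UNIV"
    by (subst has_sum_cong_neutral[of "{m}" UNIV _ "\<lambda>k. y k * fc (\<lambda>x. 1) (m - k)"]) (auto simp: fc_const)
  from has_sum_unique[OF 1 2] show "fc Y m = y m" by (simp add: fc_const)
qed

section \<open>Solutions of the differential equation\<close>

lemma primitive_on01_add:
  assumes "primitive_on01 f F" "primitive_on01 g G"
  shows "primitive_on01 (\<lambda>x. f x + g x) (\<lambda>x. F x + G x)"
  unfolding primitive_on01_def
proof (intro conjI ballI)
  show "(\<lambda>x. f x + g x) absolutely_integrable_on {0..1}"
    using assms[THEN primitive_on01_abs] by (rule set_integral_add)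
  fix x :: real assume x: "x \<in> {0..1}"
  have "(f has_integral F x - F 0) {0..x}" "(g has_integral G x - G 0) {0..x}"
    using assms x unfolding primitive_on01_def by simp_all
  from has_integral_add[OF this]
  show "((\<lambda>x. f x + g x) has_integral F x + G x - (F 0 + G 0)) {0..x}"
    by (simp add: algebra_simps)
qed

lemma primitive_on01_cmult:
  assumes "primitive_on01 f F"
  shows "primitive_on01 (\<lambda>x. c * f x) (\<lambda>x. c * F x)"
  unfolding primitive_on01_def
proof (intro conjI ballI)
  show "(\<lambda>x. c * f x) absolutely_integrable_on {0..1}"
    using assms[THEN primitive_on01_abs] by (rule absolutely_integrable_cmult)
  fix x :: real assume x: "x \<in> {0..1}"
  have "(f has_integral F x - F 0) {0..x}"
    using assms x unfolding primitive_on01_def by simp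
  from has_integral_mult_right[OF this, of c]
  show "((\<lambda>x. c * f x) has_integral c * F x - c * F 0) {0..x}"
    by (simp add: algebra_simps)
qed

lemma primitive_on01_diff_fun:
  assumes "primitive_on01 f F" "primitive_on01 g G"
  shows "primitive_on01 (\<lambda>x. f x - g x) (\<lambda>x. F x - G x)"
  using primitive_on01_add[OF assms(1) primitive_on01_cmult[OF assms(2), of "-1"]] by simp

lemma primitive_on01_cong:
  assumes P: "primitive_on01 f F"
    and f: "\<And>x. x \<in> {0..1} \<Longrightarrow> f x = g x" and F: "\<And>x. x \<in> {0..1} \<Longrightarrow> F x = G x"
  shows "primitive_on01 g G"
  unfolding primitive_on01_def
proof (intro conjI ballI)
  show "g absolutely_integrable_on {0..1}"
    by (rule absolutely_integrable_spike[OF primitive_on01_abs[OF P], of "{}"]) (use f in auto)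
  fix x :: real assume x: "x \<in> {0..1}"
  have "(f has_integral F x - F 0) {0..x}" using P x unfolding primitive_on01_def by simp
  then show "(g has_integral G x - G 0) {0..x}"
    using x F[of x] F[of 0] by (subst has_integral_cong[of _ g f]) (auto simp: f)
qed

lemma primitive_on01_eqI:
  assumes "primitive_on01 f F" "x \<in> {0..1}"
  shows "F x = F 0 + integral {0..x} f"
proof -
  have "(f has_integral F x - F 0) {0..x}" using assms unfolding primitive_on01_def by simp
  from integral_unique[OF this] show ?thesis by simp
qed

lemma primitive_on01_sin:
  "primitive_on01 (\<lambda>s. a * cos (a * of_real s + b)) (\<lambda>s. sin (a * of_real s + b :: complex))"
proof (rule primitive_on01_smooth)
  fix x :: real
  have "((\<lambda>w. sin (a * w + b)) has_field_derivative a * cos (a * of_real x + b)) (at (of_real x))"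
    by (auto intro!: derivative_eq_intros)
  from has_vector_derivative_real_field[OF this]
  show "((\<lambda>s. sin (a * of_real s + b)) has_vector_derivative a * cos (a * of_real x + b)) (at x within {0..1})" .
qed (intro continuous_intros)

lemma primitive_on01_cos:
  "primitive_on01 (\<lambda>s. - a * sin (a * of_real s + b)) (\<lambda>s. cos (a * of_real s + b :: complex))"
proof (rule primitive_on01_smooth)
  fix x :: real
  have "((\<lambda>w. cos (a * w + b)) has_field_derivative - a * sin (a * of_real x + b)) (at (of_real x))"
    by (auto intro!: derivative_eq_intros)
  from has_vector_derivative_real_field[OF this]
  show "((\<lambda>s. cos (a * of_real s + b)) has_vector_derivative - a * sin (a * of_real x + b)) (at x within {0..1})" .
qed (intro continuous_intros)

lemma continuous_sup_attained:
  fixes y :: "real \<Rightarrow> complex"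
  assumes "continuous_on {0..1} y"
  obtains x0 where "x0 \<in> {0..1}" "\<And>x. x \<in> {0..1} \<Longrightarrow> norm (y x) \<le> norm (y x0)"
proof -
  have "\<exists>x\<in>{0..1}. \<forall>u\<in>{0..1}. norm (y u) \<le> norm (y x)"
    by (rule continuous_attains_sup) (use assms in \<open>auto intro: continuous_on_norm\<close>)
  then show ?thesis by (elim bexE) (rule that, auto)
qed

lemma integral_norm_subinterval_le:
  fixes f :: "real \<Rightarrow> complex"
  assumes "f absolutely_integrable_on {0..1}" "x \<in> {0..1}"
  shows "integral {0..x} (\<lambda>s. norm (f s)) \<le> integral {0..1} (\<lambda>s. norm (f s))"
proof -
  have n: "(\<lambda>s. norm (f s)) integrable_on {0..1}"
    using assms(1) unfolding absolutely_integrable_on_def by (rule conjunct2)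
  moreover have "(\<lambda>s. norm (f s)) integrable_on {0..x}"
    by (rule integrable_on_subinterval[OF n]) (use assms in auto)
  ultimately show ?thesis using assms by (intro integral_subset_le) auto
qed

text \<open>Conditions on a square root \<open>z\<close> of the spectral parameter. The strip bounds
  sin and cos of z u by e <= 3 for 0 <= u <= 1. With Z = 6 I + 1, where I is the L_1 norm of the
  potential, the factor 3 I / |z| of the Volterra operator is at most 1/2.\<close>

definition admissible :: "real \<Rightarrow> complex \<Rightarrow> bool" where
  "admissible Z z \<longleftrightarrow> norm z > Z \<and> \<bar>Im z\<bar> < 1"

lemma norm_sin_cos_le_3:
  assumes "\<bar>Im z\<bar> < 1" "0 \<le> u" "u \<le> 1"
  shows "norm (sin (z * of_real u)) \<le> 3" "norm (cos (z * of_real u)) \<le> 3"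
proof -
  have "exp \<bar>Im z\<bar> \<le> exp 1" using assms by simp
  also have "\<dots> \<le> (3::real)" by (rule exp_le)
  finally have e: "exp \<bar>Im z\<bar> \<le> 3" .
  show "norm (sin (z * of_real u)) \<le> 3" "norm (cos (z * of_real u)) \<le> 3"
    using cmod_sin_le_exp[of u z] cmod_cos_le_exp[of u z] assms e
    by (auto simp: scaleR_conv_of_real mult.commute)
qed

locale hill =
  fixes q :: "real \<Rightarrow> complex"
  assumes q_L1: "q absolutely_integrable_on {0..1}"
begin

definition "I = integral {0..1} (\<lambda>x. norm (q x))"

abbreviation "adm \<equiv> admissible (6 * I + 1)"

lemma I_nonneg: "I \<ge> 0"
  unfolding I_def
  by (rule integral_nonneg) (use q_L1 in \<open>simp_all add: absolutely_integrable_on_def\<close>)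

text \<open>The first-order system for y'' = (q - lam) y + f, with \<open>y1\<close> as y'. The
  source \<open>f\<close> is there for differences of solutions with two spectral parameters, which
  solve such an equation.\<close>

definition hsol :: "complex \<Rightarrow> (real \<Rightarrow> complex) \<Rightarrow> (real \<Rightarrow> complex) \<Rightarrow> (real \<Rightarrow> complex) \<Rightarrow> bool" where
  "hsol lam f y y1 \<longleftrightarrow> primitive_on01 y1 y \<and> primitive_on01 (\<lambda>s. (q s - lam) * y s + f s) y1"

text \<open>\<open>ode_sol\<close> asks only for gauge integrals. But \<open>y1\<close> is an
  indefinite integral, hence continuous, so \<open>y\<close> is absolutely continuous, and then (q -
  lam) y is the product of an L_1 function and a continuous one.\<close>

lemma ode_sol_iff_hsol: "ode_sol q lam y y1 \<longleftrightarrow> hsol lam (\<lambda>s. 0) y y1"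
proof
  assume o: "ode_sol q lam y y1"
  define h where "h = (\<lambda>s. (q s - lam) * y s)"
  have y: "(y1 has_integral (y x - y 0)) {0..x}" if "x \<in> {0..1}" for x
    using o that unfolding ode_sol_def by blast
  have y1: "(h has_integral (y1 x - y1 0)) {0..x}" if "x \<in> {0..1}" for x
    using o that unfolding ode_sol_def h_def by blast
  have hi: "h integrable_on {0..1}" using y1[of 1] by (intro has_integral_integrable) auto
  have "continuous_on {0..1} (\<lambda>x. y1 0 + integral {0..x} h)"
    by (intro continuous_intros indefinite_integral_continuous_1 hi)
  then have c1: "continuous_on {0..1} y1"
  proof (rule continuous_on_eq)
    show "y1 0 + integral {0..x} h = y1 x" if "x \<in> {0..1}" for x
      using integral_unique[OF y1[OF that]] by simp
  qed
  have p1: "primitive_on01 y1 y"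
    unfolding primitive_on01_def using y absolutely_integrable_continuous_real[OF c1] by simp
  have "(\<lambda>s. q s - lam) absolutely_integrable_on {0..1}"
    by (rule set_integral_diff[OF q_L1]) (rule absolutely_integrable_continuous_real, intro continuous_intros)
  then have "h absolutely_integrable_on {0..1}" unfolding h_def
    by (rule absolutely_integrable_mult_continuous) (rule primitive_on01_continuous[OF p1])
  then have "primitive_on01 h y1" unfolding primitive_on01_def using y1 by simp
  then show "hsol lam (\<lambda>s. 0) y y1" using p1 by (simp add: hsol_def h_def)
next
  assume "hsol lam (\<lambda>s. 0) y y1"
  then show "ode_sol q lam y y1" by (simp add: hsol_def primitive_on01_def ode_sol_def)
qed

lemma hsol_combine:
  assumes "hsol lam f y y1" "hsol lam g z z1"
  shows "hsol lam (\<lambda>s. a * f s + b * g s) (\<lambda>s. a * y s + b * z s) (\<lambda>s. a * y1 s + b * z1 s)"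
proof -
  have "primitive_on01 (\<lambda>s. a * y1 s + b * z1 s) (\<lambda>s. a * y s + b * z s)"
    using assms unfolding hsol_def by (intro primitive_on01_add primitive_on01_cmult) auto
  moreover have "primitive_on01 (\<lambda>s. a * ((q s - lam) * y s + f s) + b * ((q s - lam) * z s + g s))
      (\<lambda>s. a * y1 s + b * z1 s)"
    using assms unfolding hsol_def by (intro primitive_on01_add primitive_on01_cmult) auto
  moreover have "(\<lambda>s. a * ((q s - lam) * y s + f s) + b * ((q s - lam) * z s + g s)) =
     (\<lambda>s. (q s - lam) * (a * y s + b * z s) + (a * f s + b * g s))"
    by (auto simp: algebra_simps)
  ultimately show ?thesis by (simp add: hsol_def)
qed

lemma hsol_continuous:
  assumes "hsol lam f y y1" shows "continuous_on {0..1} y" "continuous_on {0..1} y1"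
  using assms primitive_on01_continuous unfolding hsol_def by blast+

text \<open>With S and C the sine and cosine of z (x - s), the derivatives of y C + y1 S / z and of
  y1 C - z y S with respect to s lose all terms without \<open>q\<close> or \<open>f\<close>.
  Integrating from 0 to x, where S = 0 and C = 1 at the upper end, gives the formulas.\<close>

lemma variation_of_constants:
  assumes h: "hsol (z\<^sup>2) f y y1" and z: "z \<noteq> 0" and x: "x \<in> {0..1}"
  shows "y x = y 0 * cos (z * of_real x) + y1 0 * (sin (z * of_real x) / z)
           + integral {0..x} (\<lambda>s. (q s * y s + f s) * (sin (z * of_real (x - s)) / z))"
    and "y1 x = y1 0 * cos (z * of_real x) - z * y 0 * sin (z * of_real x)
           + integral {0..x} (\<lambda>s. (q s * y s + f s) * cos (z * of_real (x - s)))"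
proof -
  define S C where "S s = sin (- z * of_real s + z * of_real x)"
    and "C s = cos (- z * of_real s + z * of_real x)" for s
  have pS: "primitive_on01 (\<lambda>s. - z * C s) S" unfolding S_def[abs_def] C_def by (rule primitive_on01_sin)
  have pC: "primitive_on01 (\<lambda>s. z * S s) C" unfolding S_def C_def[abs_def]
    using primitive_on01_cos[of "-z" "z * of_real x"] by simp
  have py: "primitive_on01 y1 y" and py1: "primitive_on01 (\<lambda>s. (q s - z\<^sup>2) * y s + f s) y1"
    using h by (auto simp: hsol_def)
  have SC: "S s = sin (z * of_real (x - s))" "C s = cos (z * of_real (x - s))" for s
    by (simp_all add: S_def C_def algebra_simps)
  have "primitive_on01 (\<lambda>s. (y1 s * C s + y s * (z * S s)) +
       inverse z * (((q s - z\<^sup>2) * y s + f s) * S s + y1 s * (- z * C s)))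
     (\<lambda>s. y s * C s + inverse z * (y1 s * S s))"
    by (intro primitive_on01_add primitive_on01_cmult primitive_on01_mult py py1 pS pC)
  from primitive_on01_eqI[OF this x]
  have "y x * C x + inverse z * (y1 x * S x) = y 0 * C 0 + inverse z * (y1 0 * S 0)
     + integral {0..x} (\<lambda>s. (y1 s * C s + y s * (z * S s)) +
       inverse z * (((q s - z\<^sup>2) * y s + f s) * S s + y1 s * (- z * C s)))" .
  moreover have "(\<lambda>s. (y1 s * C s + y s * (z * S s)) +
       inverse z * (((q s - z\<^sup>2) * y s + f s) * S s + y1 s * (- z * C s)))
     = (\<lambda>s. (q s * y s + f s) * (S s / z))"
  proof
    fix s
    show "(y1 s * C s + y s * (z * S s)) +
       inverse z * (((q s - z\<^sup>2) * y s + f s) * S s + y1 s * (- z * C s)) = (q s * y s + f s) * (S s / z)"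
      using z by (simp add: field_simps power2_eq_square)
  qed
  ultimately show "y x = y 0 * cos (z * of_real x) + y1 0 * (sin (z * of_real x) / z)
           + integral {0..x} (\<lambda>s. (q s * y s + f s) * (sin (z * of_real (x - s)) / z))"
    by (simp add: SC divide_inverse mult_ac)
  have "primitive_on01 (\<lambda>s. (((q s - z\<^sup>2) * y s + f s) * C s + y1 s * (z * S s)) +
       (- z) * (y1 s * S s + y s * (- z * C s)))
     (\<lambda>s. y1 s * C s + (- z) * (y s * S s))"
    by (intro primitive_on01_add primitive_on01_cmult primitive_on01_mult py py1 pS pC)
  from primitive_on01_eqI[OF this x]
  have "y1 x * C x + (- z) * (y x * S x) = y1 0 * C 0 + (- z) * (y 0 * S 0)
     + integral {0..x} (\<lambda>s. (((q s - z\<^sup>2) * y s + f s) * C s + y1 s * (z * S s)) +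
       (- z) * (y1 s * S s + y s * (- z * C s)))" .
  moreover have "(\<lambda>s. (((q s - z\<^sup>2) * y s + f s) * C s + y1 s * (z * S s)) +
       (- z) * (y1 s * S s + y s * (- z * C s))) = (\<lambda>s. (q s * y s + f s) * C s)"
    by (auto simp: algebra_simps power2_eq_square)
  ultimately show "y1 x = y1 0 * cos (z * of_real x) - z * y 0 * sin (z * of_real x)
           + integral {0..x} (\<lambda>s. (q s * y s + f s) * cos (z * of_real (x - s)))"
    by (simp add: SC mult_ac)
qed

lemma adm_nz: "adm z \<Longrightarrow> z \<noteq> 0" "adm z \<Longrightarrow> norm z \<ge> 1" "adm z \<Longrightarrow> 3 * I / norm z \<le> 1 / 2"
proof -
  assume a: "adm z"
  then have n: "norm z > 6 * I + 1" by (simp add: admissible_def)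
  then show "z \<noteq> 0" "norm z \<ge> 1" using I_nonneg by auto
  then show "3 * I / norm z \<le> 1 / 2" using n by (simp add: divide_le_eq)
qed

lemma norm_source_integral_le:
  assumes z: "adm z" and x: "x \<in> {0..1}" and y: "continuous_on {0..1} y"
    and M: "\<And>s. s \<in> {0..1} \<Longrightarrow> norm (y s) \<le> M"
    and f: "f absolutely_integrable_on {0..1}"
  shows "norm (integral {0..x} (\<lambda>s. (q s * y s + f s) * (sin (z * of_real (x - s)) / z)))
      \<le> 3 / norm z * (I * M + integral {0..1} (\<lambda>s. norm (f s)))"
    and "norm (integral {0..x} (\<lambda>s. (q s * y s + f s) * cos (z * of_real (x - s))))
      \<le> 3 * (I * M + integral {0..1} (\<lambda>s. norm (f s)))"
proof -
  have Im: "\<bar>Im z\<bar> < 1" using z by (simp add: admissible_def)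
  have qy: "(\<lambda>s. q s * y s) absolutely_integrable_on {0..1}"
    by (rule absolutely_integrable_mult_continuous[OF q_L1 y])
  have g: "(\<lambda>s. q s * y s + f s) absolutely_integrable_on {0..1}"
    by (rule set_integral_add(1)[OF qy f])
  have gx: "(\<lambda>s. q s * y s + f s) absolutely_integrable_on {0..x}"
    by (rule absolutely_integrable_on_subinterval[OF g]) (use x in auto)
  have nq: "(\<lambda>s. norm (q s)) integrable_on {0..1}" and nf: "(\<lambda>s. norm (f s)) integrable_on {0..1}"
    and ng: "(\<lambda>s. norm (q s * y s + f s)) integrable_on {0..1}"
    using q_L1 f g unfolding absolutely_integrable_on_def by simp_all
  have "integral {0..1} (\<lambda>s. norm (q s * y s + f s)) \<le> integral {0..1} (\<lambda>s. norm (q s) * M + norm (f s))"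
  proof (rule integral_le[OF ng])
    show "(\<lambda>s. norm (q s) * M + norm (f s)) integrable_on {0..1}"
      by (intro integrable_add integrable_on_mult_left nq nf)
    show "norm (q s * y s + f s) \<le> norm (q s) * M + norm (f s)" if "s \<in> {0..1}" for s
      using norm_triangle_ineq[of "q s * y s" "f s"] mult_left_mono[OF M[OF that], of "norm (q s)"]
      by (simp add: norm_mult)
  qed
  also have "\<dots> = I * M + integral {0..1} (\<lambda>s. norm (f s))"
    by (subst Henstock_Kurzweil_Integration.integral_add)
      (intro integrable_on_mult_left nq nf, intro nf, simp add: I_def)
  finally have G: "integral {0..x} (\<lambda>s. norm (q s * y s + f s)) \<le> I * M + integral {0..1} (\<lambda>s. norm (f s))"
    using integral_norm_subinterval_le[OF g x] by simp
  have sc: "norm (sin (z * of_real (x - s))) \<le> 3" "norm (cos (z * of_real (x - s))) \<le> 3" if "s \<in> {0..x}" for s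
    using norm_sin_cos_le_3[OF Im, of "x - s"] that x by auto
  have nz: "norm z > 0" using adm_nz[OF z] by simp
  have "norm (integral {0..x} (\<lambda>s. (q s * y s + f s) * (sin (z * of_real (x - s)) / z)))
      \<le> 3 / norm z * integral {0..x} (\<lambda>s. norm (q s * y s + f s))"
  proof (rule norm_integral_mult_le[OF gx])
    show "continuous_on {0..x} (\<lambda>s. sin (z * of_real (x - s)) / z)"
      using nz by (intro continuous_intros) auto
    show "norm (sin (z * of_real (x - s)) / z) \<le> 3 / norm z" if "s \<in> {0..x}" for s
      using sc(1)[OF that] nz by (simp add: norm_divide divide_right_mono)
  qed
  also have "\<dots> \<le> 3 / norm z * (I * M + integral {0..1} (\<lambda>s. norm (f s)))"
    using G nz by (intro mult_left_mono) auto
  finally show "norm (integral {0..x} (\<lambda>s. (q s * y s + f s) * (sin (z * of_real (x - s)) / z)))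
      \<le> 3 / norm z * (I * M + integral {0..1} (\<lambda>s. norm (f s)))" .
  have "norm (integral {0..x} (\<lambda>s. (q s * y s + f s) * cos (z * of_real (x - s))))
      \<le> 3 * integral {0..x} (\<lambda>s. norm (q s * y s + f s))"
    by (rule norm_integral_mult_le[OF gx]) (use sc in \<open>auto intro!: continuous_intros\<close>)
  also have "\<dots> \<le> 3 * (I * M + integral {0..1} (\<lambda>s. norm (f s)))" using G by simp
  finally show "norm (integral {0..x} (\<lambda>s. (q s * y s + f s) * cos (z * of_real (x - s))))
      \<le> 3 * (I * M + integral {0..1} (\<lambda>s. norm (f s)))" .
qed

text \<open>At a point \<open>x0\<close> where |y| is largest the integral returns at most half of
  that maximum, since 3 I / |z| <= 1/2. Moving it to the left doubles the constants from 3 to 6, and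
  no Gronwall argument is needed.\<close>

lemma hsol_bound:
  assumes h: "hsol (z\<^sup>2) f y y1" and z: "adm z" and f: "f absolutely_integrable_on {0..1}" and x: "x \<in> {0..1}"
  shows "norm (y x) \<le> 6 * norm (y 0) + 6 * norm (y1 0) / norm z + 6 / norm z * integral {0..1} (\<lambda>s. norm (f s))"
proof -
  have c: "continuous_on {0..1} y" by (rule hsol_continuous[OF h])
  obtain x0 where x0: "x0 \<in> {0..1}" "\<And>x. x \<in> {0..1} \<Longrightarrow> norm (y x) \<le> norm (y x0)"
    using continuous_sup_attained[OF c] by metis
  define F where "F = integral {0..1} (\<lambda>s. norm (f s))"
  define M where "M = norm (y x0)"
  have nz: "norm z > 0" using adm_nz[OF z] by simp
  have sc: "norm (sin (z * of_real x0)) \<le> 3" "norm (cos (z * of_real x0)) \<le> 3"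
    using norm_sin_cos_le_3[of z x0] z x0 by (auto simp: admissible_def)
  have "M \<le> norm (y 0 * cos (z * of_real x0)) + norm (y1 0 * (sin (z * of_real x0) / z))
     + norm (integral {0..x0} (\<lambda>s. (q s * y s + f s) * (sin (z * of_real (x0 - s)) / z)))"
    unfolding M_def
    by (subst variation_of_constants(1)[OF h adm_nz(1)[OF z] x0(1)])
      (rule order_trans[OF norm_triangle_ineq add_right_mono[OF norm_triangle_ineq]])
  also have "\<dots> \<le> norm (y 0) * 3 + norm (y1 0) * (3 / norm z) + 3 / norm z * (I * M + F)"
    unfolding norm_mult norm_divide F_def M_def using sc nz x0
    by (intro add_mono mult_left_mono divide_right_mono norm_source_integral_le(1)[OF z _ c _ f]) auto
  also have "\<dots> = 3 * norm (y 0) + 3 * norm (y1 0) / norm z + (3 * I / norm z) * M + 3 / norm z * F"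
    by (simp add: algebra_simps add_divide_distrib)
  finally have 1: "M \<le> 3 * norm (y 0) + 3 * norm (y1 0) / norm z + (3 * I / norm z) * M + 3 / norm z * F" .
  have "(3 * I / norm z) * M \<le> (1/2) * M"
    by (rule mult_right_mono[OF adm_nz(3)[OF z]]) (simp add: M_def)
  with 1 have "M \<le> 6 * norm (y 0) + 6 * norm (y1 0) / norm z + 6 / norm z * F" by simp
  then show ?thesis using x0(2)[OF x] by (simp add: M_def F_def)
qed

lemma hsol_unique:
  assumes h: "hsol (z\<^sup>2) (\<lambda>s. 0) y y1" "hsol (z\<^sup>2) (\<lambda>s. 0) w w1" and z: "adm z"
    and i: "y 0 = w 0" "y1 0 = w1 0" and x: "x \<in> {0..1}"
  shows "y x = w x \<and> y1 x = w1 x"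
proof -
  have d: "hsol (z\<^sup>2) (\<lambda>s. 0) (\<lambda>s. y s - w s) (\<lambda>s. y1 s - w1 s)"
    using hsol_combine[OF h, of 1 "-1"] by simp
  have 0: "y s - w s = 0" if "s \<in> {0..1}" for s
    using hsol_bound[OF d z _ that] i by simp
  have "integral {0..x} (\<lambda>s. (q s * (y s - w s) + 0) * cos (z * of_real (x - s))) = integral {0..x} (\<lambda>s. 0)"
    by (rule integral_cong) (use 0 x in auto)
  then have "y1 x - w1 x = 0"
    using variation_of_constants(2)[OF d adm_nz(1)[OF z] x] i by simp
  then show ?thesis using 0[OF x] by simp
qed

text \<open>The integral of q y sin (z (x - s)) / z over [0,x], with the sine expanded by the
  addition theorem. So \<open>x\<close> stands outside the integrands, and continuity in
  \<open>x\<close> is that of indefinite integrals.\<close>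

definition volterra :: "complex \<Rightarrow> (real \<Rightarrow> complex) \<Rightarrow> real \<Rightarrow> complex" where
  "volterra z y x = inverse z * (sin (z * of_real x) * integral {0..x} (\<lambda>s. q s * (y s * cos (z * of_real s))))
     - inverse z * (cos (z * of_real x) * integral {0..x} (\<lambda>s. q s * (y s * sin (z * of_real s))))"

lemma volterra_integrable:
  assumes y: "continuous_on {0..1} y"
  shows "(\<lambda>s. q s * (y s * cos (z * of_real s))) absolutely_integrable_on {0..1}"
    "(\<lambda>s. q s * (y s * sin (z * of_real s))) absolutely_integrable_on {0..1}"
  by (intro absolutely_integrable_mult_continuous q_L1 continuous_intros y)+

lemma volterra_eq:
  assumes y: "continuous_on {0..1} y" and x: "x \<in> {0..1}"
  shows "volterra z y x = integral {0..x} (\<lambda>s. (q s * y s + 0) * (sin (z * of_real (x - s)) / z))"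
proof -
  have i: "(\<lambda>s. q s * (y s * cos (z * of_real s))) integrable_on {0..x}"
    "(\<lambda>s. q s * (y s * sin (z * of_real s))) integrable_on {0..x}"
    using absolutely_integrable_on_subinterval[OF volterra_integrable(1)[OF y]]
      absolutely_integrable_on_subinterval[OF volterra_integrable(2)[OF y]] x
    unfolding absolutely_integrable_on_def by simp_all
  have 1: "((\<lambda>s. inverse z * (sin (z * of_real x) * (q s * (y s * cos (z * of_real s))))
      - inverse z * (cos (z * of_real x) * (q s * (y s * sin (z * of_real s))))) has_integral volterra z y x) {0..x}"
    unfolding volterra_def
    by (intro has_integral_diff has_integral_mult_right integrable_integral i)
  have eq: "inverse z * (sin (z * of_real x) * (q s * (y s * cos (z * of_real s))))
      - inverse z * (cos (z * of_real x) * (q s * (y s * sin (z * of_real s))))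
     = (q s * y s + 0) * (sin (z * of_real (x - s)) / z)" for s
    by (simp add: right_diff_distrib sin_diff divide_inverse algebra_simps)
  show ?thesis using integral_unique[OF 1] by (simp only: eq)
qed

lemma volterra_continuous:
  assumes y: "continuous_on {0..1} y" shows "continuous_on {0..1} (volterra z y)"
proof -
  have i: "(\<lambda>s. q s * (y s * cos (z * of_real s))) integrable_on {0..1}"
    "(\<lambda>s. q s * (y s * sin (z * of_real s))) integrable_on {0..1}"
    using volterra_integrable[OF y] unfolding absolutely_integrable_on_def by simp_all
  show ?thesis unfolding volterra_def[abs_def]
    by (intro continuous_intros indefinite_integral_continuous_1 i)
qed

lemma volterra_bound:
  assumes z: "adm z" and y: "continuous_on {0..1} y" and M: "\<And>s. s \<in> {0..1} \<Longrightarrow> norm (y s) \<le> M"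
    and x: "x \<in> {0..1}"
  shows "norm (volterra z y x) \<le> M / 2"
proof -
  have M0: "M \<ge> 0" using M[of 0] norm_ge_zero[of "y 0"] by (simp del: norm_ge_zero)
  have "norm (volterra z y x) \<le> 3 / norm z * (I * M + integral {0..1} (\<lambda>s::real. norm (0::complex)))"
    unfolding volterra_eq[OF y x]
    by (rule norm_source_integral_le(1)[OF z x y M]) (auto intro: absolutely_integrable_zero)
  also have "\<dots> = (3 * I / norm z) * M" by simp
  also have "\<dots> \<le> (1/2) * M" using adm_nz(3)[OF z] M0 by (rule mult_right_mono)
  finally show ?thesis by simp
qed

lemma volterra_diff:
  assumes "continuous_on {0..1} y" "continuous_on {0..1} w" "x \<in> {0..1}"
  shows "volterra z (\<lambda>s. y s - w s) x = volterra z y x - volterra z w x"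
proof -
  have i: "(\<lambda>s. q s * (y s * cos (z * of_real s))) integrable_on {0..x}"
    "(\<lambda>s. q s * (y s * sin (z * of_real s))) integrable_on {0..x}" if "continuous_on {0..1} y" for y
    using absolutely_integrable_on_subinterval[OF volterra_integrable(1)[OF that]]
      absolutely_integrable_on_subinterval[OF volterra_integrable(2)[OF that]] assms
    unfolding absolutely_integrable_on_def by simp_all
  show ?thesis unfolding volterra_def
    by (simp add: left_diff_distrib right_diff_distrib
        Henstock_Kurzweil_Integration.integral_diff[OF i(1)[OF assms(1)] i(1)[OF assms(2)], unfolded right_diff_distrib left_diff_distrib]
        Henstock_Kurzweil_Integration.integral_diff[OF i(2)[OF assms(1)] i(2)[OF assms(2)], unfolded right_diff_distrib left_diff_distrib])
qed

text \<open>Neumann series: each application of \<open>volterra z\<close> halves the sup norm on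
  [0,1], so the iterates of \<open>g\<close> sum uniformly by the M-test.\<close>

lemma volterra_fixpoint:
  assumes z: "adm z" and g: "continuous_on {0..1} g"
  shows "\<exists>y. continuous_on {0..1} y \<and> (\<forall>x\<in>{0..1}. y x = g x + volterra z y x)"
proof -
  define u where "u k = (volterra z ^^ k) g" for k
  have uS: "u (Suc k) = volterra z (u k)" for k by (simp add: u_def)
  have cu: "continuous_on {0..1} (u k)" for k
    by (induction k) (simp_all add: uS volterra_continuous, simp add: u_def g)
  obtain x0 where x0: "\<And>x. x \<in> {0..1} \<Longrightarrow> norm (g x) \<le> norm (g x0)"
    using continuous_sup_attained[OF g] by metis
  define M where "M = norm (g x0)"
  have bu: "norm (u k x) \<le> M * (1/2) ^ k" if "x \<in> {0..1}" for k x
    using that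
  proof (induction k arbitrary: x)
    case 0 then show ?case using x0 by (simp add: u_def M_def)
  next
    case (Suc k)
    show ?case using volterra_bound[OF z cu Suc.IH Suc.prems] by (simp add: uS)
  qed
  have sm: "summable (\<lambda>k. M * (1/2::real) ^ k)" by (intro summable_mult summable_geometric) simp
  define Y where "Y n x = (\<Sum>k<n. u k x)" for n x
  define y where "y x = (\<Sum>k. u k x)" for x
  have U: "uniform_limit {0..1} Y y sequentially"
    unfolding Y_def[abs_def] y_def[abs_def] by (rule Weierstrass_m_test[OF _ sm]) (rule bu)
  have cY: "continuous_on {0..1} (Y n)" for n unfolding Y_def[abs_def] by (intro continuous_intros cu)
  have cy: "continuous_on {0..1} y"
    by (rule uniform_limit_theorem[OF _ U]) (auto intro: always_eventually cY)
  have YS: "Y (Suc n) x = g x + volterra z (Y n) x" if x: "x \<in> {0..1}" for n x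
  proof (induction n)
    case 0
    show ?case by (simp add: Y_def u_def volterra_def)
  next
    case (Suc n)
    have "volterra z (Y (Suc n)) x - volterra z (Y n) x = volterra z (\<lambda>s. Y (Suc n) s - Y n s) x"
      by (rule volterra_diff[symmetric, OF cY cY x])
    also have "(\<lambda>s. Y (Suc n) s - Y n s) = u n" by (simp add: Y_def)
    also have "volterra z (u n) x = Y (Suc (Suc n)) x - Y (Suc n) x" by (simp add: Y_def uS)
    finally show ?case using Suc.IH by (simp add: algebra_simps)
  qed
  have "y x = g x + volterra z y x" if x: "x \<in> {0..1}" for x
  proof -
    have lY: "(\<lambda>n. Y n x) \<longlonglongrightarrow> y x" using tendsto_uniform_limitI[OF U x] .
    have "(\<lambda>n. volterra z (Y n) x) \<longlonglongrightarrow> volterra z y x"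
    proof (rule LIMSEQ_I)
      fix e :: real assume e: "e > 0"
      from U e have "\<forall>\<^sub>F n in sequentially. \<forall>x\<in>{0..1}. dist (Y n x) (y x) < e"
        unfolding uniform_limit_iff by simp
      then obtain N where N: "\<forall>n\<ge>N. \<forall>s\<in>{0..1}. dist (Y n s) (y s) < e"
        unfolding eventually_sequentially by (elim exE)
      have "norm (volterra z (Y n) x - volterra z y x) < e" if "n \<ge> N" for n
      proof -
        have "norm (volterra z (\<lambda>s. Y n s - y s) x) \<le> e / 2"
          by (rule volterra_bound[OF z _ _ x])
            (use N[rule_format, OF that] in \<open>auto intro!: continuous_intros cY cy less_imp_le simp: dist_norm\<close>)
        then show ?thesis using e volterra_diff[OF cY cy x, of z n] by simp
      qed
      then show "\<exists>no. \<forall>n\<ge>no. norm (volterra z (Y n) x - volterra z y x) < e" by blast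
    qed
    then have "(\<lambda>n. g x + volterra z (Y n) x) \<longlonglongrightarrow> g x + volterra z y x" by (intro tendsto_intros)
    then have "(\<lambda>n. Y (Suc n) x) \<longlonglongrightarrow> g x + volterra z y x" using YS[OF x] by simp
    then show ?thesis using LIMSEQ_Suc[OF lY] LIMSEQ_unique by blast
  qed
  then show ?thesis using cy by (intro exI[of _ y] conjI ballI)
qed

lemma hsol_exists:
  assumes z: "adm z"
  obtains y y1 where "hsol (z\<^sup>2) (\<lambda>s. 0) y y1" "y 0 = a" "y1 0 = b"
proof -
  have z0: "z \<noteq> 0" by (rule adm_nz(1)[OF z])
  define g where "g x = a * cos (z * of_real x) + b * (inverse z * sin (z * of_real x))" for x
  have cg: "continuous_on {0..1} g" unfolding g_def[abs_def] by (intro continuous_intros)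
  obtain w where w: "continuous_on {0..1} w" "\<And>x. x \<in> {0..1} \<Longrightarrow> w x = g x + volterra z w x"
    using volterra_fixpoint[OF z cg] by (elim exE conjE) simp
  define P where "P x = 0 + integral {0..x} (\<lambda>s. q s * (w s * cos (z * of_real s)))" for x
  define R where "R x = 0 + integral {0..x} (\<lambda>s. q s * (w s * sin (z * of_real s)))" for x
  have P: "primitive_on01 (\<lambda>s. q s * (w s * cos (z * of_real s))) P"
    unfolding P_def[abs_def] by (rule primitive_on01I[OF volterra_integrable(1)[OF w(1)]])
  have R: "primitive_on01 (\<lambda>s. q s * (w s * sin (z * of_real s))) R"
    unfolding R_def[abs_def] by (rule primitive_on01I[OF volterra_integrable(2)[OF w(1)]])
  have S: "primitive_on01 (\<lambda>s. z * cos (z * of_real s)) (\<lambda>s. sin (z * of_real s))"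
    using primitive_on01_sin[of z 0] by simp
  have C: "primitive_on01 (\<lambda>s. - z * sin (z * of_real s)) (\<lambda>s. cos (z * of_real s))"
    using primitive_on01_cos[of z 0] by simp
  \<comment> \<open>\<open>w\<close> is known only to solve the integral equation. \<open>y\<close>
    is its right-hand side and \<open>y1\<close> the formal derivative, both written with the
    primitives \<open>P\<close> and \<open>R\<close> so that the product rule differentiates them;
    on [0,1] \<open>y\<close> agrees with \<open>w\<close>.\<close>
  define y where "y x = (a * cos (z * of_real x) + (b * inverse z) * sin (z * of_real x))
     + inverse z * (sin (z * of_real x) * P x - cos (z * of_real x) * R x)" for x
  define y1 where "y1 x = (b * cos (z * of_real x) + (- a * z) * sin (z * of_real x))
     + (cos (z * of_real x) * P x + sin (z * of_real x) * R x)" for x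
  have wy: "w x = y x" if "x \<in> {0..1}" for x
    using w(2)[OF that] by (simp add: y_def g_def volterra_def P_def R_def algebra_simps)
  have sc: "sin (z * of_real x) * sin (z * of_real x) = 1 - cos (z * of_real x) * cos (z * of_real x)" for x :: real
    using sin_cos_squared_add[of "z * of_real x"] by (simp add: power2_eq_square algebra_simps)
  have "primitive_on01 (\<lambda>s. (a * (- z * sin (z * of_real s)) + (b * inverse z) * (z * cos (z * of_real s)))
     + inverse z * (((z * cos (z * of_real s)) * P s + sin (z * of_real s) * (q s * (w s * cos (z * of_real s))))
        - ((- z * sin (z * of_real s)) * R s + cos (z * of_real s) * (q s * (w s * sin (z * of_real s)))))) y"
    unfolding y_def[abs_def]
    by (intro primitive_on01_add primitive_on01_cmult primitive_on01_diff_fun primitive_on01_mult P R S C)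
  then have py: "primitive_on01 y1 y"
  proof (rule primitive_on01_cong)
    fix s
    have zi: "inverse z * z = 1" using z0 by simp
    show "(a * (- z * sin (z * of_real s)) + (b * inverse z) * (z * cos (z * of_real s)))
     + inverse z * (((z * cos (z * of_real s)) * P s + sin (z * of_real s) * (q s * (w s * cos (z * of_real s))))
        - ((- z * sin (z * of_real s)) * R s + cos (z * of_real s) * (q s * (w s * sin (z * of_real s))))) = y1 s"
      unfolding y1_def using zi by algebra
  qed simp
  have "primitive_on01 (\<lambda>s. (b * (- z * sin (z * of_real s)) + (- a * z) * (z * cos (z * of_real s)))
     + (((- z * sin (z * of_real s)) * P s + cos (z * of_real s) * (q s * (w s * cos (z * of_real s))))
        + ((z * cos (z * of_real s)) * R s + sin (z * of_real s) * (q s * (w s * sin (z * of_real s)))))) y1"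
    unfolding y1_def[abs_def]
    by (intro primitive_on01_add primitive_on01_cmult primitive_on01_mult P R S C)
  then have py1: "primitive_on01 (\<lambda>s. (q s - z\<^sup>2) * y s + 0) y1"
  proof (rule primitive_on01_cong)
    fix s :: real assume s: "s \<in> {0..1}"
    have zi: "inverse z * z = 1" using z0 by simp
    have "(b * (- z * sin (z * of_real s)) + (- a * z) * (z * cos (z * of_real s)))
     + (((- z * sin (z * of_real s)) * P s + cos (z * of_real s) * (q s * (w s * cos (z * of_real s))))
        + ((z * cos (z * of_real s)) * R s + sin (z * of_real s) * (q s * (w s * sin (z * of_real s)))))
      = q s * w s - z\<^sup>2 * y s"
      unfolding y_def using zi sc[of s] by algebra
    then show "(b * (- z * sin (z * of_real s)) + (- a * z) * (z * cos (z * of_real s)))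
     + (((- z * sin (z * of_real s)) * P s + cos (z * of_real s) * (q s * (w s * cos (z * of_real s))))
        + ((z * cos (z * of_real s)) * R s + sin (z * of_real s) * (q s * (w s * sin (z * of_real s)))))
      = (q s - z\<^sup>2) * y s + 0"
      using wy[OF s] by (simp add: algebra_simps)
  qed simp
  show ?thesis
  proof (rule that)
    show "hsol (z\<^sup>2) (\<lambda>s. 0) y y1" using py py1 by (simp add: hsol_def)
    show "y 0 = a" "y1 0 = b" by (simp_all add: y_def y1_def P_def R_def)
  qed
qed

end

section \<open>Fundamental solutions and analyticity of the characteristic determinant\<close>

context hill
begin

text \<open>The cosine-like and the sine-like solution with their derivatives. A choice operator is
  used because the functions are determined only on [0,1].\<close>

definition fund :: "complex \<Rightarrow> (real \<Rightarrow> complex) \<times> (real \<Rightarrow> complex) \<times> (real \<Rightarrow> complex) \<times> (real \<Rightarrow> complex)" where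
  "fund z = (SOME (y, y1, w, w1). hsol (z\<^sup>2) (\<lambda>s. 0) y y1 \<and> y 0 = 1 \<and> y1 0 = 0 \<and>
     hsol (z\<^sup>2) (\<lambda>s. 0) w w1 \<and> w 0 = 0 \<and> w1 0 = 1)"

definition "\<theta> z = fst (fund z)"
definition "\<theta>' z = fst (snd (fund z))"
definition "\<phi> z = fst (snd (snd (fund z)))"
definition "\<phi>' z = snd (snd (snd (fund z)))"

lemma fund:
  assumes "adm z"
  shows "hsol (z\<^sup>2) (\<lambda>s. 0) (\<theta> z) (\<theta>' z)" "\<theta> z 0 = 1" "\<theta>' z 0 = 0"
    "hsol (z\<^sup>2) (\<lambda>s. 0) (\<phi> z) (\<phi>' z)" "\<phi> z 0 = 0" "\<phi>' z 0 = 1"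
proof -
  obtain y y1 where 1: "hsol (z\<^sup>2) (\<lambda>s. 0) y y1" "y 0 = 1" "y1 0 = 0"
    using hsol_exists[OF assms] by metis
  obtain w w1 where 2: "hsol (z\<^sup>2) (\<lambda>s. 0) w w1" "w 0 = 0" "w1 0 = 1"
    using hsol_exists[OF assms] by metis
  have "\<exists>p. case p of (y, y1, w, w1) \<Rightarrow> hsol (z\<^sup>2) (\<lambda>s. 0) y y1 \<and> y 0 = 1 \<and> y1 0 = 0 \<and>
     hsol (z\<^sup>2) (\<lambda>s. 0) w w1 \<and> w 0 = 0 \<and> w1 0 = 1"
    by (rule exI[of _ "(y, y1, w, w1)"]) (simp add: 1 2)
  from someI_ex[OF this]
  have "case fund z of (y, y1, w, w1) \<Rightarrow> hsol (z\<^sup>2) (\<lambda>s. 0) y y1 \<and> y 0 = 1 \<and> y1 0 = 0 \<and>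
     hsol (z\<^sup>2) (\<lambda>s. 0) w w1 \<and> w 0 = 0 \<and> w1 0 = 1"
    by (simp only: fund_def)
  then show "hsol (z\<^sup>2) (\<lambda>s. 0) (\<theta> z) (\<theta>' z)" "\<theta> z 0 = 1" "\<theta>' z 0 = 0"
    "hsol (z\<^sup>2) (\<lambda>s. 0) (\<phi> z) (\<phi>' z)" "\<phi> z 0 = 0" "\<phi>' z 0 = 1"
    by (simp_all add: \<theta>_def \<theta>'_def \<phi>_def \<phi>'_def split_beta)
qed

lemma hill_F_eq:
  assumes z: "adm z" shows "hill_F q (z\<^sup>2) = \<theta> z 1 + \<phi>' z 1"
  unfolding hill_F_def
proof (rule the_equality)
  show "\<exists>y y1 w w1. ode_sol q (z\<^sup>2) y y1 \<and> y 0 = 1 \<and> y1 0 = 0 \<and> ode_sol q (z\<^sup>2) w w1 \<and> w 0 = 0 \<and>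
      w1 0 = 1 \<and> \<theta> z 1 + \<phi>' z 1 = y 1 + w1 1"
    by (rule exI[of _ "\<theta> z"], rule exI[of _ "\<theta>' z"], rule exI[of _ "\<phi> z"], rule exI[of _ "\<phi>' z"])
      (simp add: ode_sol_iff_hsol fund[OF z])
  fix v
  assume "\<exists>y y1 w w1. ode_sol q (z\<^sup>2) y y1 \<and> y 0 = 1 \<and> y1 0 = 0 \<and> ode_sol q (z\<^sup>2) w w1 \<and> w 0 = 0 \<and>
      w1 0 = 1 \<and> v = y 1 + w1 1"
  then obtain y y1 w w1 where h: "hsol (z\<^sup>2) (\<lambda>s. 0) y y1" "y 0 = 1" "y1 0 = 0"
    "hsol (z\<^sup>2) (\<lambda>s. 0) w w1" "w 0 = 0" "w1 0 = 1" "v = y 1 + w1 1"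
    unfolding ode_sol_iff_hsol by (elim exE conjE)
  have "y 1 = \<theta> z 1" "w1 1 = \<phi>' z 1"
    using hsol_unique[OF h(1) fund(1)[OF z] z, of 1] hsol_unique[OF h(4) fund(4)[OF z] z, of 1]
      h fund[OF z] by auto
  then show "v = \<theta> z 1 + \<phi>' z 1" using h(7) by simp
qed

lemma fund_bound:
  assumes z: "adm z" and x: "x \<in> {0..1}"
  shows "norm (\<theta> z x) \<le> 6" "norm (\<phi> z x) \<le> 6 / norm z" "norm (\<phi> z x) \<le> 6"
proof -
  have i: "integral {0..1} (\<lambda>s::real. norm (0::complex)) = 0" by simp
  show "norm (\<theta> z x) \<le> 6"
    using hsol_bound[OF fund(1)[OF z] z absolutely_integrable_zero x] fund[OF z] by simp
  show *: "norm (\<phi> z x) \<le> 6 / norm z"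
    using hsol_bound[OF fund(4)[OF z] z absolutely_integrable_zero x] fund[OF z] by simp
  have "6 / norm z \<le> 6 / 1" using adm_nz[OF z] by (intro divide_left_mono) auto
  then show "norm (\<phi> z x) \<le> 6" using * by simp
qed

text \<open>Of the two terms in the trace, the first gains 1/|z| from the kernel sin / z, the second
  from \<open>\<phi> z\<close> itself being at most 6 / |z|. Each contributes 3 * 6 * I / |z|, hence
  36.\<close>

lemma hill_F_asymptotic:
  assumes z: "adm z" shows "norm (hill_F q (z\<^sup>2) - 2 * cos z) \<le> 36 * I / norm z"
proof -
  have z0: "z \<noteq> 0" by (rule adm_nz(1)[OF z])
  define a where "a = integral {0..1} (\<lambda>s. (q s * \<theta> z s + 0) * (sin (z * of_real (1 - s)) / z))"
  define b where "b = integral {0..1} (\<lambda>s. (q s * \<phi> z s + 0) * cos (z * of_real (1 - s)))"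
  have one: "(1::real) \<in> {0..1}" by simp
  have "\<theta> z 1 = cos z + a"
    using variation_of_constants(1)[OF fund(1)[OF z] z0 one] fund(2,3)[OF z] by (simp add: a_def)
  moreover have "\<phi>' z 1 = cos z + b"
    using variation_of_constants(2)[OF fund(4)[OF z] z0 one] fund(5,6)[OF z] by (simp add: b_def)
  ultimately have "hill_F q (z\<^sup>2) - 2 * cos z = a + b" using hill_F_eq[OF z] by simp
  also have "norm (a + b) \<le> norm a + norm b" by (rule norm_triangle_ineq)
  also have "norm a \<le> 3 / norm z * (I * 6 + integral {0..1} (\<lambda>s::real. norm (0::complex)))"
    unfolding a_def
    by (rule norm_source_integral_le(1)[OF z one hsol_continuous(1)[OF fund(1)[OF z]] fund_bound(1)[OF z] absolutely_integrable_zero])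
  also have "norm b \<le> 3 * (I * (6 / norm z) + integral {0..1} (\<lambda>s::real. norm (0::complex)))"
    unfolding b_def
    by (rule norm_source_integral_le(2)[OF z one hsol_continuous(1)[OF fund(4)[OF z]] fund_bound(2)[OF z] absolutely_integrable_zero])
  finally show ?thesis by (simp add: algebra_simps)
qed

text \<open>Lagrange's identity: (w y' - w' y)' = (\<mu> - lam) w y. For equal parameters it is the
  constancy of the Wronskian, for distinct ones it expresses differences of boundary values as
  integrals.\<close>

lemma wronskian_diff:
  assumes "hsol lam (\<lambda>s. 0) y y1" "hsol \<mu> (\<lambda>s. 0) w w1"
  shows "w 1 * y1 1 - w1 1 * y 1 - (w 0 * y1 0 - w1 0 * y 0) = (\<mu> - lam) * integral {0..1} (\<lambda>s. w s * y s)"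
proof -
  have p: "primitive_on01 y1 y" "primitive_on01 w1 w"
    "primitive_on01 (\<lambda>s. (q s - lam) * y s + 0) y1" "primitive_on01 (\<lambda>s. (q s - \<mu>) * w s + 0) w1"
    using assms by (simp_all add: hsol_def)
  have "primitive_on01 (\<lambda>s. (w1 s * y1 s + w s * ((q s - lam) * y s + 0)) -
        (((q s - \<mu>) * w s + 0) * y s + w1 s * y1 s)) (\<lambda>s. w s * y1 s - w1 s * y s)"
    by (intro primitive_on01_diff_fun primitive_on01_mult p)
  moreover have "(w1 s * y1 s + w s * ((q s - lam) * y s + 0)) -
        (((q s - \<mu>) * w s + 0) * y s + w1 s * y1 s) = (\<mu> - lam) * (w s * y s)" for s
    by (simp add: algebra_simps)
  ultimately have P: "primitive_on01 (\<lambda>s. (\<mu> - lam) * (w s * y s)) (\<lambda>s. w s * y1 s - w1 s * y s)"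
    by (simp only:)
  from integral_unique[OF primitive_on01_at1[OF P]] show ?thesis by simp
qed

lemma wronskian:
  assumes z: "adm z" shows "\<theta> z 1 * \<phi>' z 1 - \<theta>' z 1 * \<phi> z 1 = 1"
  using wronskian_diff[OF fund(4)[OF z] fund(1)[OF z]] fund[OF z] by simp

text \<open>The monodromy matrix has determinant 1 by \<open>wronskian\<close> and the eigenvalue k
  = cis t, so 1 - k F + k^2 = 0 for its trace F. Division by k leaves F = 2 cos t.\<close>

lemma eigenvalue_hill_F:
  assumes z: "adm z" and e: "is_eigenvalue q t (z\<^sup>2)"
  shows "char_det q t (z\<^sup>2) = 0"
proof -
  obtain y y1 where h: "hsol (z\<^sup>2) (\<lambda>s. 0) y y1" and nz: "\<exists>x\<in>{0..1}. y x \<noteq> 0"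
    and bc: "y 1 = cis t * y 0" "y1 1 = cis t * y1 0"
    using e unfolding is_eigenvalue_def ode_sol_iff_hsol by (elim exE conjE)
  define a b k where "a = y 0" and "b = y1 0" and "k = cis t"
  have c: "hsol (z\<^sup>2) (\<lambda>s. 0) (\<lambda>s. a * \<theta> z s + b * \<phi> z s) (\<lambda>s. a * \<theta>' z s + b * \<phi>' z s)"
    using hsol_combine[OF fund(1)[OF z] fund(4)[OF z], of a b] by simp
  have eq: "y x = a * \<theta> z x + b * \<phi> z x \<and> y1 x = a * \<theta>' z x + b * \<phi>' z x" if "x \<in> {0..1}" for x
    by (rule hsol_unique[OF h c z _ _ that]) (simp_all add: fund[OF z] a_def b_def)
  have ab: "a \<noteq> 0 \<or> b \<noteq> 0"
  proof (rule ccontr)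
    assume "\<not> (a \<noteq> 0 \<or> b \<noteq> 0)"
    then have "y x = 0" if "x \<in> {0..1}" for x using eq[OF that] by simp
    then show False using nz by blast
  qed
  have 1: "a * \<theta> z 1 + b * \<phi> z 1 = k * a" "a * \<theta>' z 1 + b * \<phi>' z 1 = k * b"
    using eq[of 1] bc by (simp_all add: a_def b_def k_def)
  define D where "D = (\<theta> z 1 - k) * (\<phi>' z 1 - k) - \<phi> z 1 * \<theta>' z 1"
  have "a * D = 0" "b * D = 0" unfolding D_def using 1 by algebra+
  then have "D = 0" using ab by auto
  then have "1 - k * (\<theta> z 1 + \<phi>' z 1) + k * k = 0"
    using wronskian[OF z] unfolding D_def by algebra
  then have "1 - k * hill_F q (z\<^sup>2) + k\<^sup>2 = 0"
    by (simp only: hill_F_eq[OF z] power2_eq_square[of k])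
  then have A: "cis (-t) * (1 - k * hill_F q (z\<^sup>2) + k\<^sup>2) = 0" by simp
  have C1: "cis (-t) * k = 1" by (simp add: k_def cis_mult)
  have "cis (-t) * (1 - k * hill_F q (z\<^sup>2) + k\<^sup>2) = cis (-t) - (cis (-t) * k) * hill_F q (z\<^sup>2) + (cis (-t) * k) * k"
    by (simp add: algebra_simps power2_eq_square)
  with A C1 have "cis (-t) - hill_F q (z\<^sup>2) + k = 0" by simp
  then have "hill_F q (z\<^sup>2) = cis (-t) + cis t" unfolding k_def by algebra
  also have "\<dots> = 2 * of_real (cos t)" by (simp add: complex_eq_iff)
  finally show ?thesis by (simp add: char_det_def)
qed

text \<open>The solution u for w^2 solves the equation for z^2 with the source (z^2 - w^2) u, so the
  difference of the two solutions has zero initial data and \<open>hsol_bound\<close> applies. The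
  constant is 6 from that bound times 6 from |u| <= 6.\<close>

lemma fund_continuous_parameter:
  assumes z: "adm z" and w: "adm w" and x: "x \<in> {0..1}"
  shows "norm (\<theta> w x - \<theta> z x) \<le> 36 * norm (z\<^sup>2 - w\<^sup>2)" "norm (\<phi> w x - \<phi> z x) \<le> 36 * norm (z\<^sup>2 - w\<^sup>2)"
proof -
  have gen: "norm (u x - v x) \<le> 36 * norm (z\<^sup>2 - w\<^sup>2)"
    if u: "hsol (w\<^sup>2) (\<lambda>s. 0) u u1" and v: "hsol (z\<^sup>2) (\<lambda>s. 0) v v1"
      and i: "u 0 = v 0" "u1 0 = v1 0" and b: "\<And>x. x \<in> {0..1} \<Longrightarrow> norm (u x) \<le> 6" for u u1 v v1
  proof -
    have cu: "continuous_on {0..1} u" by (rule hsol_continuous[OF u])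
    have "(\<lambda>s. (q s - w\<^sup>2) * u s + 0) = (\<lambda>s. (q s - z\<^sup>2) * u s + (z\<^sup>2 - w\<^sup>2) * u s)"
      by (auto simp: algebra_simps)
    then have u': "hsol (z\<^sup>2) (\<lambda>s. (z\<^sup>2 - w\<^sup>2) * u s) u u1" using u by (simp only: hsol_def)
    have d: "hsol (z\<^sup>2) (\<lambda>s. (z\<^sup>2 - w\<^sup>2) * u s) (\<lambda>s. u s - v s) (\<lambda>s. u1 s - v1 s)"
      using hsol_combine[OF u' v, of 1 "-1"] by simp
    have ai: "(\<lambda>s. (z\<^sup>2 - w\<^sup>2) * u s) absolutely_integrable_on {0..1}"
      by (rule absolutely_integrable_continuous_real) (intro continuous_intros cu)
    have "integral {0..1} (\<lambda>s. norm ((z\<^sup>2 - w\<^sup>2) * u s)) \<le> integral {0..1} (\<lambda>s::real. norm (z\<^sup>2 - w\<^sup>2) * 6)"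
    proof (rule integral_le)
      show "(\<lambda>s. norm ((z\<^sup>2 - w\<^sup>2) * u s)) integrable_on {0..1}"
        by (rule integrable_continuous_real) (intro continuous_intros cu)
      show "(\<lambda>s::real. norm (z\<^sup>2 - w\<^sup>2) * 6) integrable_on {0..1}"
        by (rule integrable_continuous_real) (intro continuous_intros)
      show "norm ((z\<^sup>2 - w\<^sup>2) * u s) \<le> norm (z\<^sup>2 - w\<^sup>2) * 6" if "s \<in> {0..1}" for s
        unfolding norm_mult by (rule mult_left_mono[OF b[OF that] norm_ge_zero])
    qed
    then have J: "integral {0..1} (\<lambda>s. norm ((z\<^sup>2 - w\<^sup>2) * u s)) \<le> norm (z\<^sup>2 - w\<^sup>2) * 6" by simp
    have "6 / norm z \<le> 6 / 1" using adm_nz[OF z] by (intro divide_left_mono) auto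
    then have "6 / norm z * integral {0..1} (\<lambda>s. norm ((z\<^sup>2 - w\<^sup>2) * u s)) \<le> 6 * (norm (z\<^sup>2 - w\<^sup>2) * 6)"
      using J by (intro mult_mono integral_nonneg) (auto intro!: integrable_continuous_real continuous_intros cu)
    then show ?thesis using hsol_bound[OF d z ai x] i by simp
  qed
  show "norm (\<theta> w x - \<theta> z x) \<le> 36 * norm (z\<^sup>2 - w\<^sup>2)"
    by (rule gen[OF fund(1)[OF w] fund(1)[OF z]]) (use fund[OF w] fund[OF z] fund_bound[OF w] in auto)
  show "norm (\<phi> w x - \<phi> z x) \<le> 36 * norm (z\<^sup>2 - w\<^sup>2)"
    by (rule gen[OF fund(4)[OF w] fund(4)[OF z]]) (use fund[OF w] fund[OF z] fund_bound[OF w] in auto)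
qed

lemma integral_product_tendsto:
  fixes u :: "complex \<Rightarrow> real \<Rightarrow> complex" and v :: "real \<Rightarrow> complex"
  assumes u: "\<And>w. adm w \<Longrightarrow> continuous_on {0..1} (u w)" and z: "adm z"
    and lip: "\<And>w x. adm w \<Longrightarrow> x \<in> {0..1} \<Longrightarrow> norm (u w x - u z x) \<le> 36 * norm (z\<^sup>2 - w\<^sup>2)"
    and v: "continuous_on {0..1} v" "\<And>x. x \<in> {0..1} \<Longrightarrow> norm (v x) \<le> 6"
    and ev: "\<forall>\<^sub>F w in at z. adm w"
  shows "((\<lambda>w. integral {0..1} (\<lambda>s. u w s * v s)) \<longlongrightarrow> integral {0..1} (\<lambda>s. u z s * v s)) (at z)"
proof (rule Lim_null_comparison[where g = "\<lambda>w. 216 * norm (z\<^sup>2 - w\<^sup>2)", THEN Lim_null[THEN iffD2]])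
  have "((\<lambda>w. 216 * norm (z\<^sup>2 - w\<^sup>2)) \<longlongrightarrow> 216 * norm (z\<^sup>2 - z\<^sup>2)) (at z)" by (intro tendsto_intros)
  then show "((\<lambda>w. 216 * norm (z\<^sup>2 - w\<^sup>2)) \<longlongrightarrow> 0) (at z)" by simp
  show "\<forall>\<^sub>F w in at z. norm (integral {0..1} (\<lambda>s. u w s * v s) - integral {0..1} (\<lambda>s. u z s * v s))
     \<le> 216 * norm (z\<^sup>2 - w\<^sup>2)"
    using ev
  proof eventually_elim
    case (elim w)
    have iu: "(\<lambda>s. u w s * v s) integrable_on {0..1}" if "adm w" for w
      by (rule integrable_continuous_real) (intro continuous_intros u that v(1))
    have "((\<lambda>s. u w s * v s - u z s * v s) has_integral
        integral {0..1} (\<lambda>s. u w s * v s) - integral {0..1} (\<lambda>s. u z s * v s)) {0..1}"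
      by (intro has_integral_diff integrable_integral iu elim z)
    then have "((\<lambda>s. (u w s - u z s) * v s) has_integral
        integral {0..1} (\<lambda>s. u w s * v s) - integral {0..1} (\<lambda>s. u z s * v s)) {0..1}"
      by (simp only: left_diff_distrib)
    note hi = this
    have pt: "norm ((u w x - u z x) * v x) \<le> 216 * norm (z\<^sup>2 - w\<^sup>2)" if "x \<in> {0..1} - {}" for x
    proof -
      have "norm ((u w x - u z x) * v x) \<le> (36 * norm (z\<^sup>2 - w\<^sup>2)) * 6"
        unfolding norm_mult by (rule mult_mono[OF lip[OF elim] v(2)]) (use that in auto)
      then show ?thesis by simp
    qed
    show ?case using has_integral_bound_real[OF _ finite.emptyI hi pt] by simp
  qed
qed

lemma adm_open: "open {z. adm z}"
proof -
  have "{z. adm z} = {z. norm z > 6 * I + 1} \<inter> {z. \<bar>Im z\<bar> < 1}" by (auto simp: admissible_def)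
  moreover have "open {z::complex. norm z > 6 * I + 1}" "open {z. \<bar>Im z\<bar> < 1}"
    by (intro open_Collect_less continuous_intros)+
  ultimately show ?thesis by (simp add: open_Int)
qed

text \<open>Four Lagrange identities between the solutions for w^2 and z^2 give the increment of the
  trace as (w^2 - z^2) E w, with E continuous at z. So the difference quotient converges, without
  any theorem on analytic dependence on parameters.\<close>

lemma hill_F_square_holomorphic: "(\<lambda>z. hill_F q (z\<^sup>2)) holomorphic_on {z. adm z}"
  unfolding holomorphic_on_open[OF adm_open]
proof (intro ballI)
  fix z assume "z \<in> {z. adm z}"
  then have z: "adm z" by simp
  have ev: "\<forall>\<^sub>F w in at z. adm w"
    using eventually_at_topological[of adm z UNIV] adm_open z by auto
  \<comment> \<open>Obtained by eliminating \<open>\<theta>' w 1\<close> and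
    \<open>\<phi> w 1\<close> from the four identities below with the help of the Wronskian at
    \<open>z\<close>.\<close>
  define E where "E w = \<theta> z 1 * integral {0..1} (\<lambda>s. \<theta> w s * \<phi> z s) - \<phi> z 1 * integral {0..1} (\<lambda>s. \<theta> w s * \<theta> z s)
     - \<phi>' z 1 * integral {0..1} (\<lambda>s. \<phi> w s * \<theta> z s) + \<theta>' z 1 * integral {0..1} (\<lambda>s. \<phi> w s * \<phi> z s)" for w
  have key: "hill_F q (w\<^sup>2) - hill_F q (z\<^sup>2) = (w\<^sup>2 - z\<^sup>2) * E w" if w: "adm w" for w
  proof -
    define i1 i2 i3 i4 where "i1 = integral {0..1} (\<lambda>s. \<theta> w s * \<theta> z s)"
      and "i2 = integral {0..1} (\<lambda>s. \<theta> w s * \<phi> z s)"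
      and "i3 = integral {0..1} (\<lambda>s. \<phi> w s * \<theta> z s)"
      and "i4 = integral {0..1} (\<lambda>s. \<phi> w s * \<phi> z s)"
    have "\<theta> w 1 * \<theta>' z 1 - \<theta>' w 1 * \<theta> z 1 = (w\<^sup>2 - z\<^sup>2) * i1"
      using wronskian_diff[OF fund(1)[OF z] fund(1)[OF w]] fund[OF z] fund[OF w] by (simp add: i1_def)
    moreover have "\<theta> w 1 * \<phi>' z 1 - \<theta>' w 1 * \<phi> z 1 = 1 + (w\<^sup>2 - z\<^sup>2) * i2"
      using wronskian_diff[OF fund(4)[OF z] fund(1)[OF w]] fund[OF z] fund[OF w] by (simp add: i2_def algebra_simps)
    moreover have "\<phi> w 1 * \<theta>' z 1 - \<phi>' w 1 * \<theta> z 1 = - 1 + (w\<^sup>2 - z\<^sup>2) * i3"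
      using wronskian_diff[OF fund(1)[OF z] fund(4)[OF w]] fund[OF z] fund[OF w] by (simp add: i3_def algebra_simps)
    moreover have "\<phi> w 1 * \<phi>' z 1 - \<phi>' w 1 * \<phi> z 1 = (w\<^sup>2 - z\<^sup>2) * i4"
      using wronskian_diff[OF fund(4)[OF z] fund(4)[OF w]] fund[OF z] fund[OF w] by (simp add: i4_def)
    moreover note wronskian[OF z]
    ultimately show ?thesis
      unfolding hill_F_eq[OF z] hill_F_eq[OF w] E_def
        i1_def[symmetric] i2_def[symmetric] i3_def[symmetric] i4_def[symmetric]
      by algebra
  qed
  note ct = hsol_continuous(1)[OF fund(1)] and cp = hsol_continuous(1)[OF fund(4)]
  have "(E \<longlongrightarrow> E z) (at z)"
    unfolding E_def
    by (intro tendsto_intros integral_product_tendsto[of \<theta>] integral_product_tendsto[of \<phi>]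
        ct cp z ev fund_continuous_parameter(1)[OF z] fund_continuous_parameter(2)[OF z]
        fund_bound(1)[OF z] fund_bound(3)[OF z])
  then have L: "((\<lambda>w. (w + z) * E w) \<longlongrightarrow> (z + z) * E z) (at z)" by (intro tendsto_intros)
  have "((\<lambda>w. (hill_F q (w\<^sup>2) - hill_F q (z\<^sup>2)) / (w - z)) \<longlongrightarrow> (z + z) * E z) (at z)"
  proof (rule Lim_transform_eventually[OF L])
    have "\<forall>\<^sub>F w in at z. w \<noteq> z" by (simp add: eventually_at_filter)
    with ev show "\<forall>\<^sub>F w in at z. (w + z) * E w = (hill_F q (w\<^sup>2) - hill_F q (z\<^sup>2)) / (w - z)"
    proof eventually_elim
      case (elim w)
      have "(hill_F q (w\<^sup>2) - hill_F q (z\<^sup>2)) = (w - z) * ((w + z) * E w)"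
        using key[OF elim(1)] by (simp add: power2_eq_square algebra_simps)
      then show ?case using elim(2) by simp
    qed
  qed
  then show "\<exists>f'. ((\<lambda>z. hill_F q (z\<^sup>2)) has_field_derivative f') (at z)"
    unfolding has_field_derivative_iff by blast
qed

end

text \<open>Both incidences would give d(b,c) = d(b,a) + d(a,c) and d(a,c) = d(a,b) + d(b,c), hence
  d(a,b) = 0. So among three distinct points one can be chosen off the segment between the other
  two.\<close>

lemma pivot_off_segment:
  fixes a b c :: "'a::euclidean_space"
  assumes "a \<noteq> b" "a \<in> closed_segment b c"
  shows "b \<notin> closed_segment a c"
proof
  assume "b \<in> closed_segment a c"
  then have "dist a c = dist a b + dist b c" using between[of a c b] between_mem_segment[of a c b] by simp
  moreover have "dist b c = dist b a + dist a c"
    using assms(2) between[of b c a] between_mem_segment[of b c a] by simp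
  ultimately have "dist a b = 0" by (simp add: dist_commute)
  then show False using assms(1) by simp
qed

text \<open>For \<open>h = g - \<zeta>\<^sup>2\<close> with \<open>|g''| \<le> 1/2\<close>, a second divided difference of \<open>h\<close> is close to \<open>-1\<close>
  and hence nonzero, so that \<open>h\<close> cannot have three zeros counted with multiplicity.\<close>

lemma perturbed_square_zeros:
  fixes g :: "complex \<Rightarrow> complex"
  assumes S: "convex S"
    and g': "\<And>x. x \<in> S \<Longrightarrow> (g has_field_derivative g' x) (at x)"
    and g'': "\<And>x. x \<in> S \<Longrightarrow> (g' has_field_derivative g'' x) (at x)"
    and B: "\<And>x. x \<in> S \<Longrightarrow> norm (g'' x) \<le> 1 / 2"
    and a: "a \<in> S" "g a = a\<^sup>2" and b: "b \<in> S" "g b = b\<^sup>2" and ab: "a \<noteq> b"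
  shows "g' a \<noteq> 2 * a" and "\<And>c. c \<in> S \<Longrightarrow> g c = c\<^sup>2 \<Longrightarrow> c = a \<or> c = b"
proof -
  \<comment> \<open>The remainder is bounded by sup |g''| times |z - w|^2, without the usual 1/2;
    all that matters below is that the constant is less than 1.\<close>
  have T: "norm (g z - (g w + g' w * (z - w))) \<le> 1 / 2 * norm (z - w) ^ 2" if "w \<in> S" "z \<in> S" for w z
  proof -
    define f where "f = (\<lambda>i::nat. if i = 0 then g else if i = 1 then g' else g'')"
    have "norm (f 0 z - (\<Sum>i\<le>1. f i w * (z - w) ^ i / (fact i))) \<le> 1 / 2 * norm (z - w) ^ Suc 1 / fact 1"
    proof (rule complex_Taylor[OF S _ _ that])
      fix i x assume "x \<in> S" "i \<le> (1::nat)"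
      then show "(f i has_field_derivative f (Suc i) x) (at x within S)"
        using g'[of x] g''[of x] by (auto simp: f_def le_Suc_eq intro: has_field_derivative_at_within)
    qed (use B in \<open>auto simp: f_def\<close>)
    then show ?thesis by (simp add: f_def numeral_2_eq_2)
  qed
  show "g' a \<noteq> 2 * a"
  proof
    assume h: "g' a = 2 * a"
    have "g b - (g a + g' a * (b - a)) = (b - a)\<^sup>2"
      using a b h by (simp add: power2_eq_square algebra_simps)
    then have "norm (b - a) ^ 2 \<le> 1 / 2 * norm (b - a) ^ 2"
      using T[OF a(1) b(1)] by (simp add: norm_power)
    then show False using ab by simp
  qed
  have no3: False if p: "p \<in> S" "g p = p\<^sup>2" and u: "u \<in> S" "g u = u\<^sup>2" and v: "v \<in> S" "g v = v\<^sup>2"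
    and ne: "u \<noteq> v" and np: "p \<notin> closed_segment u v" for p u v
  proof -
    \<comment> \<open>First divided difference with pivot \<open>p\<close>. Its derivative is at
      most 1/2 by the Taylor bound \<open>T\<close>, but at the zeros u and v it takes the values u
      + p and v + p, whose distance is |u - v|. The segment must avoid the pivot.\<close>
    define k where "k \<zeta> = (g \<zeta> - g p) / (\<zeta> - p)" for \<zeta>
    have sub: "closed_segment u v \<subseteq> S" by (rule closed_segment_subset[OF u(1) v(1) S])
    have "norm (k u - k v) \<le> 1 / 2 * norm (u - v)"
    proof (rule field_differentiable_bound[where S = "closed_segment u v"])
      show "convex (closed_segment u v)" by (rule convex_closed_segment)
      fix \<zeta> assume z: "\<zeta> \<in> closed_segment u v"
      then have zp: "\<zeta> - p \<noteq> 0" and zS: "\<zeta> \<in> S" using np sub by auto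
      show "(k has_field_derivative (g' \<zeta> * (\<zeta> - p) - (g \<zeta> - g p)) / (\<zeta> - p)\<^sup>2) (at \<zeta> within closed_segment u v)"
        unfolding k_def[abs_def] using zp
        by (auto intro!: derivative_eq_intros has_field_derivative_at_within[OF g'[OF zS]] simp: power2_eq_square)
      have "norm (g' \<zeta> * (\<zeta> - p) - (g \<zeta> - g p)) \<le> 1 / 2 * norm (\<zeta> - p) ^ 2"
        using T[OF zS p(1)] by (simp add: algebra_simps norm_minus_commute)
      then show "norm ((g' \<zeta> * (\<zeta> - p) - (g \<zeta> - g p)) / (\<zeta> - p)\<^sup>2) \<le> 1 / 2"
        using zp by (simp add: norm_divide norm_power divide_le_eq)
    qed auto
    moreover have "k u = u + p" "k v = v + p"
    proof -
      have "u - p \<noteq> 0" "v - p \<noteq> 0" using np by auto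
      then show "k u = u + p" "k v = v + p"
        using p u v by (auto simp: k_def power2_eq_square divide_eq_eq algebra_simps)
    qed
    ultimately show False using ne by simp
  qed
  fix c assume c: "c \<in> S" "g c = c\<^sup>2"
  show "c = a \<or> c = b"
  proof (rule ccontr)
    assume n: "\<not> (c = a \<or> c = b)"
    show False
    proof (cases "c \<in> closed_segment a b")
      case False
      then show False using no3[OF c a b ab] by simp
    next
      case True
      then have "a \<notin> closed_segment c b" using pivot_off_segment[of c a b] n by simp
      then show False using no3[OF a c b] n by auto
    qed
  qed
qed

section \<open>Counting the zeros of the characteristic determinant\<close>

text \<open>Take the principal root z: Re z >= 0 gives |z + m| >= m with m = 2 pi n + t, so |z - m|
  < 15 pi n \<rho> / m <= 15 \<rho> / 2. Adding t <= \<rho> < 1/40 stays below 8.5/40 < 1/4.\<close>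

lemma Dset_square:
  assumes n: "n > 0" and t: "0 \<le> t" "t \<le> \<rho>" and \<rho>: "\<rho> < 1 / 40" and l: "lam \<in> Dset (int n) t \<rho>"
  obtains \<zeta> where "norm \<zeta> < 1 / 4" "lam = (of_real (2 * pi * real n) + \<zeta>)\<^sup>2"
proof -
  define z where "z = csqrt lam"
  have z2: "z\<^sup>2 = lam" by (simp add: z_def)
  have Re: "Re z \<ge> 0" using csqrt_principal[of lam] by (auto simp: z_def)
  define m where "m = 2 * pi * real n + t"
  have m: "m \<ge> 2 * pi * real n" "m > 0" using t n by (auto simp: m_def intro!: add_pos_nonneg)
  have "norm (z - of_real m) * norm (z + of_real m) < 15 * pi * real n * \<rho>"
    using l unfolding Dset_def
    by (simp add: norm_mult[symmetric] z2[symmetric] m_def power2_eq_square algebra_simps)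
  moreover have "m \<le> norm (z + of_real m)" using Re complex_Re_le_cmod[of "z + of_real m"] by simp
  then have "norm (z - of_real m) * m \<le> norm (z - of_real m) * norm (z + of_real m)"
    by (rule mult_left_mono) simp
  ultimately have "norm (z - of_real m) * m < 15 * pi * real n * \<rho>" by simp
  moreover have "15 * pi * real n * \<rho> \<le> (15 / 2 * \<rho>) * m"
    using m(1) t mult_left_mono[OF m(1), of "15 / 2 * \<rho>"] by simp
  ultimately have "norm (z - of_real m) * m < (15 / 2 * \<rho>) * m" by linarith
  then have "norm (z - of_real m) < 15 / 2 * \<rho>"
    using m(2) by (simp only: mult_less_cancel_right_pos)
  then have "norm (z - of_real (2 * pi * real n)) < 15 / 2 * \<rho> + t"
    using norm_triangle_ineq[of "z - of_real m" "of_real t"] t by (simp add: m_def)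
  then have "norm (z - of_real (2 * pi * real n)) < 1 / 4" using t \<rho> by simp
  then show ?thesis using that[of "z - of_real (2 * pi * real n)"] z2 by simp
qed

context hill
begin

text \<open>The threshold ensures |z| >= 5 n > 6 I + 1, and it also makes the error 36 I / |z| of
  the trace less than 1/100, as the zero count demands.\<close>

lemma adm_shift:
  assumes n: "real n \<ge> 3600 * I + 10" and \<zeta>: "norm \<zeta> < 1"
  shows "adm (of_real (2 * pi * real n) + \<zeta>)" "norm (of_real (2 * pi * real n) + \<zeta>) \<ge> 5 * real n"
    "Re (of_real (2 * pi * real n) + \<zeta>) > 1"
proof -
  have n10: "real n \<ge> 10" using n I_nonneg by simp
  have p: "2 * pi * real n \<ge> 6 * real n" using pi_gt3 by (intro mult_right_mono) auto
  have "norm (of_real (2 * pi * real n) + \<zeta>) \<ge> 2 * pi * real n - 1"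
    using norm_triangle_ineq2[of "of_real (2 * pi * real n)" "- \<zeta>"] \<zeta> by (simp add: norm_mult)
  then show 5: "norm (of_real (2 * pi * real n) + \<zeta>) \<ge> 5 * real n" using p n10 by linarith
  have "\<bar>Im \<zeta>\<bar> < 1" using abs_Im_le_cmod[of \<zeta>] \<zeta> by simp
  then show "adm (of_real (2 * pi * real n) + \<zeta>)"
    using 5 n I_nonneg by (simp add: admissible_def)
  have "\<bar>Re \<zeta>\<bar> < 1" using abs_Re_le_cmod[of \<zeta>] \<zeta> by simp
  moreover have "Re (of_real (2 * pi * real n) + \<zeta>) = 2 * pi * real n + Re \<zeta>" by simp
  ultimately show "Re (of_real (2 * pi * real n) + \<zeta>) > 1" using p n10 by linarith
qed

lemma char_det_two_zeros:
  assumes n: "real n \<ge> 3600 * I + 10" and t: "0 \<le> t" "t \<le> \<rho>" and \<rho>: "\<rho> < 1 / 40"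
    and l1: "l1 \<in> Dset (int n) t \<rho>" "char_det q t l1 = 0"
    and l2: "l2 \<in> Dset (int n) t \<rho>" "char_det q t l2 = 0" and ne: "l1 \<noteq> l2"
  shows "zorder (char_det q t) l1 = 1"
    and "\<And>l. l \<in> Dset (int n) t \<rho> \<Longrightarrow> char_det q t l = 0 \<Longrightarrow> l = l1 \<or> l = l2"
proof -
  have n10: "real n \<ge> 10" using n I_nonneg by simp
  then have n0: "n > 0" by simp
  define c where "c = complex_of_real (2 * pi * real n)"
  define err where "err \<zeta> = hill_F q ((c + \<zeta>)\<^sup>2) - 2 * cos \<zeta>" for \<zeta>
  have adm: "adm (c + \<zeta>)" if "norm \<zeta> < 1" for \<zeta> using adm_shift(1)[OF n that] by (simp add: c_def)
  have cosc: "cos (c + \<zeta>) = cos \<zeta>" for \<zeta>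
  proof -
    have "c = of_real (2 * real n * pi)" by (simp add: c_def)
    then have "cos c = 1" "sin c = 0"
      by (simp_all only: cos_of_real sin_of_real cos_2npi sin_2npi of_real_1 of_real_0)
    then show ?thesis by (simp add: cos_add)
  qed
  have errb: "norm (err \<zeta>) < 1 / 100" if "norm \<zeta> < 1" for \<zeta>
  proof -
    have "norm (err \<zeta>) \<le> 36 * I / norm (c + \<zeta>)"
      using hill_F_asymptotic[OF adm[OF that]] by (simp add: err_def cosc)
    also have "\<dots> \<le> 36 * I / (5 * real n)"
      using adm_shift(2)[OF n that] n10 I_nonneg by (intro divide_left_mono) (auto simp: c_def intro!: mult_pos_pos)
    also have "\<dots> < 1 / 100" using n n10 I_nonneg by (simp add: divide_less_eq)
    finally show ?thesis .
  qed
  have herr: "err holomorphic_on ball 0 1"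
  proof -
    have "((\<lambda>z. hill_F q (z\<^sup>2)) \<circ> (\<lambda>\<zeta>. c + \<zeta>)) holomorphic_on ball 0 1"
      by (rule holomorphic_on_compose_gen[OF _ hill_F_square_holomorphic])
        (intro holomorphic_intros, rule image_subsetI, use adm in simp)
    then have "(\<lambda>\<zeta>. hill_F q ((c + \<zeta>)\<^sup>2)) holomorphic_on ball 0 1" by (simp add: o_def)
    then show ?thesis unfolding err_def[abs_def] by (intro holomorphic_intros)
  qed
  \<comment> \<open>Adding the square removes the leading part of the determinant: its zeros become
    the solutions of g \<zeta> = \<zeta>^2, and g has a small second derivative.\<close>
  define g where "g \<zeta> = err \<zeta> + 2 * cos \<zeta> - 2 * of_real (cos t) + \<zeta>\<^sup>2" for \<zeta>
  define g' where "g' \<zeta> = deriv err \<zeta> - 2 * sin \<zeta> + 2 * \<zeta>" for \<zeta>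
  define g'' where "g'' \<zeta> = deriv (deriv err) \<zeta> - 2 * cos \<zeta> + 2" for \<zeta>
  have gF: "g \<zeta> = char_det q t ((c + \<zeta>)\<^sup>2) + \<zeta>\<^sup>2" for \<zeta> by (simp add: g_def err_def char_det_def)
  let ?S = "ball (0::complex) (1/4)"
  have S1: "\<zeta> \<in> ball 0 1" if "\<zeta> \<in> ?S" for \<zeta> using that by simp
  have derr: "(err has_field_derivative deriv err \<zeta>) (at \<zeta>)" if "\<zeta> \<in> ?S" for \<zeta>
    by (rule holomorphic_derivI[OF herr open_ball S1[OF that]])
  have hderr: "deriv err holomorphic_on ball 0 1" by (rule holomorphic_deriv[OF herr open_ball])
  have dderr: "(deriv err has_field_derivative deriv (deriv err) \<zeta>) (at \<zeta>)" if "\<zeta> \<in> ?S" for \<zeta>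
    by (rule holomorphic_derivI[OF hderr open_ball S1[OF that]])
  have g'd: "(g has_field_derivative g' \<zeta>) (at \<zeta>)" if "\<zeta> \<in> ?S" for \<zeta>
    unfolding g_def[abs_def] g'_def using derr[OF that] by (auto intro!: derivative_eq_intros)
  have g''d: "(g' has_field_derivative g'' \<zeta>) (at \<zeta>)" if "\<zeta> \<in> ?S" for \<zeta>
    unfolding g''_def g'_def[abs_def] using dderr[OF that] by (auto intro!: derivative_eq_intros)
  \<comment> \<open>Cauchy's estimate on a disc of radius 1/2, where |err| < 1/100, gives 2 *
    (1/100) / (1/4) = 8/100; the cosine contributes 2 * 3/16. The sum 0.455 is below 1/2.\<close>
  have bound: "norm (g'' \<zeta>) \<le> 1 / 2" if z: "\<zeta> \<in> ?S" for \<zeta>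
  proof -
    have sub: "cball \<zeta> (1/2) \<subseteq> ball 0 1"
    proof
      fix w assume "w \<in> cball \<zeta> (1/2)"
      then have "norm (w - \<zeta>) \<le> 1/2" by (simp add: dist_norm norm_minus_commute)
      then show "w \<in> ball 0 1" using norm_triangle_ineq[of "w - \<zeta>" \<zeta>] z by simp
    qed
    have "norm ((deriv ^^ 2) err \<zeta>) \<le> fact 2 * (1/100) / (1/2) ^ 2"
    proof (rule Cauchy_higher_deriv_bound[where y = 0])
      show "err holomorphic_on ball \<zeta> (1/2)"
        by (rule holomorphic_on_subset[OF herr]) (use sub ball_subset_cball in blast)
      show "continuous_on (cball \<zeta> (1/2)) err"
        by (rule holomorphic_on_imp_continuous_on[OF holomorphic_on_subset[OF herr sub]])
      show "err w \<in> ball 0 (1/100)" if "w \<in> ball \<zeta> (1/2)" for w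
      proof -
        have "w \<in> ball 0 1" using that sub ball_subset_cball by blast
        then show ?thesis using errb[of w] by simp
      qed
    qed auto
    then have 1: "norm (deriv (deriv err) \<zeta>) \<le> 8 / 100" by (simp add: numeral_2_eq_2)
    have "norm (cos \<zeta> - 1) \<le> exp \<bar>Im \<zeta>\<bar> * (norm \<zeta>)\<^sup>2"
      using Taylor_cos[of \<zeta> 1] by (simp add: cos_coeff_def power2_eq_square)
    also have "\<dots> \<le> 3 * (1/4)\<^sup>2"
    proof (rule mult_mono)
      have "exp \<bar>Im \<zeta>\<bar> \<le> exp 1" using abs_Im_le_cmod[of \<zeta>] z by simp
      from order_trans[OF this exp_le] show "exp \<bar>Im \<zeta>\<bar> \<le> 3" .
      show "(norm \<zeta>)\<^sup>2 \<le> (1/4)\<^sup>2" using z by (intro power_mono) auto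
    qed auto
    finally have 2: "norm (cos \<zeta> - 1) \<le> 3 / 16" by (simp add: power2_eq_square)
    have "g'' \<zeta> = deriv (deriv err) \<zeta> - 2 * (cos \<zeta> - 1)" by (simp add: g''_def)
    then have "norm (g'' \<zeta>) \<le> norm (deriv (deriv err) \<zeta>) + norm (2 * (cos \<zeta> - 1))"
      by (simp only: norm_triangle_ineq4)
    also have "norm (2 * (cos \<zeta> - 1)) = 2 * norm (cos \<zeta> - 1)" unfolding norm_mult by simp
    also have "norm (deriv (deriv err) \<zeta>) + 2 * norm (cos \<zeta> - 1) \<le> 8 / 100 + 2 * (3/16)" using 1 2 by linarith
    finally show ?thesis by simp
  qed
  have conv: "convex ?S" by simp
  obtain a where a: "norm a < 1/4" "l1 = (c + a)\<^sup>2"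
    using Dset_square[OF n0 t \<rho> l1(1)] by (metis c_def)
  obtain b where b: "norm b < 1/4" "l2 = (c + b)\<^sup>2"
    using Dset_square[OF n0 t \<rho> l2(1)] by (metis c_def)
  have ab: "a \<noteq> b" using a b ne by auto
  have aS: "a \<in> ?S" "g a = a\<^sup>2" and bS: "b \<in> ?S" "g b = b\<^sup>2"
    using a b l1 l2 by (simp_all add: gF)
  note two = perturbed_square_zeros[OF conv g'd g''d bound aS bS ab]
  show "l = l1 \<or> l = l2" if l: "l \<in> Dset (int n) t \<rho>" "char_det q t l = 0" for l
  proof -
    obtain e where e: "norm e < 1/4" "l = (c + e)\<^sup>2"
      using Dset_square[OF n0 t \<rho> l(1)] by (metis c_def)
    have "e = a \<or> e = b" by (rule two(2)) (use e l in \<open>simp_all add: gF\<close>)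
    then show ?thesis using a b e by auto
  qed
  \<comment> \<open>The order of the zero is taken in lam, not in its root. On this neighbourhood of
    \<open>l1\<close> the principal root is holomorphic and admissible, which makes the determinant
    holomorphic in lam.\<close>
  define U where "U = {l. Re l > 0} \<inter> csqrt -` {z. adm z}"
  have csq: "csqrt holomorphic_on {l. Re l > 0}"
    unfolding holomorphic_on_def
    by (auto simp: complex_nonpos_Reals_iff intro!: field_differentiable_within_csqrt)
  have oU: "open U" unfolding U_def
    by (rule continuous_open_preimage[OF holomorphic_on_imp_continuous_on[OF csq] _ adm_open])
      (rule open_halfspace_Re_gt)
  have hF: "char_det q t holomorphic_on U"
  proof -
    have "((\<lambda>z. hill_F q (z\<^sup>2)) \<circ> csqrt) holomorphic_on U"
      by (rule holomorphic_on_compose_gen[OF holomorphic_on_subset[OF csq] hill_F_square_holomorphic])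
        (auto simp: U_def)
    then have "hill_F q holomorphic_on U" by (simp add: o_def)
    then show ?thesis unfolding char_det_def[abs_def] by (intro holomorphic_intros)
  qed
  have a1: "norm a < 1" using a by simp
  have Re1: "Re (c + a) > 1" using adm_shift(3)[OF n a1] by (simp add: c_def)
  have Im1: "\<bar>Im (c + a)\<bar> < 1" using adm[OF a1] by (simp add: admissible_def)
  have lU: "l1 \<in> U"
  proof -
    have "csqrt l1 = c + a" unfolding a(2) by (rule csqrt_square) (use Re1 in simp)
    moreover have "Re l1 > 0"
    proof -
      have "(Im (c + a))\<^sup>2 < (Re (c + a))\<^sup>2"
        using Im1 Re1 by (metis abs_le_square_iff abs_of_pos less_trans not_le zero_less_one order_less_imp_le)
      then show ?thesis unfolding a(2) by (simp add: power2_eq_square)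
    qed
    ultimately show ?thesis using adm[OF a1] by (simp add: U_def)
  qed
  have dF: "(char_det q t has_field_derivative deriv (char_det q t) l1) (at l1)"
    by (rule holomorphic_derivI[OF hF oU lU])
  have "((\<lambda>\<zeta>. (c + \<zeta>)\<^sup>2) has_field_derivative 2 * (c + a)) (at a)"
    by (auto intro!: derivative_eq_intros)
  from DERIV_chain2[OF dF[unfolded a(2)] this]
  have d1: "((\<lambda>\<zeta>. char_det q t ((c + \<zeta>)\<^sup>2)) has_field_derivative deriv (char_det q t) l1 * (2 * (c + a))) (at a)"
    by (simp add: a(2))
  have "((\<lambda>\<zeta>. g \<zeta> - \<zeta>\<^sup>2) has_field_derivative g' a - 2 * a) (at a)"
    using g'd[OF aS(1)] by (auto intro!: derivative_eq_intros)
  then have d2: "((\<lambda>\<zeta>. char_det q t ((c + \<zeta>)\<^sup>2)) has_field_derivative g' a - 2 * a) (at a)"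
    by (simp add: gF)
  \<comment> \<open>Chain rule for lam = (c + \<zeta>)^2. The right side is nonzero because
    \<open>a\<close> is not a double solution of g \<zeta> = \<zeta>^2, so the zero in lam is
    simple.\<close>
  have "deriv (char_det q t) l1 * (2 * (c + a)) = g' a - 2 * a" by (rule DERIV_unique[OF d1 d2])
  then have dnz: "deriv (char_det q t) l1 \<noteq> 0" using two(1) by auto
  show "zorder (char_det q t) l1 = 1"
    using zorder_zero_eqI[OF hF oU lU, of 1] dnz l1(2) by simp
qed

end

section \<open>Sums over paths\<close>

lemma infsum_dominated:
  fixes f :: "'a \<Rightarrow> complex" and D :: "'a \<Rightarrow> real"
  assumes D: "D summable_on J" and le: "\<And>m. m \<in> J \<Longrightarrow> norm (f m) \<le> B * D m"
  shows "(\<lambda>m. norm (f m)) summable_on J" "f summable_on J" "norm (infsum f J) \<le> B * infsum D J"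
proof -
  have BD: "(\<lambda>m. B * D m) summable_on J" by (rule summable_on_cmult_right[OF D])
  show 1: "(\<lambda>m. norm (f m)) summable_on J"
    by (rule Infinite_Sum.abs_summable_on_comparison_test'[OF BD le])
  show 2: "f summable_on J" by (rule abs_summable_summable[OF 1])
  have "((\<lambda>m. B * D m) has_sum B * infsum D J) J"
    by (rule has_sum_cmult_right[OF has_sum_infsum[OF D]])
  from norm_infsum_le[OF has_sum_infsum[OF 2] this le] show "norm (infsum f J) \<le> B * infsum D J" .
qed

lemma has_sum_minus:
  fixes f g :: "'a \<Rightarrow> complex"
  assumes "(f has_sum a) A" "(g has_sum b) A"
  shows "((\<lambda>x. f x - g x) has_sum a - b) A"
proof -
  have "((\<lambda>x. - g x) has_sum - b) A" using assms(2) by (simp add: has_sum_uminus)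
  from has_sum_add[OF assms(1) this] show ?thesis by simp
qed

lemma has_sum_sum_lessThan:
  fixes f :: "nat \<Rightarrow> 'a \<Rightarrow> complex"
  assumes "\<And>k. (f k has_sum a k) A"
  shows "((\<lambda>x. \<Sum>k<n. f k x) has_sum (\<Sum>k<n. a k)) A"
proof (induction n)
  case 0
  show ?case by (simp add: has_sum_0)
next
  case (Suc n)
  show ?case using has_sum_add[OF Suc.IH assms[of n]] by simp
qed

lemma infsum_norm_dominated:
  fixes f :: "'a \<Rightarrow> complex" and D :: "'a \<Rightarrow> real"
  assumes D: "D summable_on J" and le: "\<And>m. m \<in> J \<Longrightarrow> norm (f m) \<le> B * D m"
  shows "infsum (\<lambda>m. norm (f m)) J \<le> B * infsum D J"
proof -
  have "((\<lambda>m. B * D m) has_sum B * infsum D J) J"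
    by (rule has_sum_cmult_right[OF has_sum_infsum[OF D]])
  moreover have "((\<lambda>m. norm (f m)) has_sum infsum (\<lambda>m. norm (f m)) J) J"
    by (rule has_sum_infsum[OF infsum_dominated(1)[OF D le]])
  ultimately show ?thesis using has_sum_mono le by blast
qed

lemma suminf_le_geometric:
  fixes f :: "nat \<Rightarrow> complex"
  assumes r: "0 \<le> r" "r \<le> 1 / 2" and le: "\<And>k. norm (f k) \<le> C * r ^ k"
  shows "summable f" "norm (suminf f) \<le> 2 * C"
proof -
  have g: "(\<lambda>k. C * r ^ k) sums (C * (1 / (1 - r)))"
    by (intro sums_mult geometric_sums) (use r in simp)
  have n: "summable (\<lambda>k. norm (f k))"
    by (rule summable_comparison_test'[OF sums_summable[OF g], of 0]) (use le in simp)
  show "summable f" by (rule summable_norm_cancel[OF n])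
  have C: "C \<ge> 0" using le[of 0] norm_ge_zero[of "f 0"] by (simp del: norm_ge_zero)
  have "norm (suminf f) \<le> (\<Sum>k. norm (f k))" by (rule summable_norm[OF n])
  also have "\<dots> \<le> (\<Sum>k. C * r ^ k)" by (rule suminf_le[OF le n sums_summable[OF g]])
  also have "\<dots> = C * (1 / (1 - r))" using g by (rule sums_unique[symmetric])
  also have "\<dots> \<le> C * 2" using C r by (intro mult_left_mono) (auto simp: divide_le_eq)
  finally show "norm (suminf f) \<le> 2 * C" by simp
qed

lemma abs_int_add_power_le:
  fixes a b :: int
  shows "\<bar>real_of_int (a + b)\<bar> ^ s \<le> 2 ^ s * (\<bar>real_of_int a\<bar> ^ s + \<bar>real_of_int b\<bar> ^ s)"
proof -
  define M where "M = max \<bar>real_of_int a\<bar> \<bar>real_of_int b\<bar>"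
  have M: "M \<ge> 0" by (simp add: M_def)
  have "\<bar>real_of_int (a + b)\<bar> ^ s \<le> (2 * M) ^ s" by (rule power_mono) (auto simp: M_def)
  also have "\<dots> = 2 ^ s * M ^ s" by (rule power_mult_distrib)
  also have "M ^ s \<le> \<bar>real_of_int a\<bar> ^ s + \<bar>real_of_int b\<bar> ^ s"
    unfolding M_def by (cases "\<bar>real_of_int a\<bar> \<le> \<bar>real_of_int b\<bar>") (simp_all add: max_def)
  finally show ?thesis by simp
qed

text \<open>\<open>J\<close> holds the modes to be eliminated, \<open>qh\<close> the matrix entries,
  which depend on the difference of two modes only, and \<open>D\<close> a summable majorant of the
  reciprocal gaps. Each step of a path then costs a factor K S, with S the sum of
  \<open>D\<close>.\<close>

locale path_sums =
  fixes qh :: "int \<Rightarrow> complex" and J :: "int set" and D :: "int \<Rightarrow> real" and K :: real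
  assumes qh_le: "\<And>j. norm (qh j) \<le> K"
    and D_nonneg: "\<And>m. m \<in> J \<Longrightarrow> D m \<ge> 0"
    and D_summable: "D summable_on J"
begin

definition "S = infsum D J"

lemma K_nonneg: "K \<ge> 0" using qh_le[of 0] norm_ge_zero[of "qh 0"] by (simp del: norm_ge_zero)

lemma S_nonneg: "S \<ge> 0" unfolding S_def by (rule infsum_nonneg[OF D_nonneg])

definition "dominated d \<longleftrightarrow> (\<forall>m\<in>J. norm (d m :: complex) \<le> D m)"

text \<open>The sum over all paths from m to \<open>\<tau>\<close> with k intermediate modes in
  \<open>J\<close>, that is of q(m - m_1) d(m_1) q(m_1 - m_2) ... d(m_k) q(m_k - \<tau>). The two
  ends may lie outside \<open>J\<close>.\<close>

fun col_iter :: "(int \<Rightarrow> complex) \<Rightarrow> int \<Rightarrow> nat \<Rightarrow> int \<Rightarrow> complex" where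
  "col_iter d \<tau> 0 m = qh (m - \<tau>)"
| "col_iter d \<tau> (Suc k) m = (\<Sum>\<^sub>\<infinity>m'\<in>J. qh (m - m') * d m' * col_iter d \<tau> k m')"

lemma step_bound:
  assumes d: "dominated d" and c: "\<And>m. m \<in> J \<Longrightarrow> norm (c m) \<le> C"
  shows "m \<in> J \<Longrightarrow> norm (qh j * d m * c m) \<le> (K * C) * D m"
proof -
  assume m: "m \<in> J"
  have C: "C \<ge> 0" using c[OF m] norm_ge_zero[of "c m"] by (simp del: norm_ge_zero)
  have "norm (qh j) * norm (d m) * norm (c m) \<le> K * D m * C"
    using d m by (intro mult_mono qh_le c mult_nonneg_nonneg D_nonneg K_nonneg) (auto simp: dominated_def)
  then show ?thesis by (simp add: norm_mult mult_ac)
qed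

lemma col_iter_bound:
  assumes d: "dominated d" shows "norm (col_iter d \<tau> k m) \<le> K * (K * S) ^ k"
proof (induction k arbitrary: m)
  case 0 then show ?case by (simp add: qh_le)
next
  case (Suc k)
  have "norm (col_iter d \<tau> (Suc k) m) \<le> (K * (K * (K * S) ^ k)) * S"
    unfolding col_iter.simps S_def
    by (rule infsum_dominated(3)[OF D_summable step_bound[OF d]]) (rule Suc.IH[unfolded S_def])
  then show ?case by (simp add: mult_ac)
qed

lemma col_iter_summable:
  assumes d: "dominated d" shows "(\<lambda>m'. qh (m - m') * d m' * col_iter d \<tau> k m') summable_on J"
  by (rule infsum_dominated(2)[OF D_summable step_bound[OF d col_iter_bound[OF d]]])

text \<open>Since |a + b|^s <= 2^s (|a|^s + |b|^s), the weight can be spread over a path, one step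
  at a time. Each step then costs 2^(s+1) K S instead of K S, and decay of order s passes from
  \<open>qh\<close> to the iterates.\<close>

lemma col_iter_weighted_bound:
  assumes d: "dominated d" and w: "\<And>j. norm (qh j) * \<bar>real_of_int j\<bar> ^ s \<le> K"
  shows "norm (col_iter d \<tau> k m) * \<bar>real_of_int (m - \<tau>)\<bar> ^ s \<le> K * (2 ^ Suc s * K * S) ^ k"
proof (induction k arbitrary: m)
  case 0 then show ?case using w[of "m - \<tau>"] by simp
next
  case (Suc k)
  define L where "L = 2 ^ Suc s * K * S"
  have L: "K * S \<le> L" "L \<ge> 0"
  proof -
    have "(1::real) \<le> 2 ^ Suc s" by (rule one_le_power) simp
    then show "K * S \<le> L" unfolding L_def using K_nonneg S_nonneg
      by (metis mult.assoc mult_le_cancel_right1 mult_nonneg_nonneg not_le)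
    then show "L \<ge> 0" using K_nonneg S_nonneg by (meson mult_nonneg_nonneg order_trans)
  qed
  have kb: "norm (col_iter d \<tau> k m') \<le> K * L ^ k" for m'
  proof -
    have "(K * S) ^ k \<le> L ^ k" using L K_nonneg S_nonneg by (intro power_mono) auto
    then show ?thesis using col_iter_bound[OF d, of \<tau> k m'] K_nonneg by (meson mult_left_mono order_trans)
  qed
  define W where "W = complex_of_real (\<bar>real_of_int (m - \<tau>)\<bar> ^ s)"
  have "col_iter d \<tau> (Suc k) m * W = (\<Sum>\<^sub>\<infinity>m'\<in>J. qh (m - m') * d m' * col_iter d \<tau> k m' * W)"
    by (simp add: infsum_cmult_left')
  also have "norm \<dots> \<le> (2 ^ s * (2 * K * (K * L ^ k))) * S"
    unfolding S_def
  proof (rule infsum_dominated(3)[OF D_summable])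
    fix m' assume m': "m' \<in> J"
    have nW: "norm W \<le> 2 ^ s * (\<bar>real_of_int (m - m')\<bar> ^ s + \<bar>real_of_int (m' - \<tau>)\<bar> ^ s)"
      using abs_int_add_power_le[of "m - m'" "m' - \<tau>" s] by (simp add: W_def norm_power)
    have 1: "(norm (qh (m - m')) * \<bar>real_of_int (m - m')\<bar> ^ s) * norm (col_iter d \<tau> k m') \<le> K * (K * L ^ k)"
      by (intro mult_mono w kb K_nonneg norm_ge_zero)
    have 2: "norm (qh (m - m')) * (norm (col_iter d \<tau> k m') * \<bar>real_of_int (m' - \<tau>)\<bar> ^ s) \<le> K * (K * L ^ k)"
      using Suc.IH[of m', folded L_def] by (rule mult_mono[OF qh_le _ K_nonneg]) simp
    have dm: "norm (d m') \<le> D m'" using d m' by (simp add: dominated_def)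
    have "norm (qh (m - m') * d m' * col_iter d \<tau> k m' * W)
       = norm (d m') * (norm (qh (m - m')) * norm (col_iter d \<tau> k m') * norm W)"
      by (simp add: norm_mult mult_ac)
    also have "\<dots> \<le> D m' * (norm (qh (m - m')) * norm (col_iter d \<tau> k m') *
        (2 ^ s * (\<bar>real_of_int (m - m')\<bar> ^ s + \<bar>real_of_int (m' - \<tau>)\<bar> ^ s)))"
      by (intro mult_mono dm mult_left_mono nW mult_nonneg_nonneg norm_ge_zero D_nonneg m' order_refl)
    also have "\<dots> = D m' * (2 ^ s * ((norm (qh (m - m')) * \<bar>real_of_int (m - m')\<bar> ^ s) * norm (col_iter d \<tau> k m')
         + norm (qh (m - m')) * (norm (col_iter d \<tau> k m') * \<bar>real_of_int (m' - \<tau>)\<bar> ^ s)))"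
      by (simp add: algebra_simps)
    also have "\<dots> \<le> D m' * (2 ^ s * (K * (K * L ^ k) + K * (K * L ^ k)))"
      by (intro mult_left_mono add_mono 1 2 D_nonneg m') simp
    also have "\<dots> = (2 ^ s * (2 * K * (K * L ^ k))) * D m'" by (simp add: algebra_simps)
    finally show "norm (qh (m - m') * d m' * col_iter d \<tau> k m' * W) \<le> (2 ^ s * (2 * K * (K * L ^ k))) * D m'" .
  qed
  also have "\<dots> = K * L ^ Suc k" by (simp add: L_def algebra_simps)
  finally show ?case by (simp add: W_def L_def norm_mult norm_power)
qed

text \<open>The k factors \<open>d\<close> on a path are changed one after the other, each at the
  price \<open>\<eta>\<close>; hence the factor k.\<close>

lemma col_iter_perturb:
  assumes d: "dominated d" "dominated d'" and e: "\<And>m. m \<in> J \<Longrightarrow> norm (d m - d' m) \<le> \<eta> * D m" and \<eta>: "\<eta> \<ge> 0"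
  shows "norm (col_iter d \<tau> k m - col_iter d' \<tau> k m) \<le> real k * \<eta> * K * (K * S) ^ k"
proof (induction k arbitrary: m)
  case 0 then show ?case by simp
next
  case (Suc k)
  have "col_iter d \<tau> (Suc k) m - col_iter d' \<tau> (Suc k) m =
     (\<Sum>\<^sub>\<infinity>m'\<in>J. qh (m - m') * d m' * col_iter d \<tau> k m' - qh (m - m') * d' m' * col_iter d' \<tau> k m')"
  proof -
    have "((\<lambda>m'. qh (m - m') * d m' * col_iter d \<tau> k m' - qh (m - m') * d' m' * col_iter d' \<tau> k m')
        has_sum col_iter d \<tau> (Suc k) m - col_iter d' \<tau> (Suc k) m) J"
      unfolding col_iter.simps by (intro has_sum_minus has_sum_infsum col_iter_summable d)
    from infsumI[OF this] show ?thesis by (rule sym)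
  qed
  also have "norm \<dots> \<le> (K * (\<eta> * (K * (K * S) ^ k) + real k * \<eta> * K * (K * S) ^ k)) * S"
    unfolding S_def
  proof (rule infsum_dominated(3)[OF D_summable])
    fix m' assume m': "m' \<in> J"
    have D0: "D m' \<ge> 0" by (rule D_nonneg[OF m'])
    have "norm (qh (m - m') * d m' * col_iter d \<tau> k m' - qh (m - m') * d' m' * col_iter d' \<tau> k m')
      = norm (qh (m - m') * ((d m' - d' m') * col_iter d \<tau> k m' + d' m' * (col_iter d \<tau> k m' - col_iter d' \<tau> k m')))"
      by (simp add: algebra_simps)
    also have "\<dots> \<le> norm (qh (m - m')) * (norm (d m' - d' m') * norm (col_iter d \<tau> k m') + norm (d' m') * norm (col_iter d \<tau> k m' - col_iter d' \<tau> k m'))"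
      unfolding norm_mult by (rule mult_left_mono[OF order_trans[OF norm_triangle_ineq]]) (simp_all add: norm_mult)
    also have "\<dots> \<le> K * ((\<eta> * D m') * (K * (K * S) ^ k) + D m' * (real k * \<eta> * K * (K * S) ^ k))"
      using d m' D0 \<eta> K_nonneg S_nonneg
      by (intro mult_mono add_mono qh_le e col_iter_bound Suc.IH) (auto simp: dominated_def)
    also have "\<dots> = (K * (\<eta> * (K * (K * S) ^ k) + real k * \<eta> * K * (K * S) ^ k)) * D m'"
      by (simp add: algebra_simps)
    finally show "norm (qh (m - m') * d m' * col_iter d \<tau> k m' - qh (m - m') * d' m' * col_iter d' \<tau> k m')
       \<le> (K * (\<eta> * (K * (K * infsum D J) ^ k) + real k * \<eta> * K * (K * infsum D J) ^ k)) * D m'"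
      by (simp add: S_def)
  qed
  also have "\<dots> = real (Suc k) * \<eta> * K * (K * S) ^ Suc k" by (simp add: algebra_simps)
  finally show ?case .
qed

text \<open>The term without intermediate mode is left out: between the ends n and -n it is q_0 = 0
  or one of q_2n and q_-2n, which the formulas keep apart from B and B'.\<close>

definition "tail d \<tau> m = (\<Sum>k. col_iter d \<tau> (Suc k) m)"

context
  assumes small: "K * S \<le> 1 / 4"
begin

lemma KS: "0 \<le> K * S" "K * S \<le> 1 / 2"
  using small K_nonneg S_nonneg by auto

lemma col_iter_sums:
  assumes d: "dominated d" shows "summable (\<lambda>k. col_iter d \<tau> (Suc k) m)" "norm (tail d \<tau> m) \<le> 2 * K * (K * S)"
proof -
  have "norm (col_iter d \<tau> (Suc k) m) \<le> (K * (K * S)) * (K * S) ^ k" for k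
    using col_iter_bound[OF d, of \<tau> "Suc k" m] by (simp add: mult_ac)
  from suminf_le_geometric[OF KS this]
  show "summable (\<lambda>k. col_iter d \<tau> (Suc k) m)" "norm (tail d \<tau> m) \<le> 2 * K * (K * S)"
    by (simp_all add: tail_def)
qed

text \<open>The factor Suc k of \<open>col_iter_perturb\<close> is absorbed by Suc k <= 2^k. The
  ratio becomes 2 K S <= 1/2, which is why \<open>small\<close> asks for 1/4.\<close>

lemma tail_perturb:
  assumes d: "dominated d" "dominated d'" and e: "\<And>m. m \<in> J \<Longrightarrow> norm (d m - d' m) \<le> \<eta> * D m" and \<eta>: "\<eta> \<ge> 0"
  shows "norm (tail d \<tau> m - tail d' \<tau> m) \<le> 2 * (\<eta> * K * (K * S))"
proof -
  have "norm (col_iter d \<tau> (Suc k) m - col_iter d' \<tau> (Suc k) m) \<le> (\<eta> * K * (K * S)) * (2 * (K * S)) ^ k" for k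
  proof -
    have k2: "real (Suc k) \<le> 2 ^ k"
      using less_exp[of k] by (metis Suc_leI of_nat_le_iff of_nat_numeral of_nat_power)
    have "norm (col_iter d \<tau> (Suc k) m - col_iter d' \<tau> (Suc k) m) \<le> real (Suc k) * \<eta> * K * (K * S) ^ Suc k"
      by (rule col_iter_perturb[OF d e \<eta>])
    also have "\<dots> = real (Suc k) * (\<eta> * K * (K * S) * (K * S) ^ k)" by simp
    also have "\<dots> \<le> 2 ^ k * (\<eta> * K * (K * S) * (K * S) ^ k)"
      using k2 \<eta> K_nonneg S_nonneg by (intro mult_right_mono) auto
    finally show ?thesis by (simp add: power_mult_distrib mult_ac)
  qed
  from suminf_le_geometric(2)[OF _ _ this]
  have "norm (\<Sum>k. col_iter d \<tau> (Suc k) m - col_iter d' \<tau> (Suc k) m) \<le> 2 * (\<eta> * K * (K * S))"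
    using small KS by simp
  then show ?thesis
    unfolding tail_def using suminf_diff[OF col_iter_sums(1)[OF d(1)] col_iter_sums(1)[OF d(2)]] by simp
qed

text \<open>Without its first term the series starts with the square of 2^(s+1) K S. As S will be
  O(n^(-3/4)), this is o(1/n) and, after division by the weight, o(n^(-s-1)). The first term is not
  small enough for this and is estimated on its own.\<close>

lemma tail_weighted_bound:
  assumes d: "dominated d" and w: "\<And>j. norm (qh j) * \<bar>real_of_int j\<bar> ^ s \<le> K"
    and L: "2 ^ Suc s * K * S \<le> 1 / 2"
  shows "norm (tail d \<tau> m - col_iter d \<tau> 1 m) * \<bar>real_of_int (m - \<tau>)\<bar> ^ s \<le> 2 * K * (2 ^ Suc s * K * S)\<^sup>2"
proof -
  define W where "W = complex_of_real (\<bar>real_of_int (m - \<tau>)\<bar> ^ s)"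
  have s: "summable (\<lambda>k. col_iter d \<tau> (Suc k) m)" by (rule col_iter_sums(1)[OF d])
  have s2: "summable (\<lambda>k. col_iter d \<tau> (Suc (Suc k)) m)" using s by (subst summable_Suc_iff)
  have "tail d \<tau> m = (\<Sum>k. col_iter d \<tau> (Suc (Suc k)) m) + col_iter d \<tau> (Suc 0) m"
    unfolding tail_def using suminf_split_head[OF s] by (simp del: col_iter.simps)
  then have "(tail d \<tau> m - col_iter d \<tau> 1 m) * W = (\<Sum>k. col_iter d \<tau> (Suc (Suc k)) m) * W"
    by (simp del: col_iter.simps)
  also have "\<dots> = (\<Sum>k. col_iter d \<tau> (Suc (Suc k)) m * W)" by (rule suminf_mult2[OF s2])
  also have "norm \<dots> \<le> 2 * (K * (2 ^ Suc s * K * S)\<^sup>2)"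
  proof (rule suminf_le_geometric(2)[OF _ L])
    show "0 \<le> 2 ^ Suc s * K * S" using K_nonneg S_nonneg by simp
    show "norm (col_iter d \<tau> (Suc (Suc k)) m * W) \<le> K * (2 ^ Suc s * K * S)\<^sup>2 * (2 ^ Suc s * K * S) ^ k" for k
      using col_iter_weighted_bound[OF d w, of \<tau> "Suc (Suc k)" m]
      by (simp add: W_def norm_mult norm_power power2_eq_square mult_ac del: col_iter.simps)
  qed
  finally show ?thesis by (simp add: W_def norm_mult norm_power del: col_iter.simps)
qed

text \<open>The whole Neumann series, now with the direct step. It is the forcing that a unit
  amplitude at the mode \<open>\<tau>\<close> exerts on the mode \<open>m\<close> once the modes in
  \<open>J\<close> have been eliminated.\<close>

definition "G d \<tau> m = qh (m - \<tau>) + tail d \<tau> m"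

lemma G_bound:
  assumes d: "dominated d" shows "norm (G d \<tau> m) \<le> 2 * K"
proof -
  have "norm (G d \<tau> m) \<le> K + 2 * K * (K * S)"
    unfolding G_def by (rule order_trans[OF norm_triangle_ineq add_mono[OF qh_le col_iter_sums(2)[OF d]]])
  also have "2 * K * (K * S) \<le> 2 * K * (1 / 2)" by (rule mult_left_mono) (use KS K_nonneg in auto)
  finally show ?thesis by simp
qed

text \<open>The partial sums satisfy the equation with a shift by one step. Their remainder is
  geometric and uniform in m, so the limit may be taken under the infinite sum.\<close>

lemma G_equation:
  assumes d: "dominated d"
  shows "G d \<tau> m = qh (m - \<tau>) + (\<Sum>\<^sub>\<infinity>m'\<in>J. qh (m - m') * d m' * G d \<tau> m')"
proof -
  define P where "P n m = (\<Sum>k<n. col_iter d \<tau> k m)" for n m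
  have s: "summable (\<lambda>k. col_iter d \<tau> k m)" for m
    using col_iter_sums(1)[OF d, of \<tau> m] by (subst (asm) summable_Suc_iff)
  have G: "G d \<tau> m = (\<Sum>k. col_iter d \<tau> k m)" for m
    unfolding G_def tail_def using suminf_split_head[OF s[of m]] by simp
  have rem: "norm (G d \<tau> m - P n m) \<le> 2 * (K * (K * S) ^ n)" for n m
  proof -
    have "G d \<tau> m - P n m = (\<Sum>k. col_iter d \<tau> (k + n) m)"
      unfolding G P_def using suminf_split_initial_segment[OF s[of m], of n] by simp
    also have "norm \<dots> \<le> 2 * (K * (K * S) ^ n)"
    proof (rule suminf_le_geometric(2)[OF KS])
      show "norm (col_iter d \<tau> (k + n) m) \<le> K * (K * S) ^ n * (K * S) ^ k" for k
        using col_iter_bound[OF d, of \<tau> "k + n" m] by (simp add: power_add mult_ac)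
    qed
    finally show ?thesis .
  qed
  have PS: "P (Suc n) m = qh (m - \<tau>) + (\<Sum>\<^sub>\<infinity>m'\<in>J. qh (m - m') * d m' * P n m')" for n
  proof -
    have "P (Suc n) m = qh (m - \<tau>) + (\<Sum>k<n. col_iter d \<tau> (Suc k) m)"
      unfolding P_def by (subst sum.lessThan_Suc_shift) simp
    moreover have "((\<lambda>m'. \<Sum>k<n. qh (m - m') * d m' * col_iter d \<tau> k m') has_sum (\<Sum>k<n. col_iter d \<tau> (Suc k) m)) J"
      unfolding col_iter.simps by (intro has_sum_sum_lessThan has_sum_infsum col_iter_summable d)
    then have "(\<Sum>k<n. col_iter d \<tau> (Suc k) m) = (\<Sum>\<^sub>\<infinity>m'\<in>J. qh (m - m') * d m' * P n m')"
      by (simp only: P_def sum_distrib_left infsumI)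
    ultimately show ?thesis by simp
  qed
  define R where "R = (\<Sum>\<^sub>\<infinity>m'\<in>J. qh (m - m') * d m' * G d \<tau> m')"
  have Gs: "(\<lambda>m'. qh (m - m') * d m' * G d \<tau> m') summable_on J"
    by (rule infsum_dominated(2)[OF D_summable step_bound[OF d G_bound[OF d]]])
  have diff: "norm (R - (\<Sum>\<^sub>\<infinity>m'\<in>J. qh (m - m') * d m' * P n m')) \<le> (2 * K * (K * S)) * (K * S) ^ n" for n
  proof -
    have Ps: "(\<lambda>m'. qh (m - m') * d m' * P n m') summable_on J"
      unfolding P_def sum_distrib_left
      by (rule has_sum_imp_summable[OF has_sum_sum_lessThan[OF has_sum_infsum[OF col_iter_summable[OF d]]]])
    have "((\<lambda>m'. qh (m - m') * d m' * G d \<tau> m' - qh (m - m') * d m' * P n m') has_sum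
        R - (\<Sum>\<^sub>\<infinity>m'\<in>J. qh (m - m') * d m' * P n m')) J"
      unfolding R_def by (intro has_sum_minus has_sum_infsum Gs Ps)
    then have "R - (\<Sum>\<^sub>\<infinity>m'\<in>J. qh (m - m') * d m' * P n m')
       = (\<Sum>\<^sub>\<infinity>m'\<in>J. qh (m - m') * d m' * (G d \<tau> m' - P n m'))"
      by (simp add: infsumI right_diff_distrib)
    also have "norm \<dots> \<le> (K * (2 * (K * (K * S) ^ n))) * S"
      unfolding S_def by (rule infsum_dominated(3)[OF D_summable step_bound[OF d rem[unfolded S_def]]])
    finally show ?thesis by (simp add: mult_ac)
  qed
  have "(\<lambda>n. (2 * K * (K * S)) * (K * S) ^ n) \<longlonglongrightarrow> (2 * K * (K * S)) * 0"
    by (intro tendsto_intros LIMSEQ_realpow_zero) (use KS in auto)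
  then have z: "(\<lambda>n. (2 * K * (K * S)) * (K * S) ^ n) \<longlonglongrightarrow> 0" by simp
  have "(\<lambda>n. R - (\<Sum>\<^sub>\<infinity>m'\<in>J. qh (m - m') * d m' * P n m')) \<longlonglongrightarrow> 0"
    by (rule Lim_null_comparison[OF _ z]) (use diff in \<open>intro always_eventually allI\<close>)
  then have "(\<lambda>n. qh (m - \<tau>) + R - (R - (\<Sum>\<^sub>\<infinity>m'\<in>J. qh (m - m') * d m' * P n m'))) \<longlonglongrightarrow> qh (m - \<tau>) + R - 0"
    by (intro tendsto_intros)
  then have 1: "(\<lambda>n. P (Suc n) m) \<longlonglongrightarrow> qh (m - \<tau>) + R" by (simp add: PS)
  have "(\<lambda>n. P n m) \<longlonglongrightarrow> G d \<tau> m"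
    unfolding P_def G by (rule summable_LIMSEQ[OF s])
  then have 2: "(\<lambda>n. P (Suc n) m) \<longlonglongrightarrow> G d \<tau> m" by (rule LIMSEQ_Suc)
  show ?thesis using LIMSEQ_unique[OF 2 1] by (simp add: R_def)
qed

end

section \<open>Reversal and reflection of paths\<close>

fun row_iter :: "(int \<Rightarrow> complex) \<Rightarrow> int \<Rightarrow> nat \<Rightarrow> int \<Rightarrow> complex" where
  "row_iter d \<tau> 0 m = qh (\<tau> - m)"
| "row_iter d \<tau> (Suc k) m = (\<Sum>\<^sub>\<infinity>m'\<in>J. row_iter d \<tau> k m' * d m' * qh (m' - m))"

lemma row_iter_bound:
  assumes d: "dominated d" shows "norm (row_iter d \<tau> k m) \<le> K * (K * S) ^ k"
proof (induction k arbitrary: m)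
  case 0 then show ?case by (simp add: qh_le)
next
  case (Suc k)
  have "norm (row_iter d \<tau> (Suc k) m) \<le> (K * (K * (K * S) ^ k)) * S"
    unfolding row_iter.simps S_def
  proof (rule infsum_dominated(3)[OF D_summable])
    fix m' assume "m' \<in> J"
    from step_bound[OF d Suc.IH this, of "m' - m"]
    show "norm (row_iter d \<tau> k m' * d m' * qh (m' - m)) \<le> K * (K * (K * infsum D J) ^ k) * D m'"
      by (simp add: mult_ac S_def)
  qed
  then show ?case by (simp add: mult_ac)
qed

text \<open>The row iteration \<open>row_iter\<close> and the column iteration \<open>col_iter\<close> sum the same paths, because the
  bilinear pairing below depends only on \<open>j + k\<close>.\<close>

lemma pairing_shift:
  assumes d: "dominated d"
  shows "(\<Sum>\<^sub>\<infinity>m\<in>J. row_iter d a (Suc j) m * d m * col_iter d b k m) = (\<Sum>\<^sub>\<infinity>m\<in>J. row_iter d a j m * d m * col_iter d b (Suc k) m)"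
proof -
  define f where "f m m' = row_iter d a j m' * d m' * qh (m' - m) * d m * col_iter d b k m" for m m'
  define C where "C = (K * (K * S) ^ j) * K * (K * (K * S) ^ k)"
  have C: "C \<ge> 0" unfolding C_def using K_nonneg S_nonneg by simp
  have fb: "norm (f m m') \<le> C * D m * D m'" if "m \<in> J" "m' \<in> J" for m m'
  proof -
    have "norm (f m m') = norm (row_iter d a j m') * norm (d m') * norm (qh (m' - m)) * norm (d m) * norm (col_iter d b k m)"
      by (simp add: f_def norm_mult)
    also have "\<dots> \<le> (K * (K * S) ^ j) * D m' * K * D m * (K * (K * S) ^ k)"
      using d that K_nonneg S_nonneg D_nonneg
      by (intro mult_mono row_iter_bound col_iter_bound qh_le) (auto simp: dominated_def)
    finally show ?thesis by (simp add: C_def mult_ac)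
  qed
  \<comment> \<open>The product majorant C D(m) D(m') makes the double family absolutely summable,
    so that the order of summation may be exchanged.\<close>
  have abs: "(\<lambda>p. norm (case p of (m, m') \<Rightarrow> f m m')) summable_on (J \<times> J)"
    unfolding Infinite_Sum.abs_summable_on_Sigma_iff
  proof (intro conjI ballI)
    show "(\<lambda>m'. norm (case (m, m') of (m, m') \<Rightarrow> f m m')) summable_on J" if "m \<in> J" for m
      using infsum_dominated(1)[OF D_summable fb[OF that]] by simp
    have 1: "infsum (\<lambda>m'. norm (f m m')) J \<le> (C * S) * D m" if "m \<in> J" for m
      using infsum_norm_dominated[OF D_summable fb[OF that]] by (simp add: S_def mult_ac)
    have 2: "infsum (\<lambda>m'. norm (f m m')) J \<ge> 0" for m by (rule infsum_nonneg) simp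
    have "(\<lambda>m. (C * S) * D m) summable_on J" by (rule summable_on_cmult_right[OF D_summable])
    then show "(\<lambda>m. norm (infsum (\<lambda>m'. norm (case (m, m') of (m, m') \<Rightarrow> f m m')) J)) summable_on J"
      by (rule Infinite_Sum.abs_summable_on_comparison_test') (use 1 2 in simp)
  qed
  have "(\<Sum>\<^sub>\<infinity>m\<in>J. row_iter d a (Suc j) m * d m * col_iter d b k m) = (\<Sum>\<^sub>\<infinity>m\<in>J. \<Sum>\<^sub>\<infinity>m'\<in>J. f m m')"
    by (simp add: f_def infsum_cmult_left')
  also have "\<dots> = (\<Sum>\<^sub>\<infinity>m'\<in>J. \<Sum>\<^sub>\<infinity>m\<in>J. f m m')"
    by (rule infsum_swap_banach[OF abs_summable_summable[OF abs]])
  also have "\<dots> = (\<Sum>\<^sub>\<infinity>m\<in>J. row_iter d a j m * d m * col_iter d b (Suc k) m)"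
    by (simp add: f_def infsum_cmult_right' mult.assoc)
  finally show ?thesis .
qed

lemma col_iter_eq_row_iter:
  assumes d: "dominated d" shows "col_iter d b k a = row_iter d a k b"
proof (cases k)
  case 0 then show ?thesis by simp
next
  case (Suc k')
  have "(\<Sum>\<^sub>\<infinity>m\<in>J. row_iter d a j m * d m * col_iter d b i m) = (\<Sum>\<^sub>\<infinity>m\<in>J. row_iter d a 0 m * d m * col_iter d b (i + j) m)" for i j
  proof (induction j arbitrary: i)
    case (Suc j)
    then show ?case using pairing_shift[OF d, of a j b i] Suc.IH[of "Suc i"] by simp
  qed simp
  from this[of k' 0] show ?thesis using Suc by simp
qed

text \<open>When both modes change sign, the entry qh (m - m') becomes qh (m' - m), so a column
  iteration turns into a row iteration.\<close>

lemma col_iter_reflect: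
  assumes J: "\<And>m. m \<in> J \<longleftrightarrow> - m \<in> J"
  shows "col_iter (\<lambda>m. d (- m)) (- \<tau>) k (- m) = row_iter d \<tau> k m"
proof (induction k arbitrary: m)
  case 0 then show ?case by simp
next
  case (Suc k)
  have b: "bij_betw uminus J J"
    by (rule bij_betwI[where g = uminus]) (use J in auto)
  have "col_iter (\<lambda>m. d (- m)) (- \<tau>) (Suc k) (- m) = (\<Sum>\<^sub>\<infinity>m'\<in>J. qh (- m - m') * d (- m') * col_iter (\<lambda>m. d (- m)) (- \<tau>) k m')"
    by simp
  also have "\<dots> = (\<Sum>\<^sub>\<infinity>m'\<in>J. qh (- m - (- m')) * d (- (- m')) * col_iter (\<lambda>m. d (- m)) (- \<tau>) k (- m'))"
    by (rule infsum_reindex_bij_betw[OF b, symmetric])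
  also have "\<dots> = row_iter d \<tau> (Suc k) m" by (simp add: Suc.IH mult_ac)
  finally show ?case .
qed

text \<open>A closed path at n, reversed and negated, is a closed path at -n with the same steps.
  With \<open>gap_inverse_reflect\<close> this is the identity A'(lam, t) = A(lam, -t).\<close>

lemma col_iter_diagonal_reflect:
  assumes J: "\<And>m. m \<in> J \<longleftrightarrow> - m \<in> J" and d: "dominated d"
  shows "col_iter (\<lambda>m. d (- m)) (- n) k (- n) = col_iter d n k n"
  using col_iter_reflect[OF J] col_iter_eq_row_iter[OF d] by simp

section \<open>Iterations as explicit sums over lists of steps\<close>

definition paths :: "nat \<Rightarrow> int \<Rightarrow> int list set" where
  "paths k m = {ns. length ns = k \<and> (\<forall>r<k. m - sum_list (take (Suc r) ns) \<in> J)}"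

definition path_term :: "(int \<Rightarrow> complex) \<Rightarrow> int \<Rightarrow> nat \<Rightarrow> int \<Rightarrow> int list \<Rightarrow> complex" where
  "path_term d \<tau> k m ns = (\<Prod>r<k. qh (ns ! r)) * qh (m - sum_list ns - \<tau>) *
      (\<Prod>r<k. d (m - sum_list (take (Suc r) ns)))"

lemma paths_Suc: "bij_betw (\<lambda>(m', ns). (m - m') # ns) (Sigma J (paths k)) (paths (Suc k) m)"
proof (rule bij_betwI[where g = "\<lambda>ns. (m - hd ns, tl ns)"])
  show "(\<lambda>(m', ns). (m - m') # ns) \<in> Sigma J (paths k) \<rightarrow> paths (Suc k) m"
  proof (clarsimp simp: paths_def)
    fix m' ns r assume "m' \<in> J" and h: "\<forall>r<length ns. m' - sum_list (take (Suc r) ns) \<in> J"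
      and r: "r < Suc (length ns)"
    then show "m' - sum_list (take r ns) \<in> J" by (cases r) auto
  qed
  show "(\<lambda>ns. (m - hd ns, tl ns)) \<in> paths (Suc k) m \<rightarrow> Sigma J (paths k)"
  proof (rule funcsetI)
    fix ns assume ns: "ns \<in> paths (Suc k) m"
    then obtain x xs where x: "ns = x # xs" "length xs = k" unfolding paths_def by (cases ns) auto
    have h: "m - sum_list (take (Suc r) ns) \<in> J" if "r < Suc k" for r
      using ns that by (simp add: paths_def)
    have "m - x \<in> J" using h[of 0] x by simp
    moreover have "m - x - sum_list (take (Suc r) xs) \<in> J" if "r < k" for r
      using h[of "Suc r"] x that by (simp add: algebra_simps)
    ultimately show "(m - hd ns, tl ns) \<in> Sigma J (paths k)" using x by (simp add: paths_def)
  qed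
  show "(\<lambda>ns. (m - hd ns, tl ns)) ((\<lambda>(m', ns). (m - m') # ns) x) = x" if "x \<in> Sigma J (paths k)" for x
    by (simp add: split_beta)
  show "(\<lambda>(m', ns). (m - m') # ns) ((\<lambda>ns. (m - hd ns, tl ns)) y) = y" if "y \<in> paths (Suc k) m" for y
    using that by (cases y) (auto simp: paths_def)
qed

lemma path_term_Cons:
  "path_term d \<tau> (Suc k) m ((m - m') # ns) = qh (m - m') * d m' * path_term d \<tau> k m' ns"
proof -
  have e: "m - sum_list (take (Suc r) ((m - m') # ns)) = m' - sum_list (take r ns)" for r by simp
  have "(\<Prod>r<Suc k. d (m - sum_list (take (Suc r) ((m - m') # ns)))) = d m' * (\<Prod>r<k. d (m' - sum_list (take (Suc r) ns)))"
    unfolding e by (subst prod.lessThan_Suc_shift) simp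
  moreover have "(\<Prod>r<Suc k. qh (((m - m') # ns) ! r)) = qh (m - m') * (\<Prod>r<k. qh (ns ! r))"
    by (subst prod.lessThan_Suc_shift) simp
  ultimately show ?thesis by (simp add: path_term_def mult_ac)
qed

text \<open>Absolute summability and the bound go through the induction together with the value: a
  sum over a Sigma set is split into iterated sums by absolute summability, and the bound for k
  supplies the majorant for k + 1.\<close>

lemma path_sum:
  assumes d: "dominated d"
  shows "(\<lambda>ns. norm (path_term d \<tau> k m ns)) summable_on paths k m \<and>
    infsum (\<lambda>ns. norm (path_term d \<tau> k m ns)) (paths k m) \<le> K * (K * S) ^ k \<and>
    infsum (path_term d \<tau> k m) (paths k m) = col_iter d \<tau> k m"
proof (induction k arbitrary: m)
  case 0
  have "paths 0 m = {[]}" by (auto simp: paths_def)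
  then show ?case by (simp add: path_term_def qh_le)
next
  case (Suc k)
  define F where "F = (\<lambda>(m', ns). qh (m - m') * d m' * path_term d \<tau> k m' ns)"
  have F: "F p = path_term d \<tau> (Suc k) m ((\<lambda>(m', ns). (m - m') # ns) p)" for p
    by (simp add: F_def split_beta path_term_Cons)
  define N where "N m' = infsum (\<lambda>ns. norm (F (m', ns))) (paths k m')" for m'
  have sF: "(\<lambda>ns. norm (F (m', ns))) summable_on paths k m'" for m'
    unfolding F_def using Suc.IH[of m'] by (simp add: norm_mult summable_on_cmult_right)
  have Nle: "N m' \<le> (K * (K * (K * S) ^ k)) * D m'" if m': "m' \<in> J" for m'
  proof -
    have "N m' = norm (qh (m - m')) * norm (d m') * infsum (\<lambda>ns. norm (path_term d \<tau> k m' ns)) (paths k m')"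
      unfolding N_def F_def by (simp add: norm_mult infsum_cmult_right')
    also have "\<dots> \<le> K * D m' * (K * (K * S) ^ k)"
      using d m' Suc.IH[of m'] K_nonneg S_nonneg D_nonneg[OF m']
      by (intro mult_mono qh_le infsum_nonneg) (auto simp: dominated_def)
    finally show ?thesis by (simp add: mult_ac)
  qed
  have N0: "N m' \<ge> 0" for m' unfolding N_def by (rule infsum_nonneg) simp
  have Ns: "(\<lambda>m'. norm (N m')) summable_on J"
    by (rule Infinite_Sum.abs_summable_on_comparison_test'[OF summable_on_cmult_right[OF D_summable]])
      (use Nle N0 in simp)
  have aF: "(\<lambda>p. norm (F p)) summable_on Sigma J (paths k)"
    unfolding Infinite_Sum.abs_summable_on_Sigma_iff using sF Ns by (simp add: N_def)
  have 1: "(\<lambda>ns. norm (path_term d \<tau> (Suc k) m ns)) summable_on paths (Suc k) m"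
    using aF summable_on_reindex_bij_betw[OF paths_Suc[of m k], of "\<lambda>ns. norm (path_term d \<tau> (Suc k) m ns)"]
    by (simp add: F)
  have "infsum (\<lambda>ns. norm (path_term d \<tau> (Suc k) m ns)) (paths (Suc k) m) = infsum (\<lambda>p. norm (F p)) (Sigma J (paths k))"
    using infsum_reindex_bij_betw[OF paths_Suc[of m k], of "\<lambda>ns. norm (path_term d \<tau> (Suc k) m ns)"]
    by (simp add: F)
  also have "\<dots> = infsum N J"
    unfolding N_def by (rule infsum_Sigma_banach[OF aF, symmetric])
  also have "\<dots> \<le> (K * (K * (K * S) ^ k)) * S"
  proof -
    have "N summable_on J" using Ns N0 by simp
    moreover have "(\<lambda>m'. (K * (K * (K * S) ^ k)) * D m') summable_on J" by (rule summable_on_cmult_right[OF D_summable])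
    ultimately have "infsum N J \<le> infsum (\<lambda>m'. (K * (K * (K * S) ^ k)) * D m') J"
      by (rule infsum_mono[OF _ _ Nle])
    then show ?thesis by (simp add: infsum_cmult_right' S_def)
  qed
  finally have 2: "infsum (\<lambda>ns. norm (path_term d \<tau> (Suc k) m ns)) (paths (Suc k) m) \<le> K * (K * S) ^ Suc k"
    by (simp add: mult_ac)
  have "infsum (path_term d \<tau> (Suc k) m) (paths (Suc k) m) = infsum F (Sigma J (paths k))"
    unfolding F[abs_def] by (rule infsum_reindex_bij_betw[OF paths_Suc, symmetric])
  also have "\<dots> = infsum (\<lambda>m'. infsum (\<lambda>ns. F (m', ns)) (paths k m')) J"
    by (rule infsum_Sigma_banach[OF abs_summable_summable[OF aF], symmetric])
  also have "\<dots> = col_iter d \<tau> (Suc k) m"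
    unfolding F_def using Suc.IH by (simp add: infsum_cmult_right')
  finally show ?case using 1 2 by simp
qed

end

section \<open>The non-resonant modes\<close>

definition nonresonant :: "int \<Rightarrow> int set" where "nonresonant n = - {n, - n}"

text \<open>Plays the role of \<open>D\<close>. The factor 4 pi^2 of the unperturbed gap is given up
  to absorb all perturbations.\<close>

definition gap_weight :: "int \<Rightarrow> int \<Rightarrow> real" where "gap_weight n m = 1 / \<bar>real_of_int (n\<^sup>2 - m\<^sup>2)\<bar>"

text \<open>The shift \<open>\<sigma>\<close> may have either sign, because A' is treated as A at
  -t.\<close>

definition gap_inverse :: "complex \<Rightarrow> real \<Rightarrow> int \<Rightarrow> complex" where
  "gap_inverse lam \<sigma> m = inverse (lam - of_real ((2 * pi * of_int m + \<sigma>)\<^sup>2))"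

lemma nonresonant_uminus: "nonresonant (- n) = nonresonant n" by (auto simp: nonresonant_def)
lemma nonresonant_reflect: "m \<in> nonresonant n \<longleftrightarrow> - m \<in> nonresonant n" by (auto simp: nonresonant_def)
lemma gap_inverse_reflect: "(\<lambda>m. gap_inverse lam (- t) (- m)) = gap_inverse lam t"
proof
  fix m
  have "(2 * pi * of_int (- m) + - t)\<^sup>2 = (2 * pi * of_int m + t)\<^sup>2"
    by (simp add: power2_eq_square algebra_simps)
  then show "gap_inverse lam (- t) (- m) = gap_inverse lam t m" by (simp only: gap_inverse_def)
qed

lemma summable_on_int_powr:
  assumes "p > (1::real)"
  shows "(\<lambda>j::int. \<bar>real_of_int j\<bar> powr - p) summable_on UNIV"
proof -
  have s: "(\<lambda>n::nat. real n powr - p) summable_on UNIV"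
    by (subst summable_on_UNIV_nonneg_real_iff) (use assms summable_real_powr_iff[of "-p"] in auto)
  have 1: "(\<lambda>j::int. \<bar>real_of_int j\<bar> powr - p) summable_on range int"
    by (subst summable_on_reindex) (use s in \<open>simp_all add: o_def\<close>)
  have "(\<lambda>j::int. \<bar>real_of_int j\<bar> powr - p) summable_on range (\<lambda>n. - int n)"
    by (subst summable_on_reindex) (use s in \<open>simp_all add: o_def inj_on_def\<close>)
  then have 2: "(\<lambda>j::int. \<bar>real_of_int j\<bar> powr - p) summable_on (range (\<lambda>n. - int n) - range int)"
    by (rule summable_on_subset_banach) auto
  have "range int \<union> (range (\<lambda>n. - int n) - range int) = UNIV"
  proof -
    have "j \<in> range int \<or> j \<in> range (\<lambda>n. - int n)" for j
      by (cases j rule: int_cases2) auto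
    then show ?thesis by blast
  qed
  then show ?thesis using summable_on_Un_disjoint[OF 1 2] by simp
qed

text \<open>In HOL 0 powr x = 0, so the index 0 contributes nothing, and for p > 1 the value is
  twice the Riemann zeta function.\<close>

definition int_zeta :: "real \<Rightarrow> real" where "int_zeta p = (\<Sum>\<^sub>\<infinity>j::int. \<bar>real_of_int j\<bar> powr - p)"

lemma int_zeta_nonneg: "int_zeta p \<ge> 0" unfolding int_zeta_def by (rule infsum_nonneg) simp

lemma two_sided_powr_sum:
  assumes p: "p > (1::real)"
  shows "(\<lambda>m. \<bar>real_of_int (n - m)\<bar> powr - p + \<bar>real_of_int (n + m)\<bar> powr - p) summable_on J"
    and "(\<Sum>\<^sub>\<infinity>m\<in>J. \<bar>real_of_int (n - m)\<bar> powr - p + \<bar>real_of_int (n + m)\<bar> powr - p) \<le> 2 * int_zeta p"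
proof -
  let ?f = "\<lambda>j::int. \<bar>real_of_int j\<bar> powr - p"
  have f: "?f summable_on UNIV" by (rule summable_on_int_powr[OF p])
  have b1: "bij_betw (\<lambda>m. n - m) UNIV (UNIV :: int set)"
    by (rule bij_betwI[where g = "\<lambda>m. n - m"]) auto
  have b2: "bij_betw (\<lambda>m. n + m) UNIV (UNIV :: int set)"
    by (rule bij_betwI[where g = "\<lambda>m. m - n"]) auto
  have s1: "(\<lambda>m. ?f (n - m)) summable_on UNIV" using summable_on_reindex_bij_betw[OF b1, of ?f] f by simp
  have s2: "(\<lambda>m. ?f (n + m)) summable_on UNIV" using summable_on_reindex_bij_betw[OF b2, of ?f] f by simp
  have s: "(\<lambda>m. ?f (n - m) + ?f (n + m)) summable_on UNIV" by (rule summable_on_add[OF s1 s2])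
  show sJ: "(\<lambda>m. ?f (n - m) + ?f (n + m)) summable_on J"
    by (rule summable_on_subset_banach[OF s]) simp
  have "(\<Sum>\<^sub>\<infinity>m\<in>J. ?f (n - m) + ?f (n + m)) \<le> (\<Sum>\<^sub>\<infinity>m. ?f (n - m) + ?f (n + m))"
    by (rule infsum_mono2[OF sJ s]) auto
  also have "\<dots> = (\<Sum>\<^sub>\<infinity>m. ?f (n - m)) + (\<Sum>\<^sub>\<infinity>m. ?f (n + m))" by (rule infsum_add[OF s1 s2])
  also have "\<dots> = 2 * int_zeta p"
    using infsum_reindex_bij_betw[OF b1, of ?f] infsum_reindex_bij_betw[OF b2, of ?f] by (simp add: int_zeta_def)
  finally show "(\<Sum>\<^sub>\<infinity>m\<in>J. ?f (n - m) + ?f (n + m)) \<le> 2 * int_zeta p" .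
qed

text \<open>Factor n^2 - m^2 = (|n| - |m|) (|n| + |m|); off resonance the first factor is a nonzero
  integer.\<close>

lemma square_diff_bounds:
  fixes m n :: int
  assumes n: "n \<noteq> 0" and m: "m \<in> nonresonant n"
  shows "\<bar>n\<^sup>2 - m\<^sup>2\<bar> \<ge> \<bar>n\<bar>" "\<bar>n\<^sup>2 - m\<^sup>2\<bar> \<ge> \<bar>m\<bar>" "\<bar>n\<^sup>2 - m\<^sup>2\<bar> \<ge> 1"
proof -
  have e: "\<bar>n\<^sup>2 - m\<^sup>2\<bar> = \<bar>\<bar>n\<bar> - \<bar>m\<bar>\<bar> * (\<bar>n\<bar> + \<bar>m\<bar>)"
  proof -
    have "n\<^sup>2 - m\<^sup>2 = (\<bar>n\<bar> - \<bar>m\<bar>) * (\<bar>n\<bar> + \<bar>m\<bar>)"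
      by (simp add: power2_eq_square algebra_simps abs_mult_self)
    then show ?thesis by (simp add: abs_mult)
  qed
  have "\<bar>n\<bar> \<noteq> \<bar>m\<bar>" using m by (auto simp: nonresonant_def abs_if split: if_splits)
  then have "\<bar>\<bar>n\<bar> - \<bar>m\<bar>\<bar> \<ge> 1" by simp
  then have "1 * (\<bar>n\<bar> + \<bar>m\<bar>) \<le> \<bar>\<bar>n\<bar> - \<bar>m\<bar>\<bar> * (\<bar>n\<bar> + \<bar>m\<bar>)" by (rule mult_right_mono) simp
  then have h: "\<bar>n\<bar> + \<bar>m\<bar> \<le> \<bar>n\<^sup>2 - m\<^sup>2\<bar>" unfolding e by simp
  show "\<bar>n\<^sup>2 - m\<^sup>2\<bar> \<ge> \<bar>n\<bar>" using h by linarith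
  show "\<bar>n\<^sup>2 - m\<^sup>2\<bar> \<ge> \<bar>m\<bar>" using h by linarith
  show "\<bar>n\<^sup>2 - m\<^sup>2\<bar> \<ge> 1" using h n by linarith
qed

lemma gap_weight_factor: "gap_weight n m = 1 / (\<bar>real_of_int (n - m)\<bar> * \<bar>real_of_int (n + m)\<bar>)"
  unfolding gap_weight_def by (simp add: abs_mult[symmetric] power2_eq_square algebra_simps)

lemma gap_weight_pos: "n \<noteq> 0 \<Longrightarrow> m \<in> nonresonant n \<Longrightarrow> gap_weight n m > 0"
proof -
  assume "n \<noteq> 0" "m \<in> nonresonant n"
  then have "\<bar>real_of_int (n\<^sup>2 - m\<^sup>2)\<bar> \<ge> 1" using square_diff_bounds(3)[of n m] by linarith
  then show "gap_weight n m > 0" unfolding gap_weight_def by (intro divide_pos_pos) linarith+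
qed

text \<open>The larger of \<open>|n - m|, |n + m|\<close> is at least \<open>n\<close>; its factor is split with exponents \<open>3/4\<close> and \<open>1/4\<close>.\<close>

lemma gap_weight_le_powr:
  assumes n: "n \<noteq> 0" and m: "m \<in> nonresonant n"
  shows "gap_weight n m \<le> \<bar>real_of_int n\<bar> powr (-3/4) * (\<bar>real_of_int (n - m)\<bar> powr (-5/4) + \<bar>real_of_int (n + m)\<bar> powr (-5/4))"
proof -
  have gen: "1 / (x * y) \<le> N powr (-3/4) * (x powr (-5/4) + y powr (-5/4))"
    if "0 < x" "0 < N" "x \<le> y" "N \<le> y" for x y N :: real
  proof -
    have "1 / (x * y) = (y powr (-3/4) * y powr (-1/4)) * x powr (-1)"
      using that by (simp add: powr_add[symmetric] powr_minus_divide)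
    also have "\<dots> \<le> (N powr (-3/4) * x powr (-1/4)) * x powr (-1)"
      using that by (intro mult_mono powr_mono2') auto
    also have "\<dots> = N powr (-3/4) * x powr (-1/4 + -1)" by (simp only: powr_add mult.assoc)
    also have "\<dots> = N powr (-3/4) * x powr (-5/4)" by simp
    also have "\<dots> \<le> N powr (-3/4) * (x powr (-5/4) + y powr (-5/4))" by (intro mult_left_mono) auto
    finally show ?thesis .
  qed
  let ?x = "\<bar>real_of_int (n - m)\<bar>" and ?y = "\<bar>real_of_int (n + m)\<bar>" and ?N = "\<bar>real_of_int n\<bar>"
  have pos: "?x > 0" "?y > 0" "?N > 0" using m n by (auto simp: nonresonant_def)
  have mx: "?N \<le> max ?x ?y" by simp
  show ?thesis
  proof (cases "?x \<le> ?y")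
    case True
    then show ?thesis using gen[of ?x ?N ?y] pos mx by (simp add: gap_weight_factor)
  next
    case False
    then show ?thesis using gen[of ?y ?N ?x] pos mx by (simp add: gap_weight_factor mult.commute add.commute)
  qed
qed

text \<open>The true order is (log n) / n. The weaker n^(-3/4) is enough, because it tends to 0 and
  its square is o(1/n).\<close>

lemma gap_weight_summable:
  assumes n: "n \<noteq> 0"
  shows "gap_weight n summable_on nonresonant n" "infsum (gap_weight n) (nonresonant n) \<le> 2 * int_zeta (5/4) * \<bar>real_of_int n\<bar> powr (-3/4)"
proof -
  let ?g = "\<lambda>m. \<bar>real_of_int (n - m)\<bar> powr - (5/4) + \<bar>real_of_int (n + m)\<bar> powr - (5/4)"
  let ?c = "\<bar>real_of_int n\<bar> powr (-3/4)"
  have g: "?g summable_on nonresonant n" by (rule two_sided_powr_sum) simp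
  have cg: "(\<lambda>m. ?c * ?g m) summable_on nonresonant n" by (rule summable_on_cmult_right[OF g])
  have le: "gap_weight n m \<le> ?c * ?g m" if "m \<in> nonresonant n" for m
    using gap_weight_le_powr[OF n that] by simp
  have "(\<lambda>m. norm (gap_weight n m)) summable_on nonresonant n"
    by (rule Infinite_Sum.abs_summable_on_comparison_test'[OF cg]) (use le gap_weight_pos[OF n] in \<open>force simp: less_imp_le\<close>)
  then show s: "gap_weight n summable_on nonresonant n" by (rule abs_summable_summable)
  have "infsum (gap_weight n) (nonresonant n) \<le> (\<Sum>\<^sub>\<infinity>m\<in>nonresonant n. ?c * ?g m)" by (rule infsum_mono[OF s cg le])
  also have "\<dots> = ?c * infsum ?g (nonresonant n)" by (rule infsum_cmult_right')
  also have "\<dots> \<le> ?c * (2 * int_zeta (5/4))" by (rule mult_left_mono[OF two_sided_powr_sum(2)]) auto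
  finally show "infsum (gap_weight n) (nonresonant n) \<le> 2 * int_zeta (5/4) * ?c" by (simp add: mult_ac)
qed

text \<open>Let X = |n^2 - m^2|, which dominates |n|, |m| and 1. The unperturbed gap is at least 36
  X, moving lam away from the centre costs at most 2 |n| <= 2 X, and the shift
  \<open>\<sigma>\<close> at most 2 X.\<close>

lemma denominator_bound:
  assumes n: "n \<noteq> 0" and m: "m \<in> nonresonant n" and \<sigma>: "\<bar>\<sigma>\<bar> \<le> 1 / 40"
    and l: "norm (lam - of_real ((2 * pi * of_int n)\<^sup>2)) \<le> 2 * \<bar>real_of_int n\<bar>"
  shows "\<bar>real_of_int (n\<^sup>2 - m\<^sup>2)\<bar> \<le> norm (lam - of_real ((2 * pi * of_int m + \<sigma>)\<^sup>2))"
    and "norm (gap_inverse lam \<sigma> m) \<le> gap_weight n m"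
    and "gap_inverse lam \<sigma> m * (lam - of_real ((2 * pi * of_int m + \<sigma>)\<^sup>2)) = 1"
proof -
  define X where "X = \<bar>real_of_int (n\<^sup>2 - m\<^sup>2)\<bar>"
  have X: "X \<ge> \<bar>real_of_int n\<bar>" "X \<ge> \<bar>real_of_int m\<bar>" "X \<ge> 1"
    using square_diff_bounds[OF n m] unfolding X_def by linarith+
  define r where "r = 4 * pi * \<sigma> * of_int m + \<sigma>\<^sup>2"
  define e where "e = lam - of_real ((2 * pi * of_int n)\<^sup>2)"
  have eq: "lam - of_real ((2 * pi * of_int m + \<sigma>)\<^sup>2) = of_real (4 * pi\<^sup>2 * of_int (n\<^sup>2 - m\<^sup>2)) - (of_real r - e)"
    by (simp add: e_def r_def power2_eq_square algebra_simps)
  have "4 * pi\<^sup>2 * X \<ge> 36 * X"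
    using pi_gt3 X(3) power_mono[of 3 pi 2] by (intro mult_right_mono) auto
  moreover have "norm (of_real (4 * pi\<^sup>2 * of_int (n\<^sup>2 - m\<^sup>2)) :: complex) = 4 * pi\<^sup>2 * X"
    by (simp only: norm_of_real abs_mult X_def) simp
  moreover have "norm (of_real r - e) \<le> \<bar>r\<bar> + norm e"
    using norm_triangle_ineq4[of "of_real r" e] by (simp only: norm_of_real)
  moreover have "norm e \<le> 2 * X" using l X by (simp add: e_def)
  moreover have "\<bar>r\<bar> \<le> X + X"
  proof -
    have "\<bar>4 * pi * \<sigma> * of_int m\<bar> = (4 * pi) * (\<bar>\<sigma>\<bar> * \<bar>real_of_int m\<bar>)" by (simp add: abs_mult)
    also have "\<dots> \<le> (4 * 4) * ((1/40) * X)"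
      using \<sigma> X pi_less_4 by (intro mult_mono) auto
    also have "\<dots> \<le> X" using X by simp
    finally have "\<bar>4 * pi * \<sigma> * of_int m\<bar> \<le> X" .
    moreover have "\<bar>\<sigma>\<bar> * \<bar>\<sigma>\<bar> \<le> 1 * 1" using \<sigma> by (intro mult_mono) auto
    then have "\<sigma>\<^sup>2 \<le> 1" by (simp add: power2_eq_square)
    then have "\<bar>\<sigma>\<^sup>2\<bar> \<le> X" using X by simp
    ultimately show ?thesis unfolding r_def using abs_triangle_ineq[of "4 * pi * \<sigma> * of_int m" "\<sigma>\<^sup>2"] by linarith
  qed
  ultimately have "norm (of_real (4 * pi\<^sup>2 * of_int (n\<^sup>2 - m\<^sup>2)) :: complex) - norm (of_real r - e) \<ge> X"
    using X by linarith
  then have L: "X \<le> norm (lam - of_real ((2 * pi * of_int m + \<sigma>)\<^sup>2))"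
    unfolding eq using norm_triangle_ineq2 order_trans by blast
  then show "\<bar>real_of_int (n\<^sup>2 - m\<^sup>2)\<bar> \<le> norm (lam - of_real ((2 * pi * of_int m + \<sigma>)\<^sup>2))"
    by (simp only: X_def)
  have "inverse (norm (lam - of_real ((2 * pi * of_int m + \<sigma>)\<^sup>2))) \<le> inverse X"
    by (rule le_imp_inverse_le[OF L]) (use X in simp)
  moreover have "gap_weight n m = inverse X" by (simp only: gap_weight_def X_def inverse_eq_divide)
  ultimately show "norm (gap_inverse lam \<sigma> m) \<le> gap_weight n m" by (simp only: gap_inverse_def norm_inverse)
  have "norm (lam - of_real ((2 * pi * of_int m + \<sigma>)\<^sup>2)) > 0" using L X by linarith
  then have "lam - of_real ((2 * pi * of_int m + \<sigma>)\<^sup>2) \<noteq> 0" by (metis norm_zero less_irrefl)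
  then show "gap_inverse lam \<sigma> m * (lam - of_real ((2 * pi * of_int m + \<sigma>)\<^sup>2)) = 1"
    unfolding gap_inverse_def by (rule left_inverse)
qed

lemma gap_weight_le: assumes "n \<noteq> 0" "m \<in> nonresonant n"
  shows "gap_weight n m \<le> 1" "\<bar>real_of_int m\<bar> * gap_weight n m \<le> 1"
proof -
  have X: "\<bar>real_of_int (n\<^sup>2 - m\<^sup>2)\<bar> \<ge> \<bar>real_of_int m\<bar>" "\<bar>real_of_int (n\<^sup>2 - m\<^sup>2)\<bar> \<ge> 1"
    using square_diff_bounds[OF assms] by linarith+
  then show "gap_weight n m \<le> 1" "\<bar>real_of_int m\<bar> * gap_weight n m \<le> 1"
    unfolding gap_weight_def by (simp_all add: divide_le_eq)
qed

lemma gap_inverse_perturb_lam: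
  assumes n: "n \<noteq> 0" and m: "m \<in> nonresonant n" and \<sigma>: "\<bar>\<sigma>\<bar> \<le> 1 / 40"
    and l: "norm (lam - of_real ((2 * pi * of_int n)\<^sup>2)) \<le> 2 * \<bar>real_of_int n\<bar>"
    and \<mu>: "norm (\<mu> - of_real ((2 * pi * of_int n)\<^sup>2)) \<le> 2 * \<bar>real_of_int n\<bar>"
  shows "norm (gap_inverse lam \<sigma> m - gap_inverse \<mu> \<sigma> m) \<le> norm (lam - \<mu>) * gap_weight n m"
proof -
  define u :: complex where "u = of_real ((2 * pi * of_int m + \<sigma>)\<^sup>2)"
  have 1: "gap_inverse lam \<sigma> m * (lam - u) = 1" "gap_inverse \<mu> \<sigma> m * (\<mu> - u) = 1"
    unfolding u_def by (rule denominator_bound(3)[OF n m \<sigma> l], rule denominator_bound(3)[OF n m \<sigma> \<mu>])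
  have "gap_inverse lam \<sigma> m - gap_inverse \<mu> \<sigma> m = gap_inverse lam \<sigma> m * gap_inverse \<mu> \<sigma> m * (\<mu> - lam)" using 1 by algebra
  then have "norm (gap_inverse lam \<sigma> m - gap_inverse \<mu> \<sigma> m) = norm (gap_inverse lam \<sigma> m) * norm (gap_inverse \<mu> \<sigma> m) * norm (lam - \<mu>)"
    by (simp add: norm_mult norm_minus_commute)
  also have "\<dots> \<le> gap_weight n m * 1 * norm (lam - \<mu>)"
    using denominator_bound(2)[OF n m \<sigma> l] denominator_bound(2)[OF n m \<sigma> \<mu>] gap_weight_le[OF n m] gap_weight_pos[OF n m]
    by (intro mult_right_mono mult_mono) auto
  finally show ?thesis by (simp add: mult.commute)
qed

text \<open>The two denominators differ by 8 pi \<sigma> m, which grows with m. One of the two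
  weights from the resolvent identity pays for it, since |m| times the weight is at most 1.\<close>

lemma gap_inverse_perturb_t:
  assumes n: "n \<noteq> 0" and m: "m \<in> nonresonant n" and \<sigma>: "0 \<le> \<sigma>" "\<sigma> \<le> 1 / 40"
    and l: "norm (lam - of_real ((2 * pi * of_int n)\<^sup>2)) \<le> 2 * \<bar>real_of_int n\<bar>"
  shows "norm (gap_inverse lam \<sigma> m - gap_inverse lam (- \<sigma>) m) \<le> (8 * pi * \<sigma>) * gap_weight n m"
proof -
  define u :: complex where "u = of_real ((2 * pi * of_int m + \<sigma>)\<^sup>2)"
  define v :: complex where "v = of_real ((2 * pi * of_int m + - \<sigma>)\<^sup>2)"
  have s: "\<bar>\<sigma>\<bar> \<le> 1/40" "\<bar>- \<sigma>\<bar> \<le> 1/40" using \<sigma> by auto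
  have 1: "gap_inverse lam \<sigma> m * (lam - u) = 1" "gap_inverse lam (-\<sigma>) m * (lam - v) = 1"
    unfolding u_def v_def by (rule denominator_bound(3)[OF n m s(1) l], rule denominator_bound(3)[OF n m s(2) l])
  have uv: "u - v = of_real (8 * pi * \<sigma> * of_int m)"
    by (simp add: u_def v_def power2_eq_square algebra_simps)
  have "gap_inverse lam \<sigma> m - gap_inverse lam (-\<sigma>) m = gap_inverse lam \<sigma> m * gap_inverse lam (-\<sigma>) m * (u - v)" using 1 by algebra
  then have "norm (gap_inverse lam \<sigma> m - gap_inverse lam (-\<sigma>) m) = norm (gap_inverse lam \<sigma> m) * norm (gap_inverse lam (-\<sigma>) m) * \<bar>8 * pi * \<sigma> * of_int m\<bar>"
    by (simp only: norm_mult uv norm_of_real)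
  also have "\<dots> \<le> gap_weight n m * gap_weight n m * \<bar>8 * pi * \<sigma> * of_int m\<bar>"
    using denominator_bound(2)[OF n m s(1) l] denominator_bound(2)[OF n m s(2) l] gap_weight_pos[OF n m]
    by (intro mult_right_mono mult_mono) auto
  also have "\<dots> = (8 * pi * \<sigma>) * gap_weight n m * (\<bar>real_of_int m\<bar> * gap_weight n m)"
    using \<sigma> by (simp add: abs_mult)
  also have "\<dots> \<le> (8 * pi * \<sigma>) * gap_weight n m * 1"
    using gap_weight_le(2)[OF n m] gap_weight_pos[OF n m] \<sigma> by (intro mult_left_mono) auto
  finally show ?thesis by simp
qed

text \<open>Passing to the unperturbed denominators costs O(|n| + |m|) against the square of the
  weight. This extra decay makes the error absolutely summable at the right rate even for s =
  0.\<close>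

lemma gap_inverse_compare:
  assumes n: "n \<noteq> 0" and m: "m \<in> nonresonant n" and \<sigma>: "\<bar>\<sigma>\<bar> \<le> 1 / 40"
    and l: "norm (lam - of_real ((2 * pi * of_int n)\<^sup>2)) \<le> 2 * \<bar>real_of_int n\<bar>"
  shows "norm (gap_inverse lam \<sigma> m - inverse (of_real (4 * pi\<^sup>2 * of_int (n\<^sup>2 - m\<^sup>2))))
     \<le> 4 * (gap_weight n m)\<^sup>2 * (\<bar>real_of_int (n - m)\<bar> + \<bar>real_of_int (n + m)\<bar>)"
proof -
  define X where "X = \<bar>real_of_int (n\<^sup>2 - m\<^sup>2)\<bar>"
  have X: "X \<ge> 1" using square_diff_bounds(3)[OF n m] unfolding X_def by linarith
  define v where "v = (of_real (4 * pi\<^sup>2 * of_int (n\<^sup>2 - m\<^sup>2)) :: complex)"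
  define u where "u = lam - of_real ((2 * pi * of_int m + \<sigma>)\<^sup>2)"
  have nv: "norm v = 4 * pi\<^sup>2 * X" unfolding v_def by (simp only: norm_of_real abs_mult X_def) simp
  have "4 * pi\<^sup>2 \<ge> 1" using pi_gt3 power_mono[of 3 pi 2] by simp
  then have vX: "norm v \<ge> X" unfolding nv using X by simp
  have v0: "v \<noteq> 0" using vX X by auto
  have niv: "norm (inverse v) \<le> gap_weight n m"
    unfolding norm_inverse gap_weight_def X_def[symmetric] inverse_eq_divide[symmetric]
    by (rule le_imp_inverse_le[OF vX]) (use X in simp)
  have du: "gap_inverse lam \<sigma> m * u = 1" unfolding u_def by (rule denominator_bound(3)[OF n m \<sigma> l])
  have iv: "inverse v * v = 1" using v0 by simp
  have "gap_inverse lam \<sigma> m - inverse v = gap_inverse lam \<sigma> m * inverse v * (v - u)" using du iv by algebra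
  then have e: "norm (gap_inverse lam \<sigma> m - inverse v) = norm (gap_inverse lam \<sigma> m) * norm (inverse v) * norm (v - u)"
    by (simp only: norm_mult)
  have vu: "v - u = of_real (4 * pi * \<sigma> * of_int m + \<sigma>\<^sup>2) - (lam - of_real ((2 * pi * of_int n)\<^sup>2))"
    by (simp add: v_def u_def power2_eq_square algebra_simps)
  have "norm (v - u) \<le> \<bar>4 * pi * \<sigma> * of_int m + \<sigma>\<^sup>2\<bar> + 2 * \<bar>real_of_int n\<bar>"
    unfolding vu using norm_triangle_ineq4[of "of_real (4 * pi * \<sigma> * of_int m + \<sigma>\<^sup>2)" "lam - of_real ((2 * pi * of_int n)\<^sup>2)"] l
    by (simp only: norm_of_real)
  also have "\<bar>4 * pi * \<sigma> * of_int m + \<sigma>\<^sup>2\<bar> \<le> \<bar>real_of_int m\<bar> + 1"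
  proof -
    have "\<bar>4 * pi * \<sigma> * of_int m\<bar> = (4 * pi) * (\<bar>\<sigma>\<bar> * \<bar>real_of_int m\<bar>)" by (simp add: abs_mult)
    also have "\<dots> \<le> (4 * 4) * ((1/40) * \<bar>real_of_int m\<bar>)"
      using \<sigma> pi_less_4 by (intro mult_mono) auto
    finally have "\<bar>4 * pi * \<sigma> * of_int m\<bar> \<le> \<bar>real_of_int m\<bar>" by simp
    moreover have "\<bar>\<sigma>\<bar> * \<bar>\<sigma>\<bar> \<le> 1 * 1" using \<sigma> by (intro mult_mono) auto
    then have "\<sigma>\<^sup>2 \<le> 1" by (simp add: power2_eq_square)
    ultimately show ?thesis using abs_triangle_ineq[of "4 * pi * \<sigma> * of_int m" "\<sigma>\<^sup>2"] by simp
  qed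
  finally have "norm (v - u) \<le> \<bar>real_of_int m\<bar> + 1 + 2 * \<bar>real_of_int n\<bar>" by simp
  moreover have "\<bar>real_of_int m\<bar> + 1 + 2 * \<bar>real_of_int n\<bar> \<le> 4 * (\<bar>real_of_int (n - m)\<bar> + \<bar>real_of_int (n + m)\<bar>)"
  proof -
    have "1 \<le> \<bar>real_of_int n\<bar>" using n by linarith
    then show ?thesis by (simp add: abs_if split: if_splits)
  qed
  ultimately have w: "norm (v - u) \<le> 4 * (\<bar>real_of_int (n - m)\<bar> + \<bar>real_of_int (n + m)\<bar>)" by linarith
  have "norm (gap_inverse lam \<sigma> m - inverse v) \<le> gap_weight n m * gap_weight n m * (4 * (\<bar>real_of_int (n - m)\<bar> + \<bar>real_of_int (n + m)\<bar>))"
    unfolding e using gap_weight_pos[OF n m]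
    by (intro mult_mono w niv denominator_bound(2)[OF n m \<sigma> l]) auto
  also have "\<dots> = 4 * (gap_weight n m)\<^sup>2 * (\<bar>real_of_int (n - m)\<bar> + \<bar>real_of_int (n + m)\<bar>)"
    by (simp add: power2_eq_square)
  finally show ?thesis by (simp only: v_def)
qed

lemma Dset_center:
  fixes lam :: complex
  assumes n: "n > (0::int)" and t: "0 \<le> t" "t \<le> \<rho>" "\<rho> < 1 / 40"
    and l: "norm (lam - of_real ((2 * pi * n + t)\<^sup>2)) \<le> 15 * pi * n * \<rho>"
  shows "norm (lam - of_real ((2 * pi * of_int n)\<^sup>2)) \<le> 2 * \<bar>real_of_int n\<bar>"
proof -
  have n1: "real_of_int n \<ge> 1" using n by simp
  have "lam - of_real ((2 * pi * of_int n)\<^sup>2) = (lam - of_real ((2 * pi * n + t)\<^sup>2)) + of_real (4 * pi * n * t + t\<^sup>2)"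
    by (simp add: power2_eq_square algebra_simps)
  also have "norm \<dots> \<le> 15 * pi * n * \<rho> + \<bar>4 * pi * n * t + t\<^sup>2\<bar>"
    by (rule order_trans[OF norm_triangle_ineq add_mono[OF l]]) (simp only: norm_of_real order_refl)
  also have "\<bar>4 * pi * n * t + t\<^sup>2\<bar> = 4 * pi * n * t + t * t" using t n1 by (simp add: power2_eq_square)
  \<comment> \<open>With pi < 4 and 1/40 for \<open>\<rho>\<close> and \<open>t\<close>, the three
    terms are 1.5 n, 0.4 n and 1/1600, in total at most 2 n for n >= 1.\<close>
  also have "15 * pi * n * \<rho> + (4 * pi * n * t + t * t) \<le> 15 * 4 * n * (1/40) + (4 * 4 * n * (1/40) + (1/40) * (1/40))"
    using t n1 pi_less_4 by (intro add_mono mult_mono) auto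
  also have "\<dots> \<le> 2 * \<bar>real_of_int n\<bar>" using n1 by simp
  finally show ?thesis .
qed

text \<open>\<open>idx\<close> forbids zero steps and \<open>paths\<close> allows them; such a term
  contains the factor \<open>qh 0\<close> = 0, so the two sums agree.\<close>

lemma (in path_sums) idx_sum:
  assumes d: "dominated d" and q0: "qh 0 = 0" and E: "\<And>x. m - x \<in> J \<longleftrightarrow> x \<notin> E"
  shows "infsum (path_term d \<tau> k m) (idx k E) = col_iter d \<tau> k m"
proof -
  have "infsum (path_term d \<tau> k m) (idx k E) = infsum (path_term d \<tau> k m) (paths k m)"
  proof (rule infsum_cong_neutral)
    fix ns assume ns: "ns \<in> paths k m - idx k E"
    then have "\<exists>r<k. ns ! r = 0" unfolding paths_def idx_def E by auto
    then obtain r where "r < k" "ns ! r = 0" by blast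
    then have "(\<Prod>r<k. qh (ns ! r)) = 0" using q0 by (intro prod_zero bexI[of _ r]) auto
    then show "path_term d \<tau> k m ns = 0" by (simp add: path_term_def)
  next
    fix ns assume "ns \<in> idx k E - paths k m"
    then show "path_term d \<tau> k m ns = 0" unfolding paths_def idx_def E by auto
  qed simp
  then show ?thesis using path_sum[OF d] by simp
qed

lemma prod_gap_inverse:
  fixes k :: nat
  shows "(\<Prod>r<k. gap_inverse lam t (f r)) = inverse (\<Prod>r<k. lam - of_real ((2 * pi * of_int (f r) + t)\<^sup>2))"
  by (induction k) (simp_all add: gap_inverse_def)

text \<open>All four series are path sums of one matrix: a and b start at n, a' and b' at -n,
  because (2 pi (n + x) - t)^2 = (2 pi (-n - x) + t)^2. The paths end at n for a and b', at -n for b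
  and a'.\<close>

lemma coefficients_eq_col_iter:
  assumes ps: "path_sums (fc q) (nonresonant n) (gap_weight n) K" and q0: "fc q 0 = 0"
    and d: "path_sums.dominated (nonresonant n) (gap_weight n) (gap_inverse lam t)"
  shows "a_k q n k lam t = path_sums.col_iter (fc q) (nonresonant n) (gap_inverse lam t) n k n"
    and "b_k q n k lam t = path_sums.col_iter (fc q) (nonresonant n) (gap_inverse lam t) (- n) k n"
    and "a'_k q n k lam t = path_sums.col_iter (fc q) (nonresonant n) (gap_inverse lam t) (- n) k (- n)"
    and "b'_k q n k lam t = path_sums.col_iter (fc q) (nonresonant n) (gap_inverse lam t) n k (- n)"
proof -
  interpret path_sums "fc q" "nonresonant n" "gap_weight n" K by (rule ps)
  have E1: "n - x \<in> nonresonant n \<longleftrightarrow> x \<notin> {0, 2 * n}" for x by (auto simp: nonresonant_def)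
  have E2: "- n - x \<in> nonresonant n \<longleftrightarrow> x \<notin> {0, - 2 * n}" for x by (auto simp: nonresonant_def)
  have sq: "(2 * pi * of_int (- n - x) + t)\<^sup>2 = (2 * pi * of_int (n + x) - t)\<^sup>2" for x :: int
    by (simp add: power2_eq_square algebra_simps)
  have arg: "n - x - n = - x" "n - x - (- n) = 2 * n - x" "- n - x - (- n) = - x" "- n - x - n = -2 * n - x" for x
    by simp_all
  show "a_k q n k lam t = col_iter (gap_inverse lam t) n k n"
    unfolding a_k_def idx_sum[OF d q0 E1, symmetric]
    by (rule infsum_cong) (simp only: path_term_def prod_gap_inverse divide_inverse arg)
  show "b_k q n k lam t = col_iter (gap_inverse lam t) (- n) k n"
    unfolding b_k_def idx_sum[OF d q0 E1, symmetric]
    by (rule infsum_cong) (simp only: path_term_def prod_gap_inverse divide_inverse arg)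
  show "a'_k q n k lam t = col_iter (gap_inverse lam t) (- n) k (- n)"
    unfolding a'_k_def idx_sum[OF d q0 E2, symmetric]
    by (rule infsum_cong) (simp only: path_term_def prod_gap_inverse divide_inverse sq arg)
  show "b'_k q n k lam t = col_iter (gap_inverse lam t) n k (- n)"
    unfolding b'_k_def idx_sum[OF d q0 E2, symmetric]
    by (rule infsum_cong) (simp only: path_term_def prod_gap_inverse divide_inverse sq arg)
qed

section \<open>Size of the coupling terms\<close>

lemma fc_cong_AE:
  assumes "AE x in lborel. x \<in> {0..1} \<longrightarrow> f x = g x"
  shows "fc f m = fc g m"
proof -
  obtain N where N: "{x \<in> space lborel. \<not> (x \<in> {0..1} \<longrightarrow> f x = g x)} \<subseteq> N" "emeasure lborel N = 0" "N \<in> sets lborel"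
    using AE_E[OF assms] by metis
  then have "N \<in> null_sets lborel" by (simp add: null_sets_def)
  then have neg: "negligible N" using null_sets_completionI negligible_iff_null_sets by blast
  have eq: "f x = g x" if "x \<in> {0..1}" "x \<notin> N" for x
  proof (rule ccontr)
    assume "f x \<noteq> g x"
    then have "x \<in> {x \<in> space lborel. \<not> (x \<in> {0..1} \<longrightarrow> f x = g x)}" using that by simp
    then show False using N(1) that(2) by (meson subsetD)
  qed
  show ?thesis unfolding fc_fexp_def
  proof (rule integral_spike[OF neg])
    fix x assume "x \<in> {0..1} - N"
    then have "f x = g x" by (intro eq) simp_all
    then show "g x * fexp (- m) x = f x * fexp (- m) x" by simp
  qed
qed

text \<open>\<open>fc_primitive\<close> applied s times; the conditions d k 0 = d k 1 for k < s
  remove the boundary terms.\<close>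

lemma sobolev_fc:
  assumes W: "sobolev_W1 p q d" and sp: "s \<le> p" and bc: "\<forall>k<s. d k 0 = d k 1"
  shows "(2 * pi * \<i> * of_int j) ^ s * fc q j = fc (d s) j"
proof -
  have prim: "primitive_on01 (d (Suc k)) (d k)" if "k < p" for k
    using W that unfolding sobolev_W1_def primitive_on01_def by simp
  have "k \<le> s \<Longrightarrow> (2 * pi * \<i> * of_int j) ^ k * fc q j = fc (d k) j" for k
  proof (induction k)
    case 0
    have "AE x in lborel. x \<in> {0..1} \<longrightarrow> d 0 x = q x" using W unfolding sobolev_W1_def by simp
    from fc_cong_AE[OF this] show ?case by simp
  next
    case (Suc k)
    have "fc (d (Suc k)) j = 2 * pi * \<i> * of_int j * fc (d k) j"
      by (rule fc_primitive[OF prim]) (use Suc.prems sp bc in auto)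
    then show ?case using Suc by (simp add: mult.assoc)
  qed
  then show ?thesis by simp
qed

lemma sobolev_fc_decay:
  assumes W: "sobolev_W1 p q d" and sp: "s \<le> p" and bc: "\<forall>k<s. d k 0 = d k 1"
  shows "norm (fc q j) * \<bar>real_of_int j\<bar> ^ s \<le> norm (fc (d s) j)"
proof -
  have "norm (fc (d s) j) = (2 * pi) ^ s * (norm (fc q j) * \<bar>real_of_int j\<bar> ^ s)"
    unfolding sobolev_fc[OF W sp bc, symmetric]
    by (simp add: norm_mult norm_power power_mult_distrib)
  moreover have "(1::real) \<le> (2 * pi) ^ s" using pi_gt3 by (intro one_le_power) simp
  then have "1 * (norm (fc q j) * \<bar>real_of_int j\<bar> ^ s) \<le> (2 * pi) ^ s * (norm (fc q j) * \<bar>real_of_int j\<bar> ^ s)"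
    by (rule mult_right_mono) simp
  ultimately show ?thesis by simp
qed

text \<open>With the periodic primitive \<open>P\<close> of \<open>q\<close>, the sum is \<open>(2 \<pi> i)\<^sup>2\<close> times the Fourier coefficient of
  \<open>P\<^sup>2\<close>, and \<open>(P\<^sup>2)' = 2 q P\<close> is integrable.\<close>

lemma quadratic_fourier_sum:
  assumes q: "q absolutely_integrable_on {0..1}" and q0: "fc q 0 = 0"
  shows "\<exists>f. f absolutely_integrable_on {0..1} \<and> (\<forall>N. N \<noteq> 0 \<longrightarrow>
    (\<Sum>\<^sub>\<infinity>k\<in>- {0, N}. fc q k * fc q (N - k) * inverse (of_int (k * (N - k)))) = 2 * pi * \<i> * fc f N / of_int N)"
proof -
  define P0 where "P0 x = 0 + integral {0..x} q" for x
  have P0: "primitive_on01 q P0" unfolding P0_def[abs_def] by (rule primitive_on01I[OF q])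
  have aP0: "P0 absolutely_integrable_on {0..1}"
    by (rule absolutely_integrable_continuous_real[OF primitive_on01_continuous[OF P0]])
  \<comment> \<open>The constant gives \<open>P\<close> mean zero. Then the terms k = 0 and k = N of
    Parseval's sum vanish, which are just those missing from the sum in question.\<close>
  define c where "c = - fc P0 0"
  define P where "P x = c + integral {0..x} q" for x
  have P: "primitive_on01 q P" unfolding P_def[abs_def] by (rule primitive_on01I[OF q])
  have cP: "continuous_on {0..1} P" by (rule primitive_on01_continuous[OF P])
  have aP: "P absolutely_integrable_on {0..1}" by (rule absolutely_integrable_continuous_real[OF cP])
  have "(\<lambda>x::real. c) absolutely_integrable_on {0..1}"
    by (rule absolutely_integrable_continuous_real) (intro continuous_intros)
  from fc_add[OF this aP0, of 0] have fcP0: "fc P 0 = 0"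
    by (simp add: P_def[abs_def] P0_def[abs_def] c_def fc_const)
  have P10: "P 1 = P 0"
  proof -
    have "integral {0..1} q = fc q 0" by (simp add: fc_fexp_def)
    then show ?thesis using q0 by (simp add: P_def)
  qed
  have fcP: "fc q k = 2 * pi * \<i> * of_int k * fc P k" for k by (rule fc_primitive[OF P P10])
  define f where "f s = q s * P s + P s * q s" for s
  have PP: "primitive_on01 f (\<lambda>x. P x * P x)" unfolding f_def[abs_def] by (rule primitive_on01_mult[OF P P])
  show ?thesis
  proof (intro exI conjI allI impI)
    show "f absolutely_integrable_on {0..1}" by (rule primitive_on01_abs[OF PP])
    fix N :: int assume N: "N \<noteq> 0"
    define a where "a = 2 * pi * \<i>"
    have a0: "a \<noteq> 0" by (simp add: a_def)
    have fN: "fc f N = a * of_int N * fc (\<lambda>x. P x * P x) N"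
      unfolding a_def by (rule fc_primitive[OF PP]) (simp add: P10)
    have cPN: "continuous_on {0..1} (\<lambda>x. P x * fexp (- N) x)" by (intro continuous_intros cP)
    have "integral {0..1} (\<lambda>x. P x * fexp (- N) x * P x) = fc (\<lambda>x. P x * P x) N"
      unfolding fc_fexp_def by (simp add: mult_ac)
    with parseval[OF cP P10 cPN]
    have "((\<lambda>k. fc P k * fc P (N - k)) has_sum fc (\<lambda>x. P x * P x) N) UNIV"
      by (simp add: fc_mult_fexp)
    then have "((\<lambda>k. fc P k * fc P (N - k)) has_sum fc (\<lambda>x. P x * P x) N) (- {0, N})"
      by (rule has_sum_cong_neutral[THEN iffD1, rotated -1]) (auto simp: fcP0)
    then have "((\<lambda>k. a\<^sup>2 * (fc P k * fc P (N - k))) has_sum a\<^sup>2 * fc (\<lambda>x. P x * P x) N) (- {0, N})"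
      by (rule has_sum_cmult_right)
    moreover have "a\<^sup>2 * (fc P k * fc P (N - k)) = fc q k * fc q (N - k) * inverse (of_int (k * (N - k)))"
      if k: "k \<in> - {0, N}" for k
    proof -
      define x y where "x = complex_of_int k" and "y = complex_of_int (N - k)"
      have xy: "x \<noteq> 0" "y \<noteq> 0" using k by (auto simp: x_def y_def)
      have "fc q k = a * x * fc P k" "fc q (N - k) = a * y * fc P (N - k)"
        unfolding a_def x_def y_def by (rule fcP)+
      moreover have "inverse (of_int (k * (N - k))) = inverse x * inverse y"
        by (simp only: x_def y_def of_int_mult inverse_mult_distrib)
      moreover have "x * inverse x = 1" "y * inverse y = 1" using xy by simp_all
      ultimately show ?thesis unfolding power2_eq_square by algebra
    qed
    ultimately have "((\<lambda>k. fc q k * fc q (N - k) * inverse (of_int (k * (N - k)))) has_sum a\<^sup>2 * fc (\<lambda>x. P x * P x) N) (- {0, N})"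
      by (rule has_sum_cong[THEN iffD1, rotated])
    from infsumI[OF this]
    have "(\<Sum>\<^sub>\<infinity>k\<in>- {0, N}. fc q k * fc q (N - k) * inverse (of_int (k * (N - k)))) = a\<^sup>2 * fc (\<lambda>x. P x * P x) N" .
    also have "\<dots> = a * fc f N / of_int N"
      unfolding fN using N by (simp add: power2_eq_square)
    finally show "(\<Sum>\<^sub>\<infinity>k\<in>- {0, N}. fc q k * fc q (N - k) * inverse (of_int (k * (N - k)))) = 2 * pi * \<i> * fc f N / of_int N"
      by (simp only: a_def)
  qed
qed

text \<open>Here x is the larger and y the smaller of |M - m| and |M + m|, with coefficient sizes a
  and b. The large index supplies the small factor \<open>\<omega>\<close> and all powers of X; what
  remains in y must be summable. For s >= 1 the decay of b supplies the second power of y, for s = 0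
  it comes from the improved weight of \<open>gap_inverse_compare\<close>.\<close>

lemma split_term_bounds:
  fixes x y X a b \<omega> K :: real
  assumes xy: "y \<le> x" "1 \<le> y" and X: "0 < X" "X \<le> x" and ab: "0 \<le> a" "0 \<le> b"
    and a: "a * x ^ s \<le> \<omega>" and b: "b * y ^ s \<le> K"
  shows "s \<ge> 1 \<Longrightarrow> a * b / (x * y) \<le> \<omega> * K / X ^ Suc s * (1 / y\<^sup>2)"
    and "s = 0 \<Longrightarrow> a * b * (4 * (1 / (x * y))\<^sup>2 * (x + y)) \<le> 8 * \<omega> * K / X ^ Suc s * (1 / y\<^sup>2)"
proof -
  have x0: "x > 0" using xy by simp
  have w0: "\<omega> \<ge> 0" using a ab x0 by (meson mult_nonneg_nonneg order_trans zero_le_power less_imp_le)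
  have ax: "a / x \<le> \<omega> / X ^ Suc s"
  proof -
    have "a / x = a * x ^ s / x ^ Suc s" using x0 by simp
    also have "\<dots> \<le> \<omega> / x ^ Suc s" using a x0 by (intro divide_right_mono) auto
    also have "\<dots> \<le> \<omega> / X ^ Suc s" using X w0 x0 by (intro divide_left_mono power_mono mult_pos_pos) auto
    finally show ?thesis .
  qed
  have wX: "\<omega> / X ^ Suc s \<ge> 0" using w0 X by simp
  show "a * b / (x * y) \<le> \<omega> * K / X ^ Suc s * (1 / y\<^sup>2)" if s: "s \<ge> 1"
  proof -
    have "b / y \<le> K / y\<^sup>2"
    proof -
      have "b * y \<le> b * y ^ s" using ab xy power_increasing[OF s, of y] by (intro mult_left_mono) auto
      then have "b * y \<le> K" using b by simp
      then show ?thesis using xy by (simp add: divide_le_eq power2_eq_square field_simps)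
    qed
    then have "(a / x) * (b / y) \<le> (\<omega> / X ^ Suc s) * (K / y\<^sup>2)"
      using ax wX ab xy by (intro mult_mono) auto
    then show ?thesis by simp
  qed
  show "a * b * (4 * (1 / (x * y))\<^sup>2 * (x + y)) \<le> 8 * \<omega> * K / X ^ Suc s * (1 / y\<^sup>2)" if s: "s = 0"
  proof -
    have "a * b * (4 * (1 / (x * y))\<^sup>2 * (x + y)) \<le> a * b * (4 * (1 / (x * y))\<^sup>2 * (2 * x))"
      using ab xy by (intro mult_left_mono) auto
    also have "\<dots> = 8 * ((a / x) * (b / y\<^sup>2))" using x0 xy by (simp add: power2_eq_square field_simps)
    also have "(a / x) * (b / y\<^sup>2) \<le> (\<omega> / X ^ Suc s) * (K / y\<^sup>2)"
      using ax wX ab xy b s by (intro mult_mono divide_right_mono) auto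
    finally show ?thesis by simp
  qed
qed

text \<open>M - m and M + m add up to 2 M, so one of them is at least |M| in size. The coefficient
  at that index gets \<open>\<omega>\<close>, the other one only \<open>K\<close>.\<close>

lemma two_sided_split_bounds:
  fixes M m :: int and qh :: "int \<Rightarrow> complex"
  assumes M: "M \<noteq> 0" and m: "m \<in> nonresonant M"
    and w: "\<And>j. \<bar>j\<bar> \<ge> \<bar>M\<bar> \<Longrightarrow> norm (qh j) * \<bar>real_of_int j\<bar> ^ s \<le> \<omega>"
    and K: "\<And>j. norm (qh j) * \<bar>real_of_int j\<bar> ^ s \<le> K"
  defines "Z \<equiv> \<bar>real_of_int (M - m)\<bar> powr - 2 + \<bar>real_of_int (M + m)\<bar> powr - 2"
  shows "s \<ge> 1 \<Longrightarrow> norm (qh (M - m)) * norm (qh (m + M)) * gap_weight M m \<le> \<omega> * K / \<bar>real_of_int M\<bar> ^ Suc s * Z"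
    and "s = 0 \<Longrightarrow> norm (qh (M - m)) * norm (qh (m + M)) *
        (4 * (gap_weight M m)\<^sup>2 * (\<bar>real_of_int (M - m)\<bar> + \<bar>real_of_int (M + m)\<bar>)) \<le> 8 * \<omega> * K / \<bar>real_of_int M\<bar> ^ Suc s * Z"
proof -
  define x y X a b where "x = \<bar>real_of_int (M - m)\<bar>" and "y = \<bar>real_of_int (M + m)\<bar>"
    and "X = \<bar>real_of_int M\<bar>" and "a = norm (qh (M - m))" and "b = norm (qh (m + M))"
  have x: "x \<ge> 1" and y: "y \<ge> 1" and X: "X > 0" using M m by (auto simp: x_def y_def X_def nonresonant_def)
  have gap_weight: "gap_weight M m = 1 / (x * y)" by (simp only: gap_weight_factor x_def y_def)
  have Z: "Z = 1 / x\<^sup>2 + 1 / y\<^sup>2"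
    unfolding Z_def x_def[symmetric] y_def[symmetric] using x y by (simp add: powr_minus_divide)
  have ab: "a \<ge> 0" "b \<ge> 0" by (simp_all add: a_def b_def)
  have aK: "a * x ^ s \<le> K" and bK: "b * y ^ s \<le> K"
    using K[of "M - m"] K[of "m + M"] by (simp_all add: a_def b_def x_def y_def add.commute)
  have K0: "K \<ge> 0" using K[of 0] by (meson mult_nonneg_nonneg norm_ge_zero order_trans zero_le_power abs_ge_zero)
  have w0: "\<omega> \<ge> 0" using w[of M] by (meson mult_nonneg_nonneg norm_ge_zero order_trans zero_le_power abs_ge_zero order_refl)
  have wK: "\<omega> * K / X ^ Suc s \<ge> 0" "8 * \<omega> * K / X ^ Suc s \<ge> 0" using w0 K0 X by simp_all
  have "x \<ge> X \<or> y \<ge> X" by (auto simp: x_def y_def X_def)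
  consider "y \<le> x" "X \<le> x" | "x \<le> y" "X \<le> y" using \<open>x \<ge> X \<or> y \<ge> X\<close> by linarith
  then have "(s \<ge> 1 \<longrightarrow> a * b * gap_weight M m \<le> \<omega> * K / X ^ Suc s * Z) \<and>
     (s = 0 \<longrightarrow> a * b * (4 * (gap_weight M m)\<^sup>2 * (x + y)) \<le> 8 * \<omega> * K / X ^ Suc s * Z)"
  proof cases
    case 1
    have aw: "a * x ^ s \<le> \<omega>"
      using w[of "M - m"] 1(2) unfolding a_def x_def X_def by linarith
    have le: "1 / y\<^sup>2 \<le> Z" by (simp add: Z)
    show ?thesis
      using split_term_bounds[OF 1(1) y X 1(2) ab aw bK] mult_left_mono[OF le wK(1)] mult_left_mono[OF le wK(2)]
      by (auto simp: gap_weight)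
  next
    case 2
    have bw: "b * y ^ s \<le> \<omega>"
      using w[of "m + M"] 2(2) unfolding b_def y_def X_def by (simp add: add.commute)
    have le: "1 / x\<^sup>2 \<le> Z" by (simp add: Z)
    show ?thesis
      using split_term_bounds[OF 2(1) x X 2(2) ab(2,1) bw aK] mult_left_mono[OF le wK(1)] mult_left_mono[OF le wK(2)]
      by (auto simp: gap_weight mult.commute[of b a] mult.commute[of y x] add.commute[of y x])
  qed
  then show "s \<ge> 1 \<Longrightarrow> norm (qh (M - m)) * norm (qh (m + M)) * gap_weight M m \<le> \<omega> * K / \<bar>real_of_int M\<bar> ^ Suc s * Z"
    and "s = 0 \<Longrightarrow> norm (qh (M - m)) * norm (qh (m + M)) *
        (4 * (gap_weight M m)\<^sup>2 * (\<bar>real_of_int (M - m)\<bar> + \<bar>real_of_int (M + m)\<bar>)) \<le> 8 * \<omega> * K / \<bar>real_of_int M\<bar> ^ Suc s * Z"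
    by (simp_all only: a_def b_def x_def y_def X_def)
qed

text \<open>The contribution of one intermediate mode to B. For s >= 1 it is estimated in absolute
  value. For s = 0 it is split into \<open>E\<close>, the error from unperturbed denominators, and
  \<open>H\<close>, which \<open>quadratic_fourier_sum\<close> turns into a Fourier coefficient over
  2 M.\<close>

lemma first_order_estimate:
  assumes q: "q absolutely_integrable_on {0..1}" and q0: "fc q 0 = 0"
    and W: "sobolev_W1 p q d" and sp: "s \<le> p" and bc: "\<forall>k<s. d k 0 = d k 1" and \<delta>: "\<delta> > 0"
  shows "\<exists>N0::nat. N0 > 0 \<and> (\<forall>M lam \<sigma>. \<bar>M\<bar> \<ge> int N0 \<longrightarrow> \<bar>\<sigma>\<bar> \<le> 1 / 40 \<longrightarrow>
       norm (lam - of_real ((2 * pi * of_int M)\<^sup>2)) \<le> 2 * \<bar>real_of_int M\<bar> \<longrightarrow>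
       norm (\<Sum>\<^sub>\<infinity>m\<in>nonresonant M. fc q (M - m) * gap_inverse lam \<sigma> m * fc q (m + M)) \<le> \<delta> / \<bar>real_of_int M\<bar> ^ Suc s)"
proof -
  have ds: "d s absolutely_integrable_on {0..1}" using W sp unfolding sobolev_W1_def by simp
  define K where "K = integral {0..1} (\<lambda>x. norm (d s x))"
  have K: "norm (fc q j) * \<bar>real_of_int j\<bar> ^ s \<le> K" for j
    using sobolev_fc_decay[OF W sp bc, of j] norm_fc_le[OF ds, of j] by (simp add: K_def)
  have K0: "K \<ge> 0" using K[of 0] by (meson mult_nonneg_nonneg norm_ge_zero order_trans zero_le_power abs_ge_zero)
  \<comment> \<open>16 is the factor 8 of the split estimate times the 2 of the two-sided sum. With
    \<open>\<omega>\<close> = \<delta> / (2 c) the error part stays within half of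
    \<open>\<delta>\<close>. The 1 keeps c positive.\<close>
  define c where "c = 16 * K * int_zeta 2 + 1"
  have c: "c > 0" unfolding c_def using K0 int_zeta_nonneg[of 2] by (simp add: add_nonneg_pos)
  define \<omega> where "\<omega> = \<delta> / (2 * c)"
  have w0: "\<omega> > 0" using c \<delta> by (simp add: \<omega>_def)
  have wc: "8 * \<omega> * K * (2 * int_zeta 2) \<le> \<delta> / 2"
  proof -
    have "8 * \<omega> * K * (2 * int_zeta 2) = \<omega> * (c - 1)" by (simp add: c_def)
    also have "\<dots> \<le> \<omega> * c" using w0 by simp
    also have "\<dots> = \<delta> / 2" using c by (simp add: \<omega>_def)
    finally show ?thesis .
  qed
  obtain N1 :: nat where N1: "\<And>m. \<bar>m\<bar> \<ge> int N1 \<Longrightarrow> norm (fc (d s) m) < \<omega>"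
    using riemann_lebesgue[OF ds w0] by metis
  obtain f where f: "f absolutely_integrable_on {0..1}"
    and fs: "\<forall>N. N \<noteq> 0 \<longrightarrow> (\<Sum>\<^sub>\<infinity>k\<in>- {0, N}. fc q k * fc q (N - k) * inverse (of_int (k * (N - k)))) = 2 * pi * \<i> * fc f N / of_int N"
    using quadratic_fourier_sum[OF q q0] by (elim exE conjE)
  have d2: "\<delta> / 2 > 0" using \<delta> by simp
  obtain N2 :: nat where N2: "\<And>m. \<bar>m\<bar> \<ge> int N2 \<Longrightarrow> norm (fc f m) < \<delta> / 2"
    using riemann_lebesgue[OF f d2] by metis
  define N0 where "N0 = N1 + N2 + 1"
  show ?thesis
  proof (intro exI conjI allI impI)
    show "N0 > 0" by (simp add: N0_def)
    fix M :: int and lam :: complex and \<sigma> :: real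
    assume MN: "\<bar>M\<bar> \<ge> int N0" and \<sigma>: "\<bar>\<sigma>\<bar> \<le> 1 / 40"
      and l: "norm (lam - of_real ((2 * pi * of_int M)\<^sup>2)) \<le> 2 * \<bar>real_of_int M\<bar>"
    have M: "M \<noteq> 0" using MN by (auto simp: N0_def)
    define X where "X = \<bar>real_of_int M\<bar> ^ Suc s"
    have X: "X > 0" using M by (simp add: X_def)
    have w: "norm (fc q j) * \<bar>real_of_int j\<bar> ^ s \<le> \<omega>" if "\<bar>j\<bar> \<ge> \<bar>M\<bar>" for j
    proof -
      have "\<bar>j\<bar> \<ge> int N1" using that MN by (simp add: N0_def)
      from N1[OF this] show ?thesis using sobolev_fc_decay[OF W sp bc, of j] by simp
    qed
    let ?Z = "\<lambda>m. \<bar>real_of_int (M - m)\<bar> powr - 2 + \<bar>real_of_int (M + m)\<bar> powr - 2"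
    have Zs: "?Z summable_on nonresonant M" "infsum ?Z (nonresonant M) \<le> 2 * int_zeta 2"
      by (rule two_sided_powr_sum, simp)+
    note tb = two_sided_split_bounds[where qh = "fc q" and s = s and \<omega> = \<omega> and K = K, OF M _ w K]
    show "norm (\<Sum>\<^sub>\<infinity>m\<in>nonresonant M. fc q (M - m) * gap_inverse lam \<sigma> m * fc q (m + M)) \<le> \<delta> / \<bar>real_of_int M\<bar> ^ Suc s"
    proof (cases "s = 0")
      case False
      have "norm (\<Sum>\<^sub>\<infinity>m\<in>nonresonant M. fc q (M - m) * gap_inverse lam \<sigma> m * fc q (m + M)) \<le> (\<omega> * K / X) * infsum ?Z (nonresonant M)"
      proof (rule infsum_dominated(3)[OF Zs(1)])
        fix m assume m: "m \<in> nonresonant M"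
        have "norm (fc q (M - m) * gap_inverse lam \<sigma> m * fc q (m + M)) = norm (fc q (M - m)) * norm (fc q (m + M)) * norm (gap_inverse lam \<sigma> m)"
          by (simp add: norm_mult)
        also have "\<dots> \<le> norm (fc q (M - m)) * norm (fc q (m + M)) * gap_weight M m"
          by (rule mult_left_mono[OF denominator_bound(2)[OF M m \<sigma> l]]) simp
        also have "\<dots> \<le> (\<omega> * K / X) * ?Z m" unfolding X_def by (rule tb(1)[OF m]) (use False in auto)
        finally show "norm (fc q (M - m) * gap_inverse lam \<sigma> m * fc q (m + M)) \<le> (\<omega> * K / X) * ?Z m" .
      qed
      also have "\<dots> \<le> (\<omega> * K / X) * (2 * int_zeta 2)"
        by (rule mult_left_mono[OF Zs(2)]) (use w0 K0 X in simp)
      also have "\<dots> = (2 * (\<omega> * (K * int_zeta 2))) / X" by simp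
      also have "\<dots> \<le> \<delta> / X"
      proof (rule divide_right_mono)
        have "\<omega> * (K * int_zeta 2) \<ge> 0" using w0 K0 int_zeta_nonneg[of 2] by simp
        moreover have "8 * \<omega> * K * (2 * int_zeta 2) = 16 * (\<omega> * (K * int_zeta 2))" by simp
        ultimately show "2 * (\<omega> * (K * int_zeta 2)) \<le> \<delta>" using wc by linarith
      qed (use X in simp)
      finally show ?thesis by (simp only: X_def)
    next
      case True
      define d0 where "d0 m = inverse (of_real (4 * pi\<^sup>2 * of_int (M\<^sup>2 - m\<^sup>2)) :: complex)" for m
      define E where "E m = fc q (M - m) * (gap_inverse lam \<sigma> m - d0 m) * fc q (m + M)" for m
      define H where "H m = fc q (M - m) * d0 m * fc q (m + M)" for m
      have Eb: "norm (E m) \<le> (8 * \<omega> * K / X) * ?Z m" if m: "m \<in> nonresonant M" for m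
      proof -
        have "norm (E m) = norm (fc q (M - m)) * norm (fc q (m + M)) * norm (gap_inverse lam \<sigma> m - d0 m)"
          by (simp add: E_def norm_mult)
        also have "\<dots> \<le> norm (fc q (M - m)) * norm (fc q (m + M)) *
            (4 * (gap_weight M m)\<^sup>2 * (\<bar>real_of_int (M - m)\<bar> + \<bar>real_of_int (M + m)\<bar>))"
          unfolding d0_def by (rule mult_left_mono[OF gap_inverse_compare[OF M m \<sigma> l]]) simp
        also have "\<dots> \<le> (8 * \<omega> * K / X) * ?Z m" unfolding X_def by (rule tb(2)[OF m _ True])
        finally show ?thesis .
      qed
      have Es: "E summable_on nonresonant M" by (rule infsum_dominated(2)[OF Zs(1) Eb])
      have "norm (infsum E (nonresonant M)) \<le> (8 * \<omega> * K / X) * infsum ?Z (nonresonant M)" by (rule infsum_dominated(3)[OF Zs(1) Eb])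
      also have "\<dots> \<le> (8 * \<omega> * K / X) * (2 * int_zeta 2)"
        by (rule mult_left_mono[OF Zs(2)]) (use w0 K0 X in simp)
      also have "\<dots> = (8 * \<omega> * K * (2 * int_zeta 2)) / X" by simp
      also have "\<dots> \<le> (\<delta> / 2) / X" using wc X by (intro divide_right_mono) auto
      finally have E: "norm (infsum E (nonresonant M)) \<le> (\<delta> / 2) / X" .
      have bij: "bij_betw (\<lambda>m. M - m) (nonresonant M) (- {0, 2 * M})"
        by (rule bij_betwI[where g = "\<lambda>k. M - k"]) (auto simp: nonresonant_def)
      have "infsum H (nonresonant M) = (\<Sum>\<^sub>\<infinity>m\<in>nonresonant M. (\<lambda>k. inverse (of_real (4 * pi\<^sup>2)) *
          (fc q k * fc q (2 * M - k) * inverse (of_int (k * (2 * M - k))))) (M - m))"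
      proof (rule infsum_cong)
        fix m
        have e1: "2 * M - (M - m) = m + M" by simp
        have e2: "M\<^sup>2 - m\<^sup>2 = (M - m) * (m + M)" by (simp add: power2_eq_square algebra_simps)
        have "d0 m = inverse (of_real (4 * pi\<^sup>2)) * inverse (of_int ((M - m) * (m + M)))"
          unfolding d0_def e2 by (simp only: of_real_mult of_real_of_int_eq inverse_mult_distrib)
        then show "H m = (\<lambda>k. inverse (of_real (4 * pi\<^sup>2)) *
          (fc q k * fc q (2 * M - k) * inverse (of_int (k * (2 * M - k))))) (M - m)"
          unfolding H_def e1 by (simp only: mult_ac)
      qed
      also have "\<dots> = (\<Sum>\<^sub>\<infinity>k\<in>- {0, 2 * M}. inverse (of_real (4 * pi\<^sup>2)) *
          (fc q k * fc q (2 * M - k) * inverse (of_int (k * (2 * M - k)))))"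
        by (rule infsum_reindex_bij_betw[OF bij])
      also have "\<dots> = inverse (of_real (4 * pi\<^sup>2)) * (2 * pi * \<i> * fc f (2 * M) / of_int (2 * M))"
        unfolding infsum_cmult_right' using fs[rule_format, of "2 * M"] M by simp
      finally have "norm (infsum H (nonresonant M)) = norm (inverse (of_real (4 * pi\<^sup>2)) * (2 * pi * \<i> * fc f (2 * M) / of_int (2 * M)) :: complex)"
        by simp
      also have "\<dots> = norm (fc f (2 * M)) / (4 * pi * \<bar>real_of_int M\<bar>)"
        by (simp add: norm_mult norm_divide norm_inverse power2_eq_square field_simps)
      also have "\<dots> \<le> norm (fc f (2 * M)) / (1 * \<bar>real_of_int M\<bar>)"
        using pi_gt3 M by (intro divide_left_mono mult_right_mono mult_pos_pos) auto
      also have "\<dots> \<le> (\<delta> / 2) / \<bar>real_of_int M\<bar>"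
      proof -
        have "\<bar>2 * M\<bar> \<ge> int N2" using MN by (simp add: N0_def)
        from less_imp_le[OF N2[OF this]] show ?thesis unfolding mult_1_left by (rule divide_right_mono) simp
      qed
      finally have Hn: "norm (infsum H (nonresonant M)) \<le> (\<delta> / 2) / X" using True by (simp add: X_def)
      have EH: "fc q (M - m) * gap_inverse lam \<sigma> m * fc q (m + M) = E m + H m" for m
        by (simp add: E_def H_def algebra_simps)
      show ?thesis
      \<comment> \<open>Summability of \<open>H\<close> is not established. If it fails, E + H is
        not summable either, its \<open>infsum\<close> is 0 by convention, and the bound holds
        trivially.\<close>
      proof (cases "H summable_on nonresonant M")
        case Hs: True
        have "(\<Sum>\<^sub>\<infinity>m\<in>nonresonant M. fc q (M - m) * gap_inverse lam \<sigma> m * fc q (m + M)) = infsum E (nonresonant M) + infsum H (nonresonant M)"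
          unfolding EH by (rule infsum_add[OF Es Hs])
        also have "norm \<dots> \<le> (\<delta> / 2) / X + (\<delta> / 2) / X"
          by (rule order_trans[OF norm_triangle_ineq add_mono[OF E Hn]])
        finally show ?thesis unfolding X_def[symmetric] by simp
      next
        case Hs: False
        have "\<not> (\<lambda>m. E m + H m) summable_on nonresonant M"
        proof
          assume "(\<lambda>m. E m + H m) summable_on nonresonant M"
          from has_sum_imp_summable[OF has_sum_minus[OF has_sum_infsum[OF this] has_sum_infsum[OF Es]]]
          show False using Hs by simp
        qed
        from infsum_not_exists[OF this] show ?thesis unfolding EH using \<delta> by simp
      qed
    qed
  qed
qed

lemma eventually_powr_neg_less:
  assumes "a > (0::real)" "e > 0"
  shows "\<exists>N::nat. \<forall>M::int. \<bar>M\<bar> \<ge> int N \<longrightarrow> \<bar>real_of_int M\<bar> powr - a < e"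
proof -
  have "((\<lambda>x::real. x powr - a) \<longlongrightarrow> 0) at_top"
    by (rule tendsto_neg_powr[OF _ filterlim_ident]) (use assms in simp)
  then have "\<forall>\<^sub>F x in at_top. (x::real) powr - a < e" using assms(2) by (rule order_tendstoD(2))
  then obtain B :: real where B: "\<And>x. x \<ge> B \<Longrightarrow> x powr - a < e"
    unfolding eventually_at_top_linorder by blast
  show ?thesis
  proof (intro exI allI impI)
    fix M :: int assume "\<bar>M\<bar> \<ge> int (nat \<lceil>B\<rceil>)"
    then have "\<bar>real_of_int M\<bar> \<ge> B" by linarith
    then show "\<bar>real_of_int M\<bar> powr - a < e" by (rule B)
  qed
qed

lemma dominated_gap_inverse:
  assumes ps: "path_sums qh (nonresonant n) (gap_weight n) K" and n: "n \<noteq> 0" and \<sigma>: "\<bar>\<sigma>\<bar> \<le> 1 / 40"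
    and l: "norm (lam - of_real ((2 * pi * of_int n)\<^sup>2)) \<le> 2 * \<bar>real_of_int n\<bar>"
  shows "path_sums.dominated (nonresonant n) (gap_weight n) (gap_inverse lam \<sigma>)"
  unfolding path_sums.dominated_def[OF ps] using denominator_bound(2)[OF n _ \<sigma> l] by blast

text \<open>\<open>tail\<close> involves neither the majorant nor \<open>K\<close>, so the series
  can be named outside the locale. A, A', B and B' are its four values with both ends in {n,
  -n}.\<close>

definition path_series :: "(real \<Rightarrow> complex) \<Rightarrow> int \<Rightarrow> complex \<Rightarrow> real \<Rightarrow> int \<Rightarrow> int \<Rightarrow> complex" where
  "path_series q n lam \<sigma> \<tau> m = path_sums.tail (fc q) (nonresonant n) (gap_inverse lam \<sigma>) \<tau> m"

text \<open>One constant K serves all n. M may have either sign: M = n controls B and M = -n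
  controls B'. The first-order term comes from \<open>first_order_estimate\<close>, the others from
  \<open>tail_weighted_bound\<close>, where S^2 = O(n^(-3/2)).\<close>

lemma path_sum_estimates:
  assumes q: "q absolutely_integrable_on {0..1}" and q0: "fc q 0 = 0"
    and W: "sobolev_W1 p q d" and sp: "s \<le> p" and bc: "\<forall>k<s. d k 0 = d k 1" and \<delta>: "\<delta> > 0"
  shows "\<exists>K. (\<forall>n. n \<noteq> 0 \<longrightarrow> path_sums (fc q) (nonresonant n) (gap_weight n) K) \<and>
    (\<exists>N0::nat. N0 > 0 \<and> (\<forall>M. \<bar>M\<bar> \<ge> int N0 \<longrightarrow>
       K * path_sums.S (nonresonant M) (gap_weight M) \<le> 1 / 4 \<and> 2 * K * (K * path_sums.S (nonresonant M) (gap_weight M)) \<le> 1 / 32 \<and>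
       (\<forall>lam \<sigma>. \<bar>\<sigma>\<bar> \<le> 1 / 40 \<longrightarrow> norm (lam - of_real ((2 * pi * of_int M)\<^sup>2)) \<le> 2 * \<bar>real_of_int M\<bar> \<longrightarrow>
         norm (path_series q M lam \<sigma> (- M) M) \<le> \<delta> / \<bar>real_of_int M\<bar> ^ Suc s)))"
proof -
  have ds: "d s absolutely_integrable_on {0..1}" using W sp unfolding sobolev_W1_def by simp
  define K where "K = integral {0..1} (\<lambda>x. norm (d s x)) + integral {0..1} (\<lambda>x. norm (q x)) + 1"
  have i0: "integral {0..1} (\<lambda>x. norm (d s x)) \<ge> 0" "integral {0..1} (\<lambda>x. norm (q x)) \<ge> 0"
    by (rule integral_nonneg, use ds q in \<open>simp_all add: absolutely_integrable_on_def\<close>)+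
  have Kw: "norm (fc q j) * \<bar>real_of_int j\<bar> ^ s \<le> K" for j
    using sobolev_fc_decay[OF W sp bc, of j] norm_fc_le[OF ds, of j] i0 by (simp add: K_def)
  have Kq: "norm (fc q j) \<le> K" for j
    using norm_fc_le[OF q, of j] i0 by (simp add: K_def)
  have K1: "K \<ge> 1" using i0 by (simp add: K_def)
  have ps: "path_sums (fc q) (nonresonant n) (gap_weight n) K" if "n \<noteq> 0" for n
    by unfold_locales (use Kq gap_weight_pos[OF that] gap_weight_summable(1)[OF that] in \<open>auto intro: less_imp_le\<close>)
  define Z where "Z = 2 * int_zeta (5/4) + 1"
  have Z: "Z > 0" using int_zeta_nonneg[of "5/4"] by (simp add: Z_def)
  define L where "L = 2 ^ Suc s * K"
  have L: "L \<ge> K" "L > 0"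
  proof -
    have "1 * K \<le> 2 ^ Suc s * K" using K1 by (intro mult_right_mono one_le_power) auto
    then show "L \<ge> K" by (simp add: L_def)
    then show "L > 0" using K1 by simp
  qed
  have \<delta>2: "\<delta> / 2 > 0" using \<delta> by simp
  obtain N1 :: nat where N1: "N1 > 0" "\<forall>M lam \<sigma>. \<bar>M\<bar> \<ge> int N1 \<longrightarrow> \<bar>\<sigma>\<bar> \<le> 1 / 40 \<longrightarrow>
       norm (lam - of_real ((2 * pi * of_int M)\<^sup>2)) \<le> 2 * \<bar>real_of_int M\<bar> \<longrightarrow>
       norm (\<Sum>\<^sub>\<infinity>m\<in>nonresonant M. fc q (M - m) * gap_inverse lam \<sigma> m * fc q (m + M)) \<le> (\<delta> / 2) / \<bar>real_of_int M\<bar> ^ Suc s"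
    using first_order_estimate[OF q q0 W sp bc \<delta>2] by (elim exE conjE)
  \<comment> \<open>Makes L S K <= 1/64, from which K S <= 1/4 and 2 K (K S) <= 1/32 follow by K >=
    1 and L >= K.\<close>
  define e where "e = 1 / (64 * L * Z * K)"
  have e: "e > 0" using L Z K1 by (simp add: e_def)
  \<comment> \<open>Half of \<open>\<delta>\<close> is left for the paths with at least two
    intermediate modes. Of X^(-3/2) one power X^(-1) is spent on the rate, and X^(-1/2) <
    \<open>e2\<close> takes care of the constant.\<close>
  define e2 where "e2 = \<delta> / (4 * K * (L * Z)\<^sup>2)"
  have e2: "e2 > 0" using L Z K1 \<delta> by (simp add: e2_def)
  obtain N2 :: nat where N2: "\<forall>M::int. \<bar>M\<bar> \<ge> int N2 \<longrightarrow> \<bar>real_of_int M\<bar> powr - (3/4) < e"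
    using eventually_powr_neg_less[of "3/4", OF _ e] by auto
  obtain N3 :: nat where N3: "\<forall>M::int. \<bar>M\<bar> \<ge> int N3 \<longrightarrow> \<bar>real_of_int M\<bar> powr - (1/2) < e2"
    using eventually_powr_neg_less[of "1/2", OF _ e2] by auto
  define N0 where "N0 = N1 + N2 + N3"
  have main: "K * path_sums.S (nonresonant M) (gap_weight M) \<le> 1 / 4 \<and> 2 * K * (K * path_sums.S (nonresonant M) (gap_weight M)) \<le> 1 / 32 \<and>
       (\<forall>lam \<sigma>. \<bar>\<sigma>\<bar> \<le> 1 / 40 \<longrightarrow> norm (lam - of_real ((2 * pi * of_int M)\<^sup>2)) \<le> 2 * \<bar>real_of_int M\<bar> \<longrightarrow>
         norm (path_series q M lam \<sigma> (- M) M) \<le> \<delta> / \<bar>real_of_int M\<bar> ^ Suc s)"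
    if MN: "\<bar>M\<bar> \<ge> int N0" for M
  proof -
    have M: "M \<noteq> 0" using MN N1(1) by (auto simp: N0_def)
    interpret path_sums "fc q" "nonresonant M" "gap_weight M" K by (rule ps[OF M])
    define X where "X = \<bar>real_of_int M\<bar>"
    have X: "X > 0" using M by (simp add: X_def)
    have Sle: "S \<le> Z * X powr - (3/4)"
    proof -
      have "S \<le> 2 * int_zeta (5/4) * X powr (-3/4)" unfolding S_def X_def by (rule gap_weight_summable(2)[OF M])
      also have "\<dots> \<le> Z * X powr (-3/4)" by (intro mult_right_mono) (simp_all add: Z_def)
      finally show ?thesis by simp
    qed
    have Xe: "X powr - (3/4) < e" unfolding X_def by (rule N2[rule_format]) (use MN in \<open>simp add: N0_def\<close>)
    have LS: "L * S * K \<le> 1 / 64"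
    proof -
      have "L * S * K \<le> L * (Z * e) * K"
        using L Z K1 Xe Sle by (intro mult_right_mono mult_left_mono order_trans[OF Sle]) auto
      also have "\<dots> = 1 / 64" using L Z K1 by (simp add: e_def)
      finally show ?thesis .
    qed
    have LSn: "L * S \<ge> 0" using L S_nonneg by simp
    have LS1: "L * S \<le> 1 / 64"
      using LS mult_left_mono[OF K1 LSn] by simp
    have KS: "K * S \<le> L * S" using L S_nonneg by (intro mult_right_mono) auto
    have A: "K * S \<le> 1 / 4" using KS LS1 by simp
    have B: "2 * K * (K * S) \<le> 1 / 32"
    proof -
      have "K * (K * S) \<le> K * (L * S)" using KS K1 by (intro mult_left_mono) auto
      then show ?thesis using LS by (simp add: mult_ac)
    qed
    have C: "norm (path_series q M lam \<sigma> (- M) M) \<le> \<delta> / X ^ Suc s"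
      if \<sigma>: "\<bar>\<sigma>\<bar> \<le> 1 / 40" and l: "norm (lam - of_real ((2 * pi * of_int M)\<^sup>2)) \<le> 2 * \<bar>real_of_int M\<bar>" for lam \<sigma>
    proof -
      have d: "dominated (gap_inverse lam \<sigma>)" by (rule dominated_gap_inverse[OF ps[OF M] M \<sigma> l])
      have first: "norm (col_iter (gap_inverse lam \<sigma>) (- M) 1 M) \<le> (\<delta> / 2) / X ^ Suc s"
        using N1(2)[rule_format, OF _ \<sigma> l] MN by (simp add: N0_def X_def)
      define D where "D = norm (tail (gap_inverse lam \<sigma>) (- M) M - col_iter (gap_inverse lam \<sigma>) (- M) 1 M)"
      have "D * \<bar>real_of_int (M - (- M))\<bar> ^ s \<le> 2 * K * (2 ^ Suc s * K * S)\<^sup>2"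
        unfolding D_def by (rule tail_weighted_bound[OF A d Kw]) (use LS1 in \<open>simp add: L_def\<close>)
      then have "D * (2 * X) ^ s \<le> 2 * K * (L * S)\<^sup>2" by (simp add: X_def L_def abs_mult)
      moreover have "D * X ^ s \<le> D * (2 * X) ^ s"
        using X by (intro mult_left_mono power_mono) (auto simp: D_def)
      moreover have "2 * K * (L * S)\<^sup>2 \<le> (\<delta> / 2) / X"
      proof -
        have "(L * S)\<^sup>2 \<le> (L * (Z * X powr - (3/4)))\<^sup>2"
          using L S_nonneg Sle by (intro power_mono mult_left_mono) auto
        also have "\<dots> = (L * Z)\<^sup>2 * (X powr - (3/4) * X powr - (3/4))"
          by (simp add: power2_eq_square)
        also have "X powr - (3/4) * X powr - (3/4) = X powr - (1/2) * X powr - 1"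
          by (simp only: powr_add[symmetric]) simp
        also have "X powr - 1 = 1 / X" using X by (simp add: powr_minus_divide)
        finally have "2 * K * (L * S)\<^sup>2 \<le> 2 * K * ((L * Z)\<^sup>2 * (X powr - (1/2) * (1 / X)))"
          using K1 by (intro mult_left_mono) auto
        also have "\<dots> \<le> 2 * K * ((L * Z)\<^sup>2 * (e2 * (1 / X)))"
          using K1 X N3[rule_format, of M] MN by (intro mult_left_mono mult_right_mono) (auto simp: X_def N0_def intro: less_imp_le)
        also have "\<dots> = (\<delta> / 2) / X" using K1 L Z X by (simp add: e2_def)
        finally show ?thesis .
      qed
      ultimately have "D * X ^ s \<le> (\<delta> / 2) / X" by linarith
      then have "D \<le> (\<delta> / 2) / X ^ Suc s" using X by (simp add: field_simps)
      then have "norm (tail (gap_inverse lam \<sigma>) (- M) M) \<le> (\<delta> / 2) / X ^ Suc s + (\<delta> / 2) / X ^ Suc s"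
        using first norm_triangle_sub[of "tail (gap_inverse lam \<sigma>) (- M) M" "col_iter (gap_inverse lam \<sigma>) (- M) 1 M"]
        unfolding D_def by linarith
      then show ?thesis unfolding path_series_def by (simp add: field_simps)
    qed
    show ?thesis using A B C unfolding X_def by blast
  qed
  show ?thesis
    by (rule exI[of _ K], intro conjI exI[of _ N0] allI impI ps main) (use N1(1) in \<open>simp_all add: N0_def\<close>)
qed

lemma coefficients_eq_tail:
  assumes ps: "path_sums (fc q) (nonresonant n) (gap_weight n) K" and q0: "fc q 0 = 0" and n: "n \<noteq> 0"
    and \<sigma>: "\<bar>t\<bar> \<le> 1 / 40" and l: "norm (lam - of_real ((2 * pi * of_int n)\<^sup>2)) \<le> 2 * \<bar>real_of_int n\<bar>"
  shows "A_fun q n lam t = path_series q n lam t n n" "B_fun q n lam t = path_series q n lam t (- n) n"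
    "A'_fun q n lam t = path_series q n lam t (- n) (- n)" "B'_fun q n lam t = path_series q n lam t n (- n)"
  using coefficients_eq_col_iter[OF ps q0 dominated_gap_inverse[OF ps n \<sigma> l]]
  unfolding A_fun_def B_fun_def A'_fun_def B'_fun_def path_series_def path_sums.tail_def[OF ps] by simp_all

text \<open>1/32 is tuned to the second fact: A' is A at -t, the reciprocal gaps change by at most 8
  pi t times the weight, and 8 pi / 32 < 1. The third fact gives the continuity in lam for Brouwer's
  theorem.\<close>

lemma tail_facts:
  assumes ps: "path_sums (fc q) (nonresonant n) (gap_weight n) K" and n: "n \<noteq> 0"
    and small: "K * path_sums.S (nonresonant n) (gap_weight n) \<le> 1 / 4"
    and small2: "2 * K * (K * path_sums.S (nonresonant n) (gap_weight n)) \<le> 1 / 32"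
  shows "\<And>t lam \<tau> m. \<bar>t\<bar> \<le> 1 / 40 \<Longrightarrow> norm (lam - of_real ((2 * pi * of_int n)\<^sup>2)) \<le> 2 * \<bar>real_of_int n\<bar> \<Longrightarrow>
      norm (path_series q n lam t \<tau> m) \<le> 1 / 32"
    and "\<And>t lam. 0 \<le> t \<Longrightarrow> t \<le> 1 / 40 \<Longrightarrow> norm (lam - of_real ((2 * pi * of_int n)\<^sup>2)) \<le> 2 * \<bar>real_of_int n\<bar> \<Longrightarrow>
      norm (path_series q n lam t n n - path_series q n lam t (- n) (- n)) \<le> t"
    and "\<And>t lam \<mu> \<tau> m. \<bar>t\<bar> \<le> 1 / 40 \<Longrightarrow> norm (lam - of_real ((2 * pi * of_int n)\<^sup>2)) \<le> 2 * \<bar>real_of_int n\<bar> \<Longrightarrow>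
      norm (\<mu> - of_real ((2 * pi * of_int n)\<^sup>2)) \<le> 2 * \<bar>real_of_int n\<bar> \<Longrightarrow>
      norm (path_series q n lam t \<tau> m - path_series q n \<mu> t \<tau> m) \<le> norm (lam - \<mu>)"
proof -
  interpret path_sums "fc q" "nonresonant n" "gap_weight n" K by (rule ps)
  note d = dominated_gap_inverse[OF ps n]
  show "norm (path_series q n lam t \<tau> m) \<le> 1 / 32" if "\<bar>t\<bar> \<le> 1 / 40"
    "norm (lam - of_real ((2 * pi * of_int n)\<^sup>2)) \<le> 2 * \<bar>real_of_int n\<bar>" for t lam \<tau> m
    unfolding path_series_def by (rule order_trans[OF col_iter_sums(2)[OF small d[OF that]] small2])
  show "norm (path_series q n lam t n n - path_series q n lam t (- n) (- n)) \<le> t"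
    if t: "0 \<le> t" "t \<le> 1 / 40" and l: "norm (lam - of_real ((2 * pi * of_int n)\<^sup>2)) \<le> 2 * \<bar>real_of_int n\<bar>" for t lam
  proof -
    have at: "\<bar>t\<bar> \<le> 1/40" "\<bar>- t\<bar> \<le> 1/40" using t by auto
    have "col_iter (gap_inverse lam t) (- n) k (- n) = col_iter (gap_inverse lam (- t)) n k n" for k
      using col_iter_diagonal_reflect[OF nonresonant_reflect d[OF at(2) l], of n k] by (simp only: gap_inverse_reflect)
    then have "tail (gap_inverse lam t) (- n) (- n) = tail (gap_inverse lam (- t)) n n"
      unfolding tail_def by (simp only:)
    moreover have "norm (tail (gap_inverse lam t) n n - tail (gap_inverse lam (- t)) n n) \<le> 2 * ((8 * pi * t) * K * (K * S))"
      by (rule tail_perturb[OF small d[OF at(1) l] d[OF at(2) l] gap_inverse_perturb_t[OF n _ t l]]) (use t in auto)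
    moreover have "2 * ((8 * pi * t) * K * (K * S)) \<le> t"
    proof -
      have "2 * ((8 * pi * t) * K * (K * S)) = (8 * pi * t) * (2 * K * (K * S))" by simp
      also have "\<dots> \<le> (8 * pi * t) * (1 / 32)" using t by (intro mult_left_mono small2) auto
      also have "\<dots> = (pi / 4) * t" by simp
      also have "\<dots> \<le> 1 * t" using pi_less_4 t by (intro mult_right_mono) auto
      finally show ?thesis by simp
    qed
    ultimately show ?thesis unfolding path_series_def by simp
  qed
  show "norm (path_series q n lam t \<tau> m - path_series q n \<mu> t \<tau> m) \<le> norm (lam - \<mu>)"
    if t: "\<bar>t\<bar> \<le> 1 / 40" and l: "norm (lam - of_real ((2 * pi * of_int n)\<^sup>2)) \<le> 2 * \<bar>real_of_int n\<bar>"
      and \<mu>: "norm (\<mu> - of_real ((2 * pi * of_int n)\<^sup>2)) \<le> 2 * \<bar>real_of_int n\<bar>" for t lam \<mu> \<tau> m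
  proof -
    have "norm (tail (gap_inverse lam t) \<tau> m - tail (gap_inverse \<mu> t) \<tau> m) \<le> 2 * (norm (lam - \<mu>) * K * (K * S))"
      by (rule tail_perturb[OF small d[OF t l] d[OF t \<mu>] gap_inverse_perturb_lam[OF n _ t l \<mu>]]) auto
    also have "\<dots> = norm (lam - \<mu>) * (2 * K * (K * S))" by simp
    also have "\<dots> \<le> norm (lam - \<mu>) * 1" by (rule mult_left_mono) (use small2 in auto)
    finally show ?thesis by (simp add: path_series_def)
  qed
qed

section \<open>Eigenfunctions from the reduced equations\<close>

text \<open>Integration by parts determines all coefficients of an antiderivative except where 2 pi
  m + t = 0, that is for m = 0 and t = 0. Applied twice, the lemma recovers y' and y from y'', so no
  Fourier series has to be differentiated.\<close>

lemma twisted_antiderivative: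
  assumes f: "f absolutely_integrable_on {0..1}" and t: "0 \<le> t" "t \<le> pi"
    and hat: "\<And>m. fc (\<lambda>x. f x * cis (- t * x)) m = \<i> * of_real (2 * pi * of_int m + t) * c m"
  shows "\<exists>F. primitive_on01 f F \<and> F 1 = cis t * F 0 \<and> (\<forall>m. fc (\<lambda>x. F x * cis (- t * x)) m = c m)"
proof -
  define F0 where "F0 x = 0 + integral {0..x} f" for x
  have P0: "primitive_on01 f F0" unfolding F0_def[abs_def] by (rule primitive_on01I[OF f])
  \<comment> \<open>For t > 0 the boundary condition fixes the constant, as cis t is not 1. For t =
    0 the condition holds because \<open>f\<close> has mean zero, and the constant is free to match
    \<open>c 0\<close>.\<close>
  define C where "C = (if t = 0 then c 0 - fc F0 0 else F0 1 / (cis t - 1))"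
  define F where "F x = C + integral {0..x} f" for x
  have P: "primitive_on01 f F" unfolding F_def[abs_def] by (rule primitive_on01I[OF f])
  have FF: "F x = C + F0 x" for x by (simp add: F_def F0_def)
  have F00: "F0 0 = 0" by (simp add: F0_def)
  have bc: "F 1 = cis t * F 0"
  proof (cases "t = 0")
    case True
    have "fc (\<lambda>x. f x * cis (- t * x)) 0 = integral {0..1} f" unfolding fc_fexp_def using True by simp
    then have "F0 1 = 0" using hat[of 0] True by (simp add: F0_def)
    then show ?thesis using True by (simp add: FF F00)
  next
    case False
    have "cis t \<noteq> 1"
    proof
      assume "cis t = 1"
      then have "cos t = 1" by (metis cis.sel(1) one_complex.sel(1))
      moreover have "cos t < cos 0" by (rule cos_monotone_0_pi) (use t False in auto)
      ultimately show False by simp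
    qed
    then have "cis t - 1 \<noteq> 0" by simp
    then have "C * (cis t - 1) = F0 1" using False by (simp add: C_def)
    then show ?thesis by (simp add: FF F00 algebra_simps)
  qed
  define e where "e x = cis (- t * x)" for x
  have e1: "primitive_on01 (\<lambda>x. \<i> * of_real (- t) * cis (- t * x)) e"
    unfolding e_def[abs_def]
    by (rule primitive_on01_smooth, rule has_vector_derivative_cis_mult) (intro continuous_intros)
  have ce: "continuous_on {0..1} e" by (rule primitive_on01_continuous[OF e1])
  have cF: "continuous_on {0..1} F" by (rule primitive_on01_continuous[OF P])
  have E: "primitive_on01 (\<lambda>x. f x * e x + F x * (\<i> * of_real (- t) * cis (- t * x))) (\<lambda>x. F x * e x)"
    by (rule primitive_on01_mult[OF P e1])
  have E10: "F 1 * e 1 = F 0 * e 0"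
    using bc by (simp add: e_def cis_mult)
  have afe: "(\<lambda>x. f x * e x) absolutely_integrable_on {0..1}"
    by (rule absolutely_integrable_mult_continuous[OF f ce])
  have aFe: "(\<lambda>x. (- \<i> * of_real t) * (F x * e x)) absolutely_integrable_on {0..1}"
    by (rule absolutely_integrable_continuous_real) (intro continuous_intros cF ce)
  have key: "\<i> * of_real (2 * pi * of_int m + t) * c m = \<i> * of_real (2 * pi * of_int m + t) * fc (\<lambda>x. F x * e x) m" for m
  proof -
    have "fc (\<lambda>x. f x * e x + F x * (\<i> * of_real (- t) * cis (- t * x))) m = 2 * pi * \<i> * of_int m * fc (\<lambda>x. F x * e x) m"
      by (rule fc_primitive[OF E E10])
    moreover have "(\<lambda>x. f x * e x + F x * (\<i> * of_real (- t) * cis (- t * x))) = (\<lambda>x. f x * e x + (- \<i> * of_real t) * (F x * e x))"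
      by (auto simp: e_def)
    ultimately have "fc (\<lambda>x. f x * e x) m + (- \<i> * of_real t) * fc (\<lambda>x. F x * e x) m = 2 * pi * \<i> * of_int m * fc (\<lambda>x. F x * e x) m"
      using fc_add[OF afe aFe, of m] by (simp only: fc_cmult)
    moreover have "fc (\<lambda>x. f x * e x) m = \<i> * of_real (2 * pi * of_int m + t) * c m"
      unfolding e_def by (rule hat)
    ultimately show ?thesis by (simp add: algebra_simps)
  qed
  have "fc (\<lambda>x. F x * e x) m = c m" for m
  proof (cases "2 * pi * of_int m + t = 0")
    case False
    then have "\<i> * of_real (2 * pi * of_int m + t) \<noteq> (0::complex)" by (simp only: mult_eq_0_iff of_real_eq_0_iff complex_i_not_zero simp_thms)
    then show ?thesis using key[of m] by (metis mult_left_cancel)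
  next
    case True
    have m0: "m = 0"
    proof (rule ccontr)
      assume "m \<noteq> 0"
      then have "m \<le> -1 \<or> m \<ge> 1" by linarith
      then show False
      proof
        assume "m \<le> -1"
        then have "2 * pi * of_int m \<le> 2 * pi * (-1)" by (intro mult_left_mono) auto
        then have "2 * pi * of_int m \<le> - (2 * pi)" by simp
        then show False using True t pi_gt_zero by linarith
      next
        assume "m \<ge> 1"
        then have "2 * pi * of_int m \<ge> 2 * pi * 1" by (intro mult_left_mono) auto
        then show False using True t pi_gt_zero by linarith
      qed
    qed
    then have t0: "t = 0" using True by simp
    have aF0: "F0 absolutely_integrable_on {0..1}"
      by (rule absolutely_integrable_continuous_real[OF primitive_on01_continuous[OF P0]])
    have "(\<lambda>x::real. C) absolutely_integrable_on {0..1}"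
      by (rule absolutely_integrable_continuous_real) (intro continuous_intros)
    from fc_add[OF this aF0, of 0] have "fc (\<lambda>x. C + F0 x) 0 = C + fc F0 0" by (simp add: fc_const)
    then show ?thesis using m0 t0 by (simp add: e_def FF C_def)
  qed
  then show ?thesis using P bc unfolding e_def by blast
qed

text \<open>From a null vector (u1, u2) of the 2 x 2 system the amplitudes of all other modes are
  rebuilt by the Neumann series \<open>G\<close>. They satisfy the equation for every mode, and the
  solution is nontrivial because u1 or u2 is among its coefficients.\<close>

lemma eigenvalue_from_reduction:
  fixes n :: int and u1 u2 :: complex
  assumes q: "q absolutely_integrable_on {0..1}" and q0: "fc q 0 = 0"
    and ps: "path_sums (fc q) (nonresonant n) (gap_weight n) K" and n: "n \<noteq> 0"
    and small: "K * path_sums.S (nonresonant n) (gap_weight n) \<le> 1 / 4"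
    and t: "0 \<le> t" "t \<le> 1 / 40" and l: "norm (lam - of_real ((2 * pi * of_int n)\<^sup>2)) \<le> 2 * \<bar>real_of_int n\<bar>"
    and u: "u1 \<noteq> 0 \<or> u2 \<noteq> 0"
    and e1: "(lam - of_real ((2 * pi * of_int n + t)\<^sup>2)) * u1 = u1 * path_series q n lam t n n + u2 * (fc q (2 * n) + path_series q n lam t (- n) n)"
    and e2: "(lam - of_real ((2 * pi * of_int (- n) + t)\<^sup>2)) * u2 = u1 * (fc q (- 2 * n) + path_series q n lam t n (- n)) + u2 * path_series q n lam t (- n) (- n)"
  shows "is_eigenvalue q t lam"
proof -
  interpret path_sums "fc q" "nonresonant n" "gap_weight n" K by (rule ps)
  interpret hill q by unfold_locales (rule q)
  have at: "\<bar>t\<bar> \<le> 1/40" using t by simp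
  have d: "dominated (gap_inverse lam t)" by (rule dominated_gap_inverse[OF ps n at l])
  have nn: "n \<noteq> - n" using n by simp
  define g where "g \<tau> m = G (gap_inverse lam t) \<tau> m" for \<tau> m
  \<comment> \<open>\<open>H m\<close> is to be the m-th coefficient of q Y, so that the equation
    for the mode m reads (lam - \<kappa>_m^2) y_m = H m; for m = n and m = -n this is
    \<open>e1\<close> and \<open>e2\<close>.\<close>
  define H where "H m = u1 * g n m + u2 * g (- n) m" for m
  define y where "y m = (if m = n then u1 else if m = - n then u2 else gap_inverse lam t m * H m)" for m
  define \<kappa> where "\<kappa> m = 2 * pi * of_int m + t" for m
  have gT: "g \<tau> m = fc q (m - \<tau>) + path_series q n lam t \<tau> m" for \<tau> m
    by (simp only: g_def G_def[OF small] path_series_def)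
  have gb: "norm (g \<tau> m) \<le> 2 * K" for \<tau> m unfolding g_def by (rule G_bound[OF small d])
  define Hb where "Hb = norm u1 * (2 * K) + norm u2 * (2 * K)"
  have Hb: "norm (H m) \<le> Hb" for m
    unfolding H_def Hb_def
    by (rule order_trans[OF norm_triangle_ineq]) (simp only: norm_mult, intro add_mono mult_left_mono gb norm_ge_zero)
  have yJ: "y m = gap_inverse lam t m * H m" if "m \<in> nonresonant n" for m using that by (auto simp: y_def nonresonant_def)
  have yn: "y n = u1" "y (- n) = u2" using nn by (auto simp: y_def)
  have lamy: "(lam - of_real ((\<kappa> m)\<^sup>2)) * y m = H m" for m
  proof -
    consider "m \<in> nonresonant n" | "m = n" | "m = - n" by (auto simp: nonresonant_def)
    then show ?thesis
    proof cases
      case 1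
      then have "gap_inverse lam t m * (lam - of_real ((\<kappa> m)\<^sup>2)) = 1"
        unfolding \<kappa>_def by (rule denominator_bound(3)[OF n _ at l])
      then show ?thesis unfolding yJ[OF 1] by algebra
    next
      case 2
      then show ?thesis using e1 q0 by (simp add: yn \<kappa>_def H_def gT)
    next
      case 3
      then show ?thesis using e2 q0 by (simp add: yn \<kappa>_def H_def gT)
    qed
  qed
  have UN: "(UNIV :: int set) = nonresonant n \<union> {n, - n}" "nonresonant n \<inter> {n, - n} = {}" by (auto simp: nonresonant_def)
  have ysJ: "(\<lambda>m. norm (y m)) summable_on nonresonant n"
  proof (rule infsum_dominated(1)[OF D_summable])
    show "norm (y m) \<le> Hb * gap_weight n m" if "m \<in> nonresonant n" for m
    proof -
      have "norm (y m) = norm (gap_inverse lam t m) * norm (H m)" by (simp add: yJ[OF that] norm_mult)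
      also have "\<dots> \<le> gap_weight n m * Hb"
        using denominator_bound(2)[OF n that at l] Hb gap_weight_pos[OF n that] by (intro mult_mono) auto
      finally show ?thesis by (simp add: mult.commute)
    qed
  qed
  have "(\<lambda>m. norm (y m)) summable_on (nonresonant n \<union> {n, - n})"
    by (rule summable_on_Un_disjoint[OF ysJ _ UN(2)]) simp
  then have ys: "(\<lambda>m. norm (y m)) summable_on UNIV" by (simp only: UN(1)[symmetric])
  \<comment> \<open>By \<open>G_equation\<close> the nonresonant modes contribute the series without
    its direct step; the modes n and -n add the direct steps.\<close>
  have conv: "((\<lambda>k. y k * fc q (m - k)) has_sum H m) UNIV" for m
  proof -
    have gs: "(\<lambda>k. fc q (m - k) * gap_inverse lam t k * g \<tau> k) summable_on nonresonant n" for \<tau>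
      by (rule infsum_dominated(2)[OF D_summable step_bound[OF d gb]])
    have gi: "(\<Sum>\<^sub>\<infinity>k\<in>nonresonant n. fc q (m - k) * gap_inverse lam t k * g \<tau> k) = g \<tau> m - fc q (m - \<tau>)" for \<tau>
      using G_equation[OF small d, of \<tau> m] by (simp add: g_def)
    have "((\<lambda>k. u1 * (fc q (m - k) * gap_inverse lam t k * g n k) + u2 * (fc q (m - k) * gap_inverse lam t k * g (- n) k))
        has_sum u1 * (g n m - fc q (m - n)) + u2 * (g (- n) m - fc q (m - (- n)))) (nonresonant n)"
      unfolding gi[symmetric] by (intro has_sum_add has_sum_cmult_right has_sum_infsum gs)
    then have 1: "((\<lambda>k. y k * fc q (m - k)) has_sum u1 * (g n m - fc q (m - n)) + u2 * (g (- n) m - fc q (m - (- n)))) (nonresonant n)"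
      by (rule has_sum_cong[THEN iffD1, rotated]) (simp add: yJ H_def algebra_simps)
    have 2: "((\<lambda>k. y k * fc q (m - k)) has_sum (\<Sum>k\<in>{n, - n}. y k * fc q (m - k))) {n, - n}"
      by (rule has_sum_finite) simp
    have e: "u1 * (g n m - fc q (m - n)) + u2 * (g (- n) m - fc q (m - (- n))) + (\<Sum>k\<in>{n, - n}. y k * fc q (m - k)) = H m"
      using nn by (simp add: yn H_def algebra_simps)
    from has_sum_Un_disjoint[OF 1 2 UN(2)] show ?thesis by (simp only: e UN(1)[symmetric])
  qed
  define Y where "Y x = (\<Sum>\<^sub>\<infinity>k. y k * fexp k x)" for x
  have cY: "continuous_on {0..1} Y" unfolding Y_def[abs_def] by (rule fourier_series_continuous[OF ys])
  have Y10: "Y 1 = Y 0" unfolding Y_def by (rule fourier_series_periodic[OF ys])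
  have fcY: "fc Y m = y m" for m unfolding Y_def[abs_def] by (rule fourier_series_fc[OF ys])
  have fcqY: "fc (\<lambda>x. q x * Y x) m = H m" for m
  proof -
    have "((\<lambda>k. y k * fc q (m - k)) has_sum fc (\<lambda>x. q x * Y x) m) UNIV"
      unfolding Y_def[abs_def] by (rule fourier_series_mult[OF ys q])
    from has_sum_unique[OF this conv] show ?thesis .
  qed
  \<comment> \<open>The candidate for y''. With the twist cis (t x) removed its coefficients are
    -\<kappa>_m^2 y_m, which amounts to applying the multiplier i \<kappa>_m twice.\<close>
  define f where "f x = (q x - lam) * (cis (t * x) * Y x)" for x
  have cc: "cis (t * x) * cis (- t * x) = 1" for x by (simp add: cis_mult)
  have af: "f absolutely_integrable_on {0..1}"
    unfolding f_def[abs_def]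
  proof (rule absolutely_integrable_mult_continuous)
    show "(\<lambda>x. q x - lam) absolutely_integrable_on {0..1}"
      by (rule set_integral_diff(1)[OF q]) (rule absolutely_integrable_continuous_real, intro continuous_intros)
    show "continuous_on {0..1} (\<lambda>x. cis (t * x) * Y x)" by (intro continuous_intros cY)
  qed
  have hatf: "fc (\<lambda>x. f x * cis (- t * x)) m = \<i> * of_real (2 * pi * of_int m + t) * (\<i> * of_real (\<kappa> m) * y m)" for m
  proof -
    have aqY: "(\<lambda>x. q x * Y x) absolutely_integrable_on {0..1}"
      by (rule absolutely_integrable_mult_continuous[OF q cY])
    have alY: "(\<lambda>x. lam * Y x) absolutely_integrable_on {0..1}"
      by (rule absolutely_integrable_continuous_real) (intro continuous_intros cY)
    have "f x * cis (- t * x) = q x * Y x - lam * Y x" for x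
    proof -
      have "f x * cis (- t * x) = (q x - lam) * Y x * (cis (t * x) * cis (- t * x))" by (simp only: f_def mult_ac)
      then show ?thesis by (simp only: cc) (simp add: algebra_simps)
    qed
    then have "fc (\<lambda>x. f x * cis (- t * x)) m = H m - lam * y m"
      using fc_diff[OF aqY alY, of m] by (simp only: fc_cmult fcqY fcY)
    also have "\<dots> = - of_real ((\<kappa> m)\<^sup>2) * y m" unfolding lamy[symmetric] by (simp add: algebra_simps)
    also have "\<dots> = \<i> * of_real (\<kappa> m) * (\<i> * of_real (\<kappa> m) * y m)"
    proof -
      have "\<i> * (of_real (\<kappa> m)) * (\<i> * of_real (\<kappa> m) * y m) = (\<i> * \<i>) * of_real (\<kappa> m * \<kappa> m) * y m"
        by (simp only: of_real_mult mult_ac)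
      then show ?thesis by (simp add: power2_eq_square)
    qed
    finally show ?thesis by (simp only: \<kappa>_def)
  qed
  have t2: "t \<le> pi" using t pi_gt3 by simp
  obtain y1 where y1: "primitive_on01 f y1" "y1 1 = cis t * y1 0"
      "\<forall>m. fc (\<lambda>x. y1 x * cis (- t * x)) m = \<i> * of_real (\<kappa> m) * y m"
    using twisted_antiderivative[OF af t(1) t2 hatf] by (elim exE conjE)
  have cy1: "continuous_on {0..1} y1" by (rule primitive_on01_continuous[OF y1(1)])
  have ay1: "y1 absolutely_integrable_on {0..1}" by (rule absolutely_integrable_continuous_real[OF cy1])
  have haty1: "fc (\<lambda>x. y1 x * cis (- t * x)) m = \<i> * of_real (2 * pi * of_int m + t) * y m" for m
    using y1(3) by (simp only: \<kappa>_def)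
  obtain y2 where y2: "primitive_on01 y1 y2" "y2 1 = cis t * y2 0"
      "\<forall>m. fc (\<lambda>x. y2 x * cis (- t * x)) m = y m"
    using twisted_antiderivative[OF ay1 t(1) t2 haty1] by (elim exE conjE)
  have cy2: "continuous_on {0..1} y2" by (rule primitive_on01_continuous[OF y2(1)])
  have cE: "continuous_on {0..1} (\<lambda>x. y2 x * cis (- t * x))" by (intro continuous_intros cy2)
  \<comment> \<open>With the twist removed both sides are continuous and periodic with the same
    Fourier coefficients.\<close>
  have eqY: "y2 x = cis (t * x) * Y x" if x: "x \<in> {0..1}" for x
  proof -
    have "y2 x * cis (- t * x) - Y x = 0"
    proof (rule fourier_unique[OF _ _ _ x, of "\<lambda>x. y2 x * cis (- t * x) - Y x"])
      show "continuous_on {0..1} (\<lambda>x. y2 x * cis (- t * x) - Y x)" by (intro continuous_intros cE cY)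
      show "y2 1 * cis (- t * 1) - Y 1 = y2 0 * cis (- t * 0) - Y 0"
        using y2(2) cc[of 1] by (simp add: Y10 algebra_simps)
      show "fc (\<lambda>x. y2 x * cis (- t * x) - Y x) m = 0" for m
        using fc_diff[OF absolutely_integrable_continuous_real[OF cE] absolutely_integrable_continuous_real[OF cY], of m]
          y2(3) by (simp only: fcY) simp
    qed
    then have "y2 x * (cis (t * x) * cis (- t * x)) = cis (t * x) * Y x" by (simp add: algebra_simps)
    then show ?thesis by (simp only: cc mult_1_right)
  qed
  have "primitive_on01 (\<lambda>s. (q s - lam) * y2 s + 0) y1"
    by (rule primitive_on01_cong[OF y1(1)]) (simp_all add: f_def eqY)
  then have "ode_sol q lam y2 y1" unfolding ode_sol_iff_hsol hsol_def using y2(1) by simp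
  moreover have "\<exists>x\<in>{0..1}. y2 x \<noteq> 0"
  proof (rule ccontr)
    assume "\<not> (\<exists>x\<in>{0..1}. y2 x \<noteq> 0)"
    then have Y0: "Y x = 0" if "x \<in> {0..1}" for x using eqY[OF that] that by simp
    have "fc Y m = integral {0..1} (\<lambda>x::real. 0)" for m
      unfolding fc_fexp_def by (rule integral_cong) (simp add: Y0)
    then have "y m = 0" for m using fcY[of m] by simp
    then show False using u yn by metis
  qed
  ultimately show ?thesis unfolding is_eigenvalue_def using y1(2) y2(2) by blast
qed

section \<open>The eigenvalues as fixed points\<close>

text \<open>On the nonpositive axis |Im p| and X + Re p would be at most \<eta> T with T = X + |p|.
  If Re p >= 0, this gives T <= 2 \<eta> T <= T / 2. Otherwise X <= |p| + T / 4 gives T <= 3 |p|,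
  and |Im p| <= 3 \<eta> |p| < \<epsilon> |p| contradicts the sector condition.\<close>

lemma sector_avoids_nonpos_Reals:
  fixes p err :: complex
  assumes p: "p \<noteq> 0" and X: "X \<ge> 0" and err: "norm err \<le> \<eta> * (X + norm p)"
    and \<eta>: "0 \<le> \<eta>" "\<eta> \<le> 1 / 4" "8 * \<eta> \<le> \<epsilon>" and \<epsilon>: "\<epsilon> > 0"
    and alt: "Re p \<ge> 0 \<or> \<bar>Im p\<bar> \<ge> \<epsilon> * norm p"
  shows "of_real X + p + err \<notin> \<real>\<^sub>\<le>\<^sub>0"
proof
  assume "of_real X + p + err \<in> \<real>\<^sub>\<le>\<^sub>0"
  then have R: "X + Re p + Re err \<le> 0" and I: "Im p + Im err = 0"
    by (auto simp: complex_nonpos_Reals_iff)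
  define T where "T = X + norm p"
  have np: "norm p > 0" using p by simp
  have T: "T > 0" using np X unfolding T_def by linarith
  have e: "norm err \<le> \<eta> * T" using err by (simp add: T_def)
  have 1: "\<bar>Im p\<bar> \<le> \<eta> * T" using I abs_Im_le_cmod[of err] e by linarith
  have 2: "X + Re p \<le> \<eta> * T" using R abs_Re_le_cmod[of err] e by linarith
  from alt show False
  proof
    assume "Re p \<ge> 0"
    then have "T \<le> 2 * (\<eta> * T)" using 1 2 cmod_le[of p] unfolding T_def by linarith
    moreover have "\<eta> * T \<le> (1/4) * T" using \<eta> T by (intro mult_right_mono) auto
    ultimately show False using T by linarith
  next
    assume a: "\<bar>Im p\<bar> \<ge> \<epsilon> * norm p"
    have "X - norm p \<le> \<eta> * T" using 2 abs_Re_le_cmod[of p] by linarith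
    moreover have "\<eta> * T \<le> (1/4) * T" using \<eta> T by (intro mult_right_mono) auto
    moreover have "X = T - norm p" by (simp add: T_def)
    ultimately have "T \<le> 3 * norm p" using np by linarith
    then have "\<eta> * T \<le> \<eta> * (3 * norm p)" using \<eta> by (intro mult_left_mono) auto
    moreover have "8 * \<eta> * norm p \<le> \<epsilon> * norm p" using \<eta> np by (intro mult_right_mono) auto
    ultimately have "\<epsilon> * norm p \<le> (3/8) * (\<epsilon> * norm p)" using a 1 by linarith
    moreover have "\<epsilon> * norm p > 0" using \<epsilon> np by simp
    ultimately show False by linarith
  qed
qed

lemma Re_csqrt_pos:
  assumes "z \<notin> \<real>\<^sub>\<le>\<^sub>0" shows "Re (csqrt z) > 0"
proof (rule ccontr)
  assume "\<not> Re (csqrt z) > 0"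
  then have R: "Re (csqrt z) = 0" using Re_csqrt[of z] by simp
  define r where "r = csqrt z"
  have "z = r * r" using power2_csqrt[of z] by (simp add: r_def power2_eq_square)
  moreover have "Re r = 0" using R by (simp only: r_def)
  ultimately have "Im z = 0" "Re z \<le> 0" by simp_all
  then show False using assms by (simp add: complex_nonpos_Reals_iff)
qed

lemma two_eigenvalues:
  fixes n :: nat and q :: "real \<Rightarrow> complex"
  assumes q: "q absolutely_integrable_on {0..1}" and q0: "fc q 0 = 0"
    and ps: "path_sums (fc q) (nonresonant (int n)) (gap_weight (int n)) K" and n: "n > 0"
    and small: "K * path_sums.S (nonresonant (int n)) (gap_weight (int n)) \<le> 1 / 4"
    and small2: "2 * K * (K * path_sums.S (nonresonant (int n)) (gap_weight (int n))) \<le> 1 / 32"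
    and t: "0 \<le> t" "t \<le> \<rho>" and \<rho>: "0 < \<rho>" "\<rho> < 1 / 40"
    and big: "K + 4 \<le> 6 * pi * real n * \<rho>" and hI: "real n \<ge> 3600 * hill.I q + 10"
    and B: "\<And>lam. norm (lam - of_real ((2 * pi * of_int (int n))\<^sup>2)) \<le> 2 * \<bar>real_of_int (int n)\<bar> \<Longrightarrow>
        norm (path_series q (int n) lam t (- int n) (int n)) \<le> \<eta> * norm (fc q (2 * int n))"
    and B': "\<And>lam. norm (lam - of_real ((2 * pi * of_int (int n))\<^sup>2)) \<le> 2 * \<bar>real_of_int (int n)\<bar> \<Longrightarrow>
        norm (path_series q (int n) lam t (int n) (- int n)) \<le> \<eta> * norm (fc q (- 2 * int n))"
    and nz: "fc q (2 * int n) \<noteq> 0" "fc q (- 2 * int n) \<noteq> 0"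
    and \<eta>: "0 \<le> \<eta>" "12 * \<eta> \<le> 1" "24 * \<eta> \<le> \<epsilon>" "1 \<le> 3 * \<eta> * real n" and \<epsilon>: "\<epsilon> > 0"
    and alt: "Re (fc q (2 * int n) * fc q (- 2 * int n)) \<ge> 0 \<or>
        \<bar>Im (fc q (2 * int n) * fc q (- 2 * int n))\<bar> \<ge> \<epsilon> * cmod (fc q (2 * int n) * fc q (- 2 * int n))"
  shows "\<exists>lam1 lam2. lam1 \<noteq> lam2 \<and>
                {lam \<in> Dset (int n) t \<rho>. is_eigenvalue q t lam} = {lam1, lam2} \<and>
                simple_eigenvalue q t lam1 \<and> simple_eigenvalue q t lam2 \<and>
                eig_formula q (int n) t 1 lam1 \<and> eig_formula q (int n) t 2 lam2"
proof -
  interpret path_sums "fc q" "nonresonant (int n)" "gap_weight (int n)" K by (rule ps)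
  interpret hill q by unfold_locales (rule q)
  define N where "N = int n"
  have N: "N > 0" "N \<noteq> 0" using n by (simp_all add: N_def)
  have rN: "real_of_int N = real n" by (simp add: N_def)
  have n1: "real n \<ge> 1" using n by simp
  have t40: "t \<le> 1 / 40" "\<bar>t\<bar> \<le> 1 / 40" using t \<rho> by auto
  define q2 qm where "q2 = fc q (2 * N)" and "qm = fc q (- 2 * N)"
  define a where "a = 4 * pi * real n * t"
  have a0: "a \<ge> 0" using t by (simp add: a_def)
  define c0 where "c0 = complex_of_real ((2 * pi * real n + t)\<^sup>2)"
  \<comment> \<open>Radius 14 instead of 15: the closed disc for Brouwer's theorem then lies inside
    the open set \<open>Dset\<close>.\<close>
  define U where "U = cball c0 (14 * pi * real n * \<rho>)"
  define reg where "reg lam \<longleftrightarrow> norm (lam - of_real ((2 * pi * of_int N)\<^sup>2)) \<le> 2 * \<bar>real_of_int N\<bar>" for lam :: complex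
  have regU: "reg lam" if "lam \<in> U" for lam
    unfolding reg_def
  proof (rule Dset_center[OF N(1) t \<rho>(2)])
    have "norm (lam - c0) \<le> 14 * pi * real n * \<rho>" using that by (simp add: U_def dist_norm norm_minus_commute)
    also have "\<dots> \<le> 15 * pi * real n * \<rho>" using \<rho> by (intro mult_right_mono) auto
    finally show "norm (lam - of_real ((2 * pi * of_int N + t)\<^sup>2)) \<le> 15 * pi * of_int N * \<rho>"
      by (simp only: c0_def rN)
  qed
  define A A' Bf Bf' where "A lam = path_series q N lam t N N" and "A' lam = path_series q N lam t (- N) (- N)"
    and "Bf lam = path_series q N lam t (- N) N" and "Bf' lam = path_series q N lam t N (- N)" for lam
  note small' = small[folded N_def] and small2' = small2[folded N_def] and ps' = ps[folded N_def]
  note tf = tail_facts[OF ps' N(2) small' small2']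
  have Ab: "norm (A lam) \<le> 1 / 32" "norm (A' lam) \<le> 1 / 32" "norm (Bf lam) \<le> 1 / 32" "norm (Bf' lam) \<le> 1 / 32"
    if "reg lam" for lam
    unfolding A_def A'_def Bf_def Bf'_def using tf(1)[OF t40(2)] that unfolding reg_def by blast+
  have AA: "norm (A lam - A' lam) \<le> t" if "reg lam" for lam
    unfolding A_def A'_def using tf(2)[OF t(1) t40(1)] that unfolding reg_def by blast
  have cont: "continuous_on U (\<lambda>lam. path_series q N lam t \<tau> m)" for \<tau> m
  proof (rule lipschitz_on_continuous_on[of 1])
    show "1-lipschitz_on U (\<lambda>lam. path_series q N lam t \<tau> m)"
    proof (rule lipschitz_onI)
      show "dist (path_series q N x t \<tau> m) (path_series q N y t \<tau> m) \<le> 1 * dist x y" if "x \<in> U" "y \<in> U" for x y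
        using tf(3)[OF t40(2) regU[OF that(1), unfolded reg_def] regU[OF that(2), unfolded reg_def]]
        by (simp add: dist_norm)
    qed simp
  qed
  have cA: "continuous_on U A" "continuous_on U A'" "continuous_on U Bf" "continuous_on U Bf'"
    unfolding A_def[abs_def] A'_def[abs_def] Bf_def[abs_def] Bf'_def[abs_def] by (rule cont)+
  define Cf where "Cf lam = (A lam - A' lam) / 2" for lam
  \<comment> \<open>\<open>D_fun\<close> regrouped: with a = 4 pi n t it equals (a + C)^2 + (q_2n +
    B) (q_-2n + B').\<close>
  define Dd where "Dd lam = (of_real a + Cf lam)\<^sup>2 + (q2 + Bf lam) * (qm + Bf' lam)" for lam
  have Cb: "norm (Cf lam) \<le> t / 2" if "reg lam" for lam
    using AA[OF that] by (simp add: Cf_def norm_divide)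
  have Bb: "norm (Bf lam) \<le> \<eta> * norm q2" "norm (Bf' lam) \<le> \<eta> * norm qm" if "reg lam" for lam
    using B[of lam] B'[of lam] that by (simp_all add: reg_def Bf_def Bf'_def q2_def qm_def N_def)
  have nz': "q2 \<noteq> 0" "qm \<noteq> 0" using nz by (simp_all add: q2_def qm_def N_def)
  have Dn: "Dd lam \<notin> \<real>\<^sub>\<le>\<^sub>0" if r: "reg lam" for lam
  proof -
    define err where "err = (2 * of_real a * Cf lam + (Cf lam)\<^sup>2) + (q2 * Bf' lam + qm * Bf lam + Bf lam * Bf' lam)"
    have "Dd lam = of_real (a\<^sup>2) + q2 * qm + err"
      by (simp add: Dd_def err_def power2_eq_square algebra_simps)
    moreover have "norm err \<le> (3 * \<eta>) * (a\<^sup>2 + norm (q2 * qm))"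
    proof -
      \<comment> \<open>|C| <= t / 2 is of relative size 1/n against a = 4 pi n t; the condition 1
        <= 3 \<eta> n turns this into the relative error 3 \<eta> that the sector argument
        allows.\<close>
      have na: "a / real n \<le> 3 * \<eta> * a"
      proof -
        have "a * 1 \<le> a * (3 * \<eta> * real n)" by (rule mult_left_mono[OF \<eta>(4) a0])
        then show ?thesis using n1 by (simp add: divide_le_eq mult_ac)
      qed
      have t14: "t \<le> a / 4 / real n * 1"
      proof -
        have "1 * (real n * t) \<le> pi * (real n * t)"
          using pi_gt3 t by (intro mult_right_mono) auto
        then have "t * real n \<le> a / 4" by (simp add: a_def mult_ac)
        then show ?thesis using n1 by (simp add: le_divide_eq)
      qed
      have ta1: "t \<le> a"
      proof -
        have "1 * 1 \<le> (4 * pi) * real n" using pi_gt3 n1 by (intro mult_mono) auto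
        then have "1 * t \<le> (4 * pi * real n) * t" using t by (intro mult_right_mono) auto
        then show ?thesis by (simp add: a_def)
      qed
      have "norm (2 * of_real a * Cf lam + (Cf lam)\<^sup>2) \<le> norm (2 * of_real a * Cf lam) + norm ((Cf lam)\<^sup>2)"
        by (rule norm_triangle_ineq)
      also have "norm (2 * of_real a * Cf lam) = 2 * a * norm (Cf lam)" using a0 by (simp add: norm_mult)
      also have "norm ((Cf lam)\<^sup>2) = norm (Cf lam) * norm (Cf lam)" by (simp add: norm_mult power2_eq_square)
      also have "2 * a * norm (Cf lam) + norm (Cf lam) * norm (Cf lam) \<le> 2 * a * (t / 2) + (t / 2) * (t / 2)"
        using Cb[OF r] a0 t by (intro add_mono mult_left_mono mult_mono) auto
      also have "\<dots> \<le> 2 * a * (t / 2) + (a / 2) * (t / 2)"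
        using ta1 t by (intro add_mono mult_right_mono) auto
      also have "\<dots> = (5/4) * (a * t)" by simp
      also have "a * t \<le> a * (a / 4 / real n * 1)" by (rule mult_left_mono[OF t14 a0])
      also have "(5/4) * (a * (a / 4 / real n * 1)) \<le> a * (a / real n)"
        using a0 n1 by (simp add: field_simps)
      also have "\<dots> \<le> a * (3 * \<eta> * a)" by (rule mult_left_mono[OF na a0])
      finally have 1: "norm (2 * of_real a * Cf lam + (Cf lam)\<^sup>2) \<le> 3 * \<eta> * a\<^sup>2"
        by (simp add: power2_eq_square mult_ac)
      have "norm (q2 * Bf' lam + qm * Bf lam + Bf lam * Bf' lam)
          \<le> norm (q2 * Bf' lam) + norm (qm * Bf lam) + norm (Bf lam * Bf' lam)"
        by (rule order_trans[OF norm_triangle_ineq add_right_mono[OF norm_triangle_ineq]])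
      also have "\<dots> = norm q2 * norm (Bf' lam) + norm qm * norm (Bf lam) + norm (Bf lam) * norm (Bf' lam)"
        by (simp only: norm_mult)
      also have "\<dots> \<le> norm q2 * (\<eta> * norm qm) + norm qm * (\<eta> * norm q2) + (\<eta> * norm q2) * (\<eta> * norm qm)"
        using Bb[OF r] \<eta>(1) by (intro add_mono mult_left_mono mult_mono) auto
      also have "\<dots> = (2 * \<eta> + \<eta> * \<eta>) * norm (q2 * qm)" by (simp add: norm_mult algebra_simps)
      also have "\<dots> \<le> (3 * \<eta>) * norm (q2 * qm)"
      proof (rule mult_right_mono)
        have "\<eta> * \<eta> \<le> \<eta> * 1" using \<eta> by (intro mult_left_mono) auto
        then show "2 * \<eta> + \<eta> * \<eta> \<le> 3 * \<eta>" by simp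
      qed simp
      finally have 2: "norm (q2 * Bf' lam + qm * Bf lam + Bf lam * Bf' lam) \<le> (3 * \<eta>) * norm (q2 * qm)" .
      show ?thesis unfolding err_def
        by (rule order_trans[OF norm_triangle_ineq order_trans[OF add_mono[OF 1 2]]]) (simp add: algebra_simps)
    qed
    moreover have "q2 * qm \<noteq> 0" using nz' by simp
    ultimately show ?thesis
      using sector_avoids_nonpos_Reals[of "q2 * qm" "a\<^sup>2" err "3 * \<eta>" \<epsilon>] \<eta> \<epsilon> alt
      by (simp add: q2_def qm_def N_def)
  qed
  have cD: "continuous_on U (\<lambda>lam. csqrt (Dd lam))"
  proof (rule continuous_on_compose2[OF continuous_on_csqrt])
    show "continuous_on U Dd" unfolding Dd_def[abs_def] Cf_def
      by (intro continuous_intros cA) auto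
    show "Dd ` U \<subseteq> - \<real>\<^sub>\<le>\<^sub>0" using Dn regU by blast
  qed
  have sD: "norm (csqrt (Dd lam)) \<le> a + K + 2" if r: "reg lam" for lam
  proof -
    have "norm (of_real a + Cf lam) \<le> a + 1"
      using norm_triangle_ineq[of "of_real a" "Cf lam"] Cb[OF r] a0 t40 by simp
    then have n1: "norm ((of_real a + Cf lam)\<^sup>2) \<le> (a + 1)\<^sup>2" by (simp add: norm_power power_mono)
    have n2: "norm ((q2 + Bf lam) * (qm + Bf' lam)) \<le> (K + 1) * (K + 1)"
      unfolding norm_mult
    proof (rule mult_mono)
      show "norm (q2 + Bf lam) \<le> K + 1"
        using norm_triangle_ineq[of q2 "Bf lam"] qh_le[of "2 * N"] Ab(3)[OF r] by (simp add: q2_def)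
      show "norm (qm + Bf' lam) \<le> K + 1"
        using norm_triangle_ineq[of qm "Bf' lam"] qh_le[of "- 2 * N"] Ab(4)[OF r] by (simp add: qm_def)
    qed (use K_nonneg in auto)
    have "norm (Dd lam) \<le> (a + 1)\<^sup>2 + (K + 1) * (K + 1)"
      unfolding Dd_def by (rule order_trans[OF norm_triangle_ineq add_mono[OF n1 n2]])
    also have "\<dots> \<le> (a + K + 2)\<^sup>2" using a0 K_nonneg by (simp add: power2_eq_square algebra_simps)
    finally have "(norm (csqrt (Dd lam)))\<^sup>2 \<le> (a + K + 2)\<^sup>2"
      by (simp only: norm_power[symmetric] power2_csqrt)
    moreover have "0 \<le> a + K + 2" using a0 K_nonneg by linarith
    ultimately show ?thesis by (rule power2_le_imp_le)
  qed
  have fixp: "\<exists>lam\<in>U. lam = c0 + (A lam + A' lam) / 2 - of_real a + \<sigma> * csqrt (Dd lam)" if \<sigma>: "norm \<sigma> = 1" for \<sigma> :: complex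
  proof -
    define f where "f lam = c0 + (A lam + A' lam) / 2 - of_real a + \<sigma> * csqrt (Dd lam)" for lam
    have cf: "continuous_on U f" unfolding f_def[abs_def] by (intro continuous_intros cA cD) auto
    have im: "f lam \<in> U" if l: "lam \<in> U" for lam
    proof -
      have r: "reg lam" by (rule regU[OF l])
      have e: "f lam - c0 = (A lam + A' lam) / 2 + (\<sigma> * csqrt (Dd lam) - of_real a)" by (simp add: f_def)
      have "norm (f lam - c0) \<le> norm ((A lam + A' lam) / 2) + (norm (\<sigma> * csqrt (Dd lam)) + norm (of_real a :: complex))"
        unfolding e by (rule order_trans[OF norm_triangle_ineq add_left_mono[OF norm_triangle_ineq4]])
      also have "norm ((A lam + A' lam) / 2) \<le> 1"
        using norm_triangle_ineq[of "A lam" "A' lam"] Ab[OF r] by (simp add: norm_divide)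
      also have "norm (\<sigma> * csqrt (Dd lam)) = norm (csqrt (Dd lam))" by (simp add: norm_mult \<sigma>)
      also have "norm (of_real a :: complex) = a" using a0 by simp
      \<comment> \<open>2 a <= 8 pi n \<rho>, and \<open>big\<close> bounds the remaining K + 3 by 6
        pi n \<rho>; together this is the radius of \<open>U\<close>.\<close>
      finally have "norm (f lam - c0) \<le> 1 + (a + K + 2 + a)" using sD[OF r] by simp
      moreover have "a \<le> 4 * pi * real n * \<rho>" unfolding a_def using t by (intro mult_left_mono) auto
      ultimately have "norm (f lam - c0) \<le> 14 * pi * real n * \<rho>" using big by simp
      then show ?thesis by (simp add: U_def dist_norm norm_minus_commute)
    qed
    have "\<exists>x\<in>U. f x = x"
    proof -
      have "0 \<le> 14 * pi * real n * \<rho>" using \<rho> by simp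
      then have "c0 \<in> U" by (simp only: U_def mem_cball dist_self)
      then have U: "compact U" "convex U" "U \<noteq> {}" unfolding U_def by auto
      have "f \<in> U \<rightarrow> U" using im by (rule funcsetI)
      from brouwer[OF U cf this] obtain x where "x \<in> U" "f x = x" .
      then show ?thesis by (rule bexI[rotated])
    qed
    then obtain x where x: "x \<in> U" "f x = x" by (elim bexE)
    show ?thesis by (rule bexI[OF _ x(1)]) (rule x(2)[unfolded f_def, symmetric])
  qed
  have coef: "A_fun q N lam t = A lam" "B_fun q N lam t = Bf lam" "A'_fun q N lam t = A' lam" "B'_fun q N lam t = Bf' lam"
    if "reg lam" for lam
    unfolding A_def A'_def Bf_def Bf'_def
    using coefficients_eq_tail[OF ps' q0 N(2) t40(2)] that unfolding reg_def by blast+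
  have Dfun: "D_fun q N lam t = Dd lam" if r: "reg lam" for lam
    unfolding D_fun_def C_fun_def coef[OF r] Dd_def Cf_def a_def q2_def qm_def rN
    by (simp add: power2_eq_square field_simps)
  have sols: "eig_formula q N t j lam \<and> lam \<in> Dset N t \<rho> \<and> is_eigenvalue q t lam"
    if l: "lam \<in> U" and eq: "lam = c0 + (A lam + A' lam) / 2 - of_real a + \<sigma> * csqrt (Dd lam)"
      and \<sigma>: "\<sigma> = (-1) ^ j" for lam \<sigma> j
  proof (intro conjI)
    have r: "reg lam" by (rule regU[OF l])
    show "eig_formula q N t j lam"
      unfolding eig_formula_def
    proof (intro exI[of _ "csqrt (Dd lam)"] conjI)
      show "(csqrt (Dd lam))\<^sup>2 = D_fun q N lam t" by (simp only: power2_csqrt Dfun[OF r])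
      show "Re (csqrt (Dd lam)) > 0" by (rule Re_csqrt_pos[OF Dn[OF r]])
      show "lam = of_real ((2 * pi * N + t)\<^sup>2) + (A_fun q N lam t + A'_fun q N lam t) / 2
          - of_real (4 * pi * N * t) + (-1) ^ j * csqrt (Dd lam)"
        using eq unfolding coef[OF r] c0_def a_def rN \<sigma> .
    qed
    show "lam \<in> Dset N t \<rho>"
    proof -
      have "norm (lam - c0) \<le> 14 * pi * real n * \<rho>" using l by (simp add: U_def dist_norm norm_minus_commute)
      also have "\<dots> < 15 * pi * real n * \<rho>" using \<rho> n1 by (intro mult_strict_right_mono) auto
      finally show ?thesis unfolding Dset_def by (simp only: c0_def rN mem_Collect_eq)
    qed
    \<comment> \<open>The null vector is read off from the first row: with these u1 and u2 the first
      equation is an identity, and the second is the vanishing of the determinant.\<close>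
    define u1 where "u1 = q2 + Bf lam"
    define u2 where "u2 = lam - c0 - A lam"
    have u1nz: "u1 \<noteq> 0"
    proof
      assume "u1 = 0"
      then have "norm q2 = norm (Bf lam)" unfolding u1_def by (metis add_eq_0_iff norm_minus_cancel)
      also have "\<dots> \<le> \<eta> * norm q2" by (rule Bb(1)[OF r])
      also have "\<dots> \<le> (1/12) * norm q2" using \<eta> by (intro mult_right_mono) auto
      finally show False using nz' by simp
    qed
    have s2: "\<sigma> * \<sigma> = 1" unfolding \<sigma> by (simp add: power_mult_distrib[symmetric])
    have c1: "of_real ((2 * pi * of_int (- N) + t)\<^sup>2) = c0 - 2 * of_real a"
      by (simp add: c0_def a_def rN power2_eq_square algebra_simps)
    have c2: "of_real ((2 * pi * of_int N + t)\<^sup>2) = c0" by (simp add: c0_def rN)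
    have x: "u2 = \<sigma> * csqrt (Dd lam) - of_real a - Cf lam"
      unfolding u2_def Cf_def by (subst eq) (simp add: field_simps)
    have y: "lam - (c0 - 2 * of_real a) - A' lam = \<sigma> * csqrt (Dd lam) + of_real a + Cf lam"
      unfolding Cf_def by (subst eq) (simp add: field_simps)
    have "csqrt (Dd lam) * csqrt (Dd lam) = Dd lam" using power2_csqrt[of "Dd lam"] by (simp add: power2_eq_square)
    \<comment> \<open>The two factors are \<sigma> sqrt D minus and plus (a + C), so their product
      is D - (a + C)^2, because \<sigma> squares to 1.\<close>
    then have prod: "u2 * (lam - (c0 - 2 * of_real a) - A' lam) = u1 * (qm + Bf' lam)"
      unfolding x y u1_def using s2 Dd_def[of lam, unfolded power2_eq_square] by algebra
    show "is_eigenvalue q t lam"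
    proof (rule eigenvalue_from_reduction[OF q q0 ps' N(2) small' t(1) t40(1) r[unfolded reg_def], of u1 u2])
      show "u1 \<noteq> 0 \<or> u2 \<noteq> 0" using u1nz by simp
      show "(lam - of_real ((2 * pi * of_int N + t)\<^sup>2)) * u1 = u1 * path_series q N lam t N N + u2 * (fc q (2 * N) + path_series q N lam t (- N) N)"
        unfolding c2 A_def[symmetric] Bf_def[symmetric] q2_def[symmetric] u1_def u2_def by (simp add: algebra_simps)
      show "(lam - of_real ((2 * pi * of_int (- N) + t)\<^sup>2)) * u2 = u1 * (fc q (- 2 * N) + path_series q N lam t N (- N)) + u2 * path_series q N lam t (- N) (- N)"
        unfolding c1 A'_def[symmetric] Bf'_def[symmetric] qm_def[symmetric] prod[symmetric] by (simp add: algebra_simps)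
    qed
  qed
  obtain l1 where l1: "l1 \<in> U" "l1 = c0 + (A l1 + A' l1) / 2 - of_real a + (- 1) * csqrt (Dd l1)"
    using fixp[of "-1"] by auto
  obtain l2 where l2: "l2 \<in> U" "l2 = c0 + (A l2 + A' l2) / 2 - of_real a + 1 * csqrt (Dd l2)"
    using fixp[of 1] by auto
  have s1: "eig_formula q N t 1 l1 \<and> l1 \<in> Dset N t \<rho> \<and> is_eigenvalue q t l1"
    by (rule sols[OF l1]) simp
  have s2: "eig_formula q N t 2 l2 \<and> l2 \<in> Dset N t \<rho> \<and> is_eigenvalue q t l2"
    by (rule sols[OF l2]) simp
  \<comment> \<open>The two equations differ only in the sign of the root, so equality would make
    sqrt D its own negative, against its positive real part.\<close>
  have ne: "l1 \<noteq> l2"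
  proof
    assume e: "l1 = l2"
    have "csqrt (Dd l1) = - csqrt (Dd l1)"
      using l1(2) l2(2) unfolding e by (metis add_left_cancel mult_1_left mult_minus_left)
    then have "csqrt (Dd l1) = 0" by simp
    then show False using Re_csqrt_pos[OF Dn[OF regU[OF l1(1)]]] by simp
  qed
  have cd: "char_det q t lam = 0" if h: "lam \<in> Dset N t \<rho>" "is_eigenvalue q t lam" for lam
  proof -
    obtain \<zeta> where z: "norm \<zeta> < 1 / 4" "lam = (of_real (2 * pi * real n) + \<zeta>)\<^sup>2"
      using Dset_square[OF n t \<rho>(2) h(1)[unfolded N_def]] by metis
    have "adm (of_real (2 * pi * real n) + \<zeta>)" by (rule adm_shift(1)[OF hI]) (use z in simp)
    from eigenvalue_hill_F[OF this] show ?thesis using h(2) unfolding z(2) .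
  qed
  note two = char_det_two_zeros[OF hI t \<rho>(2), folded N_def]
  have c1: "char_det q t l1 = 0" and c2: "char_det q t l2 = 0" using cd s1 s2 by blast+
  have z1: "zorder (char_det q t) l1 = 1"
    by (rule two(1)[of l1 l2]) (use s1 s2 c1 c2 ne in auto)
  have z2: "zorder (char_det q t) l2 = 1"
    by (rule two(1)[of l2 l1]) (use s1 s2 c1 c2 ne in auto)
  have "{lam \<in> Dset N t \<rho>. is_eigenvalue q t lam} = {l1, l2}"
  proof
    show "{lam \<in> Dset N t \<rho>. is_eigenvalue q t lam} \<subseteq> {l1, l2}"
    proof
      fix lam assume "lam \<in> {lam \<in> Dset N t \<rho>. is_eigenvalue q t lam}"
      then have h: "lam \<in> Dset N t \<rho>" "is_eigenvalue q t lam" by auto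
      have "lam = l1 \<or> lam = l2"
        by (rule two(2)[of l1 l2]) (use s1 s2 c1 c2 ne h cd in auto)
      then show "lam \<in> {l1, l2}" by simp
    qed
    show "{l1, l2} \<subseteq> {lam \<in> Dset N t \<rho>. is_eigenvalue q t lam}" using s1 s2 by simp
  qed
  then show ?thesis
    using s1 s2 z1 z2 ne unfolding simple_eigenvalue_def N_def by blast
qed

theorem theorem2:
  fixes q :: "real \<Rightarrow> complex" and p s :: nat and d :: "nat \<Rightarrow> real \<Rightarrow> complex"
    and c \<epsilon> :: real
  assumes periodic: "\<forall>x. q (x + 1) = q x"
    and L1: "q absolutely_integrable_on {0..1}"
    and q0: "fc q 0 = 0"
    and W: "sobolev_W1 p q d"
    and sp: "s \<le> p"
    and bc: "\<forall>k<s. d k 0 = d k 1"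
    and equiv: "(\<lambda>n::nat. fc q (2 * int n)) \<in> \<Theta>(\<lambda>n. fc q (- 2 * int n))"
    and c_pos: "c > 0" and eps_pos: "\<epsilon> > 0"
    and lower: "\<forall>\<^sub>F n in sequentially. cmod (fc q (2 * int n)) > c * real n powr (- real s - 1)"
    and alt: "\<forall>\<^sub>F n in sequentially.
                 Re (fc q (2 * int n) * fc q (- 2 * int n)) \<ge> 0 \<or>
                 \<bar>Im (fc q (2 * int n) * fc q (- 2 * int n))\<bar>
                   \<ge> \<epsilon> * cmod (fc q (2 * int n) * fc q (- 2 * int n))"
  shows "\<exists>\<rho>0>0. \<forall>\<rho>. 0 < \<rho> \<and> \<rho> < \<rho>0 \<longrightarrow>
           (\<forall>\<^sub>F n in sequentially. \<forall>t\<in>{0..\<rho>}.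
              \<exists>lam1 lam2. lam1 \<noteq> lam2 \<and>
                {lam \<in> Dset (int n) t \<rho>. is_eigenvalue q t lam} = {lam1, lam2} \<and>
                simple_eigenvalue q t lam1 \<and> simple_eigenvalue q t lam2 \<and>
                eig_formula q (int n) t 1 lam1 \<and> eig_formula q (int n) t 2 lam2)"
proof -
  have "(\<lambda>n::nat. fc q (2 * int n)) \<in> O(\<lambda>n. fc q (- 2 * int n))"
    using equiv by (rule bigthetaD1)
  then obtain c' where c': "c' > 0" "\<forall>\<^sub>F n in sequentially. norm (fc q (2 * int n)) \<le> c' * norm (fc q (- 2 * int n))"
    by (elim landau_o.bigE)
  \<comment> \<open>The sector argument is run with 3 \<eta>: it asks for 3 \<eta> <= 1/4 and 24
    \<eta> <= \<epsilon>.\<close>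
  define \<eta> where "\<eta> = min (1/12) (\<epsilon> / 24)"
  have \<eta>: "\<eta> > 0" "12 * \<eta> \<le> 1" "24 * \<eta> \<le> \<epsilon>" using eps_pos by (auto simp: \<eta>_def min_def)
  \<comment> \<open>Chosen so that both \<delta> and c' \<delta> are at most \<eta> c: the first
    compares B with q_2n, the second, through |q_2n| <= c' |q_-2n|, compares B' with q_-2n.\<close>
  define \<delta> where "\<delta> = \<eta> * c / (1 + c')"
  have \<delta>: "\<delta> > 0" using \<eta> c_pos c' by (simp add: \<delta>_def)
  obtain K N0 where ps: "\<forall>n. n \<noteq> 0 \<longrightarrow> path_sums (fc q) (nonresonant n) (gap_weight n) K" and N0: "N0 > 0"
    and est: "\<forall>M. \<bar>M\<bar> \<ge> int N0 \<longrightarrow>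
       K * path_sums.S (nonresonant M) (gap_weight M) \<le> 1 / 4 \<and> 2 * K * (K * path_sums.S (nonresonant M) (gap_weight M)) \<le> 1 / 32 \<and>
       (\<forall>lam \<sigma>. \<bar>\<sigma>\<bar> \<le> 1 / 40 \<longrightarrow> norm (lam - of_real ((2 * pi * of_int M)\<^sup>2)) \<le> 2 * \<bar>real_of_int M\<bar> \<longrightarrow>
         norm (path_series q M lam \<sigma> (- M) M) \<le> \<delta> / \<bar>real_of_int M\<bar> ^ Suc s)"
    using path_sum_estimates[OF L1 q0 W sp bc \<delta>] by (elim exE conjE)
  have main: "\<forall>\<^sub>F n in sequentially. \<forall>t\<in>{0..\<rho>}.
              \<exists>lam1 lam2. lam1 \<noteq> lam2 \<and>
                {lam \<in> Dset (int n) t \<rho>. is_eigenvalue q t lam} = {lam1, lam2} \<and>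
                simple_eigenvalue q t lam1 \<and> simple_eigenvalue q t lam2 \<and>
                eig_formula q (int n) t 1 lam1 \<and> eig_formula q (int n) t 2 lam2"
    if \<rho>: "0 < \<rho>" "\<rho> < 1 / 40" for \<rho>
  proof -
    \<comment> \<open>The four entries serve, in this order, the coupling estimates, the self-map of
      the disc, the zero count and the relative error of C.\<close>
    define R where "R = max (real N0) (max ((K + 4) / (6 * pi * \<rho>)) (max (3600 * hill.I q + 10) (1 / (3 * \<eta>))))"
    have "\<forall>\<^sub>F n in sequentially. R \<le> real n"
      by (rule eventually_sequentiallyI[of "nat \<lceil>R\<rceil>"]) linarith
    then show ?thesis using c'(2) lower alt
    proof eventually_elim
      case (elim n)
      have R: "real N0 \<le> real n" "(K + 4) / (6 * pi * \<rho>) \<le> real n" "3600 * hill.I q + 10 \<le> real n" "1 / (3 * \<eta>) \<le> real n"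
        using elim(1) unfolding R_def by simp_all
      have n: "n > 0" using R(1) N0 by simp
      have Nn: "\<bar>int n\<bar> \<ge> int N0" "\<bar>- int n\<bar> \<ge> int N0" using R(1) by simp_all
      have big: "K + 4 \<le> 6 * pi * real n * \<rho>" using R(2) \<rho> by (simp add: divide_le_eq mult_ac)
      have \<eta>n: "1 \<le> 3 * \<eta> * real n" using R(4) \<eta> by (simp add: divide_le_eq mult_ac)
      have pw: "real n powr (- real s - 1) = 1 / real n ^ Suc s"
      proof -
        have "- real s - 1 = - real (Suc s)" by simp
        then have "real n powr (- real s - 1) = inverse (real n powr real (Suc s))" by (simp only: powr_minus)
        also have "real n powr real (Suc s) = real n ^ Suc s" using n by (intro powr_realpow) simp
        finally show ?thesis by (simp add: inverse_eq_divide)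
      qed
      have q2: "c / real n ^ Suc s < norm (fc q (2 * int n))" using elim(3) unfolding pw by simp
      have n0: "c / real n ^ Suc s > 0" using c_pos n by simp
      have nz1: "fc q (2 * int n) \<noteq> 0" using q2 n0 by auto
      have nz2: "fc q (- 2 * int n) \<noteq> 0"
      proof
        assume "fc q (- 2 * int n) = 0"
        then show False using elim(2) nz1 by simp
      qed
      have d1: "\<delta> / real n ^ Suc s \<le> \<eta> * norm (fc q (2 * int n))"
      proof -
        have "\<delta> \<le> \<eta> * c" unfolding \<delta>_def using \<eta> c_pos c' by (simp add: divide_le_eq)
        then have "\<delta> / real n ^ Suc s \<le> \<eta> * (c / real n ^ Suc s)" by (simp add: divide_right_mono)
        also have "\<dots> \<le> \<eta> * norm (fc q (2 * int n))" using \<eta> q2 by (intro mult_left_mono) auto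
        finally show ?thesis .
      qed
      have d2: "\<delta> / real n ^ Suc s \<le> \<eta> * norm (fc q (- 2 * int n))"
      proof -
        have "\<delta> * c' \<le> \<eta> * c" unfolding \<delta>_def using \<eta> c_pos c' by (simp add: divide_le_eq algebra_simps)
        then have "(\<delta> * c') / real n ^ Suc s \<le> (\<eta> * c) / real n ^ Suc s" by (rule divide_right_mono) simp
        also have "\<dots> = \<eta> * (c / real n ^ Suc s)" by simp
        also have "\<dots> \<le> \<eta> * norm (fc q (2 * int n))" using \<eta> q2 by (intro mult_left_mono) auto
        also have "\<dots> \<le> \<eta> * (c' * norm (fc q (- 2 * int n)))" using \<eta> elim(2) by (intro mult_left_mono) auto
        finally have "c' * (\<delta> / real n ^ Suc s) \<le> c' * (\<eta> * norm (fc q (- 2 * int n)))" by (simp add: mult_ac)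
        then show ?thesis using c'(1) by (simp only: mult_le_cancel_left_pos)
      qed
      have psn: "path_sums (fc q) (nonresonant (int n)) (gap_weight (int n)) K" using ps n by simp
      note e1 = est[rule_format, OF Nn(1)] and e2 = est[rule_format, OF Nn(2)]
      have TU: "path_series q (- M) lam \<sigma> \<tau> m = path_series q M lam \<sigma> \<tau> m" for M lam \<sigma> \<tau> m
        unfolding path_series_def nonresonant_uminus ..
      show ?case
      proof
        fix t assume "t \<in> {0..\<rho>}"
        then have t: "0 \<le> t" "t \<le> \<rho>" by auto
        then have t40: "\<bar>t\<bar> \<le> 1 / 40" using \<rho> by simp
        show "\<exists>lam1 lam2. lam1 \<noteq> lam2 \<and>
                {lam \<in> Dset (int n) t \<rho>. is_eigenvalue q t lam} = {lam1, lam2} \<and>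
                simple_eigenvalue q t lam1 \<and> simple_eigenvalue q t lam2 \<and>
                eig_formula q (int n) t 1 lam1 \<and> eig_formula q (int n) t 2 lam2"
        proof (rule two_eigenvalues[OF L1 q0 psn n _ _ t \<rho> big R(3) _ _ nz1 nz2 less_imp_le[OF \<eta>(1)] \<eta>(2,3) \<eta>n eps_pos elim(4)])
          show "K * path_sums.S (nonresonant (int n)) (gap_weight (int n)) \<le> 1 / 4"
            "2 * K * (K * path_sums.S (nonresonant (int n)) (gap_weight (int n))) \<le> 1 / 32" using e1 by blast+
          fix lam :: complex assume l: "norm (lam - of_real ((2 * pi * of_int (int n))\<^sup>2)) \<le> 2 * \<bar>real_of_int (int n)\<bar>"
          have "norm (path_series q (int n) lam t (- int n) (int n)) \<le> \<delta> / \<bar>real_of_int (int n)\<bar> ^ Suc s"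
            using e1 t40 l by blast
          also have "\<dots> = \<delta> / real n ^ Suc s" by simp
          finally show "norm (path_series q (int n) lam t (- int n) (int n)) \<le> \<eta> * norm (fc q (2 * int n))" using d1 by linarith
          \<comment> \<open>For M = -n the estimate concerns the paths from -n to n, that is B'; the
            disc and the nonresonant set do not change.\<close>
          have l': "norm (lam - of_real ((2 * pi * of_int (- int n))\<^sup>2)) \<le> 2 * \<bar>real_of_int (- int n)\<bar>" using l by simp
          have "norm (path_series q (- int n) lam t (- (- int n)) (- int n)) \<le> \<delta> / \<bar>real_of_int (- int n)\<bar> ^ Suc s"
            using e2 t40 l' by blast
          also have "\<dots> = \<delta> / real n ^ Suc s" by simp
          finally show "norm (path_series q (int n) lam t (int n) (- int n)) \<le> \<eta> * norm (fc q (- 2 * int n))"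
            using d2 unfolding TU minus_minus by linarith
        qed
      qed
    qed
  qed
  show ?thesis
    by (rule exI[of _ "1/40"]) (use main in auto)
qed

end
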